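(* Let $s\in(0,1)$, let $n>2s$, let $\Omega\subset\mathbb{R}^n$ be a bounded open set with $C^1$ boundary, and put $2^*_s:=\frac{2n}{n-2s}$. Let $g:\Omega\times\mathbb{R}\to\mathbb{R}$ and assume that there exist $c>0$ and $q\in[2,2^*_s]$ such that $$|g(x,t)|\leq c\,(1+|t|^{q-1})\qquad\text{for a.e. }x\in\Omega,\ t\in\mathbb{R}.$$ Let $u\in X_0^1$ be a weak solution of $$-\Delta u+(-\Delta)^su=g(x,u)\ \text{ in }\Omega,\qquad u=0\ \text{ in }\mathbb{R}^n\setminus\Omega.$$ Then $u\in L^\infty(\Omega)$. More precisely, there exists a constant $C_0=C_0(c,n,s,\Omega)>0$, independent of $u$, such that $$\|u\|_{L^\infty(\Omega)}\leq C_0\left(1+\int_\Omega|u|^{2^*_s\beta_1}\,dx\right)^{\frac{1}{2^*_s(\beta_1-1)}},\qquad\text{where }\beta_1:=\frac{2^*_s+1}{2}.$$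
   Context: The space $X^1$ consists of all Lebesgue measurable functions $u:\mathbb{R}^n\to\mathbb{R}$ such that $u|_\Omega\in H^1(\Omega)$ and $\frac{|u(x)-u(y)|}{|x-y|^{(n+2s)/2}}\in L^2(\mathbb{R}^{2n})$. The space $X_0^1$ is $\{u\in X^1: u=0\text{ a.e. in }\mathbb{R}^n\setminus\Omega\}$. A function $u\in X_0^1$ is a weak solution of the problem if $$\int_\Omega\langle\nabla u,\nabla\varphi\rangle\,dx+\iint_{\mathbb{R}^{2n}}\frac{(u(x)-u(y))(\varphi(x)-\varphi(y))}{|x-y|^{n+2s}}\,dx\,dy=\int_\Omega g(x,u(x))\varphi(x)\,dx$$ for every $\varphi\in X_0^1$ (it is understood that $x\mapsto g(x,u(x))$ is measurable, so that the right-hand side makes sense). The solution may or may not change sign. *)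

theory Defs
  imports "HOL-Analysis.Analysis" "HOL-Probability.Essential_Supremum"
begin

text \<open>
  Throughout, $\mathbb{R}^n$ is an arbitrary type \<open>'a::euclidean_space\<close> with
  $n = $ \<open>DIM('a)\<close>, and $\mathbb{R}^{2n}$ is \<open>'a \<times> 'a\<close>. A function on $\Omega$ is a total
  function of which only the values on $\Omega$ are used.
\<close>

text \<open>\<open>C_k k f\<close>: all iterated directional derivatives of \<open>f\<close> up to order \<open>k\<close> exist
  everywhere and are continuous.\<close>

primrec C_k :: "nat \<Rightarrow> ('a::euclidean_space \<Rightarrow> real) \<Rightarrow> bool" where
  "C_k 0 f \<longleftrightarrow> continuous_on UNIV f"
| "C_k (Suc k) f \<longleftrightarrow>
     (\<forall>x. f differentiable (at x)) \<and> (\<forall>v. C_k k (\<lambda>x. frechet_derivative f (at x) v))"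

definition test_function :: "'a::euclidean_space set \<Rightarrow> ('a \<Rightarrow> real) \<Rightarrow> bool" where
  "test_function \<Omega> \<phi> \<longleftrightarrow>
     (\<forall>k. C_k k \<phi>) \<and> compact (closure {x. \<phi> x \<noteq> 0}) \<and> closure {x. \<phi> x \<noteq> 0} \<subseteq> \<Omega>"

text \<open>
  Every boundary point has a ball in which $\Omega$ is, after a rigid motion, the region strictly
  above the graph of a $C^1$ function of $n-1$ variables. The vertical direction is the unit
  vector \<open>e\<close>; the graph function \<open>\<gamma>\<close> is only evaluated at the orthogonal projection
  \<open>x - (x \<bullet> e) *\<^sub>R e\<close> of \<open>x\<close> to the hyperplane orthogonal to \<open>e\<close>.
\<close>

definition C1_boundary :: "'a::euclidean_space set \<Rightarrow> bool" where
  "C1_boundary \<Omega> \<longleftrightarrow>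
     (\<forall>x0\<in>frontier \<Omega>. \<exists>r>0. \<exists>e \<gamma>. norm e = 1 \<and> C_k 1 \<gamma> \<and>
        \<Omega> \<inter> ball x0 r = {x \<in> ball x0 r. \<gamma> (x - (x \<bullet> e) *\<^sub>R e) < x \<bullet> e})"

definition L2 :: "'a measure \<Rightarrow> ('a \<Rightarrow> 'b::euclidean_space) \<Rightarrow> bool" where
  "L2 M f \<longleftrightarrow> f \<in> borel_measurable M \<and> integrable M (\<lambda>x. (norm (f x))\<^sup>2)"

definition locally_integrable :: "'a::euclidean_space set \<Rightarrow> ('a \<Rightarrow> 'b::euclidean_space) \<Rightarrow> bool" where
  "locally_integrable \<Omega> f \<longleftrightarrow> (\<forall>K. compact K \<and> K \<subseteq> \<Omega> \<longrightarrow> integrable (lebesgue_on K) f)"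

definition has_weak_gradient ::
  "'a::euclidean_space set \<Rightarrow> ('a \<Rightarrow> real) \<Rightarrow> ('a \<Rightarrow> 'a) \<Rightarrow> bool" where
  "has_weak_gradient \<Omega> u G \<longleftrightarrow>
     locally_integrable \<Omega> u \<and> locally_integrable \<Omega> G \<and>
     (\<forall>\<phi> v. test_function \<Omega> \<phi> \<longrightarrow>
        (\<integral>x. u x * frechet_derivative \<phi> (at x) v \<partial>lebesgue_on \<Omega>) =
        - (\<integral>x. (G x \<bullet> v) * \<phi> x \<partial>lebesgue_on \<Omega>))"

text \<open>Weak gradients are unique up to null sets of $\Omega$, so the choice of representative below
  does not affect integrals over $\Omega$.\<close>

definition weak_gradient :: "'a::euclidean_space set \<Rightarrow> ('a \<Rightarrow> real) \<Rightarrow> 'a \<Rightarrow> 'a" where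
  "weak_gradient \<Omega> u = (SOME G. has_weak_gradient \<Omega> u G)"

definition H1 :: "'a::euclidean_space set \<Rightarrow> ('a \<Rightarrow> real) set" where
  "H1 \<Omega> = {u. L2 (lebesgue_on \<Omega>) u \<and> (\<exists>G. has_weak_gradient \<Omega> u G \<and> L2 (lebesgue_on \<Omega>) G)}"

text \<open>In the two double integrals below, the integrands vanish on the (null) diagonal, since
  \<open>0 / 0 = 0\<close>.\<close>

definition X1 :: "real \<Rightarrow> 'a::euclidean_space set \<Rightarrow> ('a \<Rightarrow> real) set" where
  "X1 s \<Omega> = {u. u \<in> borel_measurable lebesgue \<and> u \<in> H1 \<Omega> \<and>
     L2 (lebesgue :: ('a \<times> 'a) measure)
       (\<lambda>(x, y). \<bar>u x - u y\<bar> / norm (x - y) powr ((real DIM('a) + 2 * s) / 2))}"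

definition X1_0 :: "real \<Rightarrow> 'a::euclidean_space set \<Rightarrow> ('a \<Rightarrow> real) set" where
  "X1_0 s \<Omega> = {u \<in> X1 s \<Omega>. AE x in lebesgue. x \<notin> \<Omega> \<longrightarrow> u x = 0}"

definition weak_solution ::
  "real \<Rightarrow> 'a::euclidean_space set \<Rightarrow> ('a \<Rightarrow> real \<Rightarrow> real) \<Rightarrow> ('a \<Rightarrow> real) \<Rightarrow> bool" where
  "weak_solution s \<Omega> g u \<longleftrightarrow>
     u \<in> X1_0 s \<Omega> \<and>
     (\<lambda>x. g x (u x)) \<in> borel_measurable (lebesgue_on \<Omega>) \<and>
     (\<forall>\<phi>\<in>X1_0 s \<Omega>.
        (\<integral>x. weak_gradient \<Omega> u x \<bullet> weak_gradient \<Omega> \<phi> x \<partial>lebesgue_on \<Omega>) +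
        (\<integral>(x, y). (u x - u y) * (\<phi> x - \<phi> y) / norm (x - y) powr (real DIM('a) + 2 * s)
           \<partial>(lebesgue :: ('a \<times> 'a) measure)) =
        (\<integral>x. g x (u x) * \<phi> x \<partial>lebesgue_on \<Omega>))"

text \<open>The critical exponent $2^*_s = 2n/(n-2s)$.\<close>

definition critical_exponent :: "nat \<Rightarrow> real \<Rightarrow> real" where
  "critical_exponent n s = 2 * real n / (real n - 2 * s)"

definition Linfty_norm :: "'a::euclidean_space set \<Rightarrow> ('a \<Rightarrow> real) \<Rightarrow> ereal" where
  "Linfty_norm \<Omega> u = esssup (lebesgue_on \<Omega>) (\<lambda>x. ereal \<bar>u x\<bar>)"

definition Linfty :: "'a::euclidean_space set \<Rightarrow> ('a \<Rightarrow> real) set" where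
  "Linfty \<Omega> = {u \<in> borel_measurable (lebesgue_on \<Omega>). Linfty_norm \<Omega> u < \<infinity>}"

end

theory Submission
  imports Defs
begin

text \<open>
  Testing the equation with \<open>F \<circ> u\<close>, where \<open>F' = (H')\<^sup>2\<close> and \<open>H' t = min \<bar>t\<bar> T powr \<kappa>\<close>, makes
  the local term nonnegative (chain rule for weak gradients) and bounds the nonlocal term below by
  the Gagliardo energy of \<open>H \<circ> u\<close> (Cauchy--Schwarz). The fractional Sobolev inequality then
  controls the \<open>2\<^sup>*\<^sub>s\<close>-norm of \<open>H \<circ> u\<close> by the integral of \<open>\<bar>g x u\<bar> \<bar>F u\<bar>\<close>. Absorbing the
  critical part where \<open>\<bar>u\<bar>\<close> is large (Brezis--Kato) gives all powers of \<open>u\<close> integrable, and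
  Moser's iteration along \<open>\<beta>\<^bsub>k+1\<^esub> - 1 = (2\<^sup>*\<^sub>s / 2) (\<beta>\<^sub>k - 1)\<close> gives the bound.

  The fractional Sobolev inequality is proved by averaging \<open>w x\<close> over a ball about \<open>x\<close> of a radius
  that balances the Gagliardo term at \<open>x\<close> against the global \<open>2\<^sup>*\<^sub>s\<close>-norm; integrating the
  resulting pointwise bound lets one divide by a power of that norm, which is finite after
  truncation.
\<close>

section \<open>The fractional Sobolev inequality\<close>

text \<open>The constant must not depend on \<open>u\<close>, whereas the absorption of the critical
  term does: its threshold \<open>R\<close> comes from the tail of the integral of
  \<open>|u| powr p\<close>. Absorption is therefore used only for finiteness of the power
  integrals, which the Moser step takes as a hypothesis; every constant in the bound comes from the
  Moser step. With \<open>\<kappa> = \<beta> - 1\<close>, one step leads from the exponent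
  \<open>p + 2 * \<kappa>\<close> (growth \<open>p - 1\<close> plus degree
  \<open>2 * \<kappa> + 1\<close> of \<open>F\<close>) to \<open>p * (\<kappa> + 1)\<close>, so the
  factor \<open>p / 2\<close> on \<open>\<kappa>\<close> makes the output of one step the input of
  the next. The final power \<open>1 / (p * (\<beta>\<^sub>1 - 1))\<close> is the limit of
  \<open>(p / 2) ^ k / (p * (\<kappa> k + 1))\<close>. Truncation at \<open>T\<close> has two
  purposes: \<open>F'\<close> becomes bounded and Lipschitz, so \<open>F\<close> composed with
  \<open>u\<close> is an admissible test function, and \<open>H\<close> grows linearly, so the
  quantity to be absorbed is finite beforehand. Weak gradients are picked by choice, so the sign of
  the local term needs their uniqueness besides the chain rule; both rest on the lemma of du
  Bois-Reymond.\<close>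

lemma square_le_level_powr:
  fixes t \<kappa> p :: real
  assumes "0 \<le> t" "0 < \<kappa>" "2 \<le> p"
  shows "t\<^sup>2 \<le> \<kappa>\<^sup>2 + \<kappa> powr (2 - p) * t powr p"
proof (cases "t \<le> \<kappa>")
  case True
  then have "t\<^sup>2 \<le> \<kappa>\<^sup>2" using assms by (simp add: power_mono)
  then show ?thesis by (simp add: add_increasing2)
next
  case False
  then have "t powr (2 - p) \<le> \<kappa> powr (2 - p)"
    using assms by (intro powr_mono2') auto
  then have "t powr (2 - p) * t powr p \<le> \<kappa> powr (2 - p) * t powr p"
    by (intro mult_right_mono) auto
  moreover have "t powr (2 - p) * t powr p = t\<^sup>2"
    using False assms by (simp flip: powr_add)
  ultimately show ?thesis by (simp add: add_increasing)
qed

text \<open>Integrate \<open>(w x)\<^sup>2 \<le> 2 * (w x - w y)\<^sup>2 + 2 * (w y)\<^sup>2\<close>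
  over \<open>y\<close> in the ball. There \<open>norm (x - y) < r\<close>, so the kernel costs at
  most \<open>r powr a\<close>. The average of \<open>(w y)\<^sup>2\<close> is split at a free level
  \<kappa> by \<open>square_le_level_powr\<close>; optimising \<kappa> later replaces Hoelder's
  inequality.\<close>

lemma gagliardo_average_bound:
  fixes w :: "'a::euclidean_space \<Rightarrow> real" and a p r P d \<kappa> :: real
  assumes w[measurable]: "w \<in> borel_measurable borel" and "2 \<le> p" "0 \<le> a" "0 < r" "0 < \<kappa>" "0 \<le> P" "0 \<le> d"
    and P: "(\<integral>\<^sup>+y. ennreal (\<bar>w y\<bar> powr p) \<partial>lborel) \<le> ennreal P"
    and d: "(\<integral>\<^sup>+y. ennreal ((w x - w y)\<^sup>2 / norm (x - y) powr a) \<partial>lborel) \<le> ennreal d"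
  defines "V \<equiv> unit_ball_vol DIM('a) * r ^ DIM('a)"
  shows "(w x)\<^sup>2 * V \<le> 2 * r powr a * d + 2 * (\<kappa>\<^sup>2 * V + \<kappa> powr (2 - p) * P)"
proof -
  let ?B = "ball x r"
  have [measurable]: "?B \<in> sets borel" by simp
  have V: "emeasure lborel ?B = ennreal V"
    using emeasure_ball[of r x] \<open>0 < r\<close> by (simp add: V_def)
  have V0: "0 \<le> V" using \<open>0 < r\<close> by (simp add: V_def)
  have pw: "(w x)\<^sup>2 * indicator ?B y \<le> 2 * r powr a * ((w x - w y)\<^sup>2 / norm (x - y) powr a)
      + (2 * \<kappa>\<^sup>2 * indicator ?B y + 2 * \<kappa> powr (2 - p) * \<bar>w y\<bar> powr p)" for y
  proof (cases "y \<in> ?B")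
    case True
    have 1: "(w x - w y)\<^sup>2 \<le> r powr a * ((w x - w y)\<^sup>2 / norm (x - y) powr a)"
    proof (cases "x = y")
      case False
      have "norm (x - y) powr a \<le> r powr a"
        using True assms by (intro powr_mono2) (auto simp: dist_norm)
      moreover have "norm (x - y) powr a > 0" using False by simp
      ultimately have "1 \<le> r powr a / norm (x - y) powr a" by simp
      then have "(w x - w y)\<^sup>2 * 1 \<le> (w x - w y)\<^sup>2 * (r powr a / norm (x - y) powr a)"
        by (intro mult_left_mono) auto
      then show ?thesis by (simp add: mult.commute)
    qed simp
    have "(w x)\<^sup>2 = ((w x - w y) + w y)\<^sup>2" by simp
    also have "\<dots> \<le> 2 * (w x - w y)\<^sup>2 + 2 * (w y)\<^sup>2"
      using zero_le_power2[of "w x - 2 * w y"] by (simp add: power2_eq_square algebra_simps)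
    finally have 2: "(w x)\<^sup>2 \<le> 2 * (w x - w y)\<^sup>2 + 2 * (w y)\<^sup>2" .
    have 3: "(w y)\<^sup>2 \<le> \<kappa>\<^sup>2 + \<kappa> powr (2 - p) * \<bar>w y\<bar> powr p"
      using square_le_level_powr[of "\<bar>w y\<bar>" \<kappa> p] assms by simp
    show ?thesis using 1 2 3 True by (simp add: algebra_simps)
  next
    case False
    then show ?thesis by simp
  qed
  have "ennreal ((w x)\<^sup>2 * V) = (\<integral>\<^sup>+y. ennreal ((w x)\<^sup>2 * indicator ?B y) \<partial>lborel)"
    by (simp add: ennreal_mult' ennreal_indicator nn_integral_cmult_indicator V)
  also have "\<dots> \<le> (\<integral>\<^sup>+y. ennreal (2 * r powr a * ((w x - w y)\<^sup>2 / norm (x - y) powr a)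
      + (2 * \<kappa>\<^sup>2 * indicator ?B y + 2 * \<kappa> powr (2 - p) * \<bar>w y\<bar> powr p)) \<partial>lborel)"
    by (intro nn_integral_mono ennreal_leI pw)
  also have "\<dots> = (\<integral>\<^sup>+y. ennreal (2 * r powr a) * ennreal ((w x - w y)\<^sup>2 / norm (x - y) powr a)
      + (ennreal (2 * \<kappa>\<^sup>2) * indicator ?B y + ennreal (2 * \<kappa> powr (2 - p)) * ennreal (\<bar>w y\<bar> powr p)) \<partial>lborel)"
    by (intro nn_integral_cong)
       (simp add: ennreal_plus[symmetric] ennreal_mult[symmetric] ennreal_indicator[symmetric] del: ennreal_plus)
  also have "\<dots> = ennreal (2 * r powr a) * (\<integral>\<^sup>+y. ennreal ((w x - w y)\<^sup>2 / norm (x - y) powr a) \<partial>lborel)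
      + (ennreal (2 * \<kappa>\<^sup>2) * ennreal V + ennreal (2 * \<kappa> powr (2 - p)) * (\<integral>\<^sup>+y. ennreal (\<bar>w y\<bar> powr p) \<partial>lborel))"
    by (simp add: nn_integral_add nn_integral_cmult nn_integral_cmult_indicator V del: borel_open)
  also have "\<dots> \<le> ennreal (2 * r powr a) * ennreal d
      + (ennreal (2 * \<kappa>\<^sup>2) * ennreal V + ennreal (2 * \<kappa> powr (2 - p)) * ennreal P)"
    by (intro add_mono mult_left_mono d P) auto
  also have "\<dots> = ennreal (2 * r powr a * d + 2 * (\<kappa>\<^sup>2 * V + \<kappa> powr (2 - p) * P))"
    using V0 \<open>0 \<le> d\<close> \<open>0 \<le> P\<close>
    by (simp add: ennreal_plus[symmetric] ennreal_mult[symmetric] algebra_simps del: ennreal_plus)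
  finally show ?thesis
    using V0 \<open>0 \<le> d\<close> \<open>0 \<le> P\<close> by (subst (asm) ennreal_le_iff) auto
qed

text \<open>The two summands are what the Gagliardo term and the ball average contribute to the
  bound on \<open>(w x)\<^sup>2\<close> once radius and level are chosen; the outer power
  \<open>p / 2\<close> turns that bound into one on \<open>\<bar>w x\<bar> powr p\<close>.\<close>

definition sobolev_const :: "nat \<Rightarrow> real \<Rightarrow> real" where
  "sobolev_const n p = (2 / unit_ball_vol n + 4 * (1 / unit_ball_vol n) powr (2 / p)) powr (p / 2)"

text \<open>Here \<open>n (1 - 2 / p) = 2 s\<close>; the radius with \<open>r ^ n = P powr (2 / p) / d\<close> balances
  the two terms of the averaged bound.\<close>

lemma sobolev_pointwise:
  fixes w :: "'a::euclidean_space \<Rightarrow> real" and p P d :: real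
  assumes w[measurable]: "w \<in> borel_measurable borel" and "2 < p" "0 < P" "0 < d"
    and a: "a = real DIM('a) * (2 - 2 / p)"
    and P: "(\<integral>\<^sup>+y. ennreal (\<bar>w y\<bar> powr p) \<partial>lborel) \<le> ennreal P"
    and d: "(\<integral>\<^sup>+y. ennreal ((w x - w y)\<^sup>2 / norm (x - y) powr a) \<partial>lborel) \<le> ennreal d"
  shows "\<bar>w x\<bar> powr p \<le> sobolev_const DIM('a) p * P powr (1 - 2 / p) * d"
proof -
  define \<omega> where "\<omega> = unit_ball_vol DIM('a)"
  define n where "n = real DIM('a)"
  define v where "v = P powr (2 / p) / d"
  define r where "r = v powr (1 / n)"
  define V where "V = \<omega> * v"
  \<comment> \<open>With \<open>\<kappa> powr p = P / V\<close> both parts of the level splitting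
    equal \<open>\<kappa>\<^sup>2 * V\<close>, which is the value Hoelder's inequality would
    give.\<close>
  define \<kappa> where "\<kappa> = (P / V) powr (1 / p)"
  have \<omega>: "\<omega> > 0" by (simp add: \<omega>_def)
  have n: "n > 0" by (simp add: n_def)
  have v: "v > 0" using assms by (simp add: v_def)
  then have V: "V > 0" using \<omega> by (simp add: V_def)
  have \<kappa>: "\<kappa> > 0" using V assms by (simp add: \<kappa>_def)
  have r: "r > 0" using v by (simp add: r_def)
  have rn: "r ^ DIM('a) = v"
    using r v n by (simp add: r_def powr_powr n_def flip: powr_realpow)
  have ra: "r powr a = v * v powr (1 - 2 / p)"
  proof -
    have "r powr a = v powr (2 - 2 / p)"
      using n by (simp add: r_def powr_powr a flip: n_def)
    also have "\<dots> = v powr (1 + (1 - 2 / p))" by simp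
    also have "\<dots> = v * v powr (1 - 2 / p)" using v by (subst powr_add) auto
    finally show ?thesis .
  qed
  have a0: "a \<ge> 0" using \<open>2 < p\<close> by (simp add: a field_simps)
  have "(w x)\<^sup>2 * V \<le> 2 * r powr a * d + 2 * (\<kappa>\<^sup>2 * V + \<kappa> powr (2 - p) * P)"
    using gagliardo_average_bound[OF w _ a0 r \<kappa> _ _ P d] assms by (simp add: rn V_def \<omega>_def)
  also have "\<kappa> powr (2 - p) * P = \<kappa>\<^sup>2 * V"
  proof -
    have "\<kappa> powr p = P / V" using V assms by (simp add: \<kappa>_def powr_powr)
    then show ?thesis using \<kappa> V assms by (simp add: powr_diff field_simps)
  qed
  finally have "(w x)\<^sup>2 * V \<le> 2 * r powr a * d + 4 * \<kappa>\<^sup>2 * V" by (simp add: algebra_simps)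
  then have "(w x)\<^sup>2 \<le> 2 * r powr a * d / V + 4 * \<kappa>\<^sup>2"
    using V by (simp add: field_simps)
  also have "2 * r powr a * d / V = (2 / \<omega>) * (v powr (1 - 2 / p) * d)"
    using v by (simp add: ra V_def field_simps)
  also have "\<kappa>\<^sup>2 = (1 / \<omega>) powr (2 / p) * (v powr (1 - 2 / p) * d)"
  proof -
    have "\<kappa>\<^sup>2 = (P / V) powr (2 / p)"
      using V assms by (simp add: \<kappa>_def powr_powr flip: powr_realpow)
    also have "\<dots> = (1 / \<omega>) powr (2 / p) * (P powr (2 / p) / v powr (2 / p))"
      using v \<omega> assms by (simp add: V_def powr_divide powr_mult)
    also have "P powr (2 / p) = v * d" using assms by (simp add: v_def)
    also have "v * d / v powr (2 / p) = v powr (1 - 2 / p) * d"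
      using v by (simp add: powr_diff)
    finally show ?thesis .
  qed
  also have "(2 / \<omega>) * (v powr (1 - 2 / p) * d) + 4 * ((1 / \<omega>) powr (2 / p) * (v powr (1 - 2 / p) * d))
      = (2 / \<omega> + 4 * (1 / \<omega>) powr (2 / p)) * (v powr (1 - 2 / p) * d)" by (simp add: algebra_simps)
  finally have "(w x)\<^sup>2 \<le> (2 / \<omega> + 4 * (1 / \<omega>) powr (2 / p)) * (v powr (1 - 2 / p) * d)" .
  then have "((w x)\<^sup>2) powr (p / 2) \<le> ((2 / \<omega> + 4 * (1 / \<omega>) powr (2 / p)) * (v powr (1 - 2 / p) * d)) powr (p / 2)"
    using assms by (intro powr_mono2) auto
  also have "\<dots> = sobolev_const DIM('a) p * (v powr (1 - 2 / p) * d) powr (p / 2)"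
    using \<omega> \<open>0 < d\<close> v by (subst powr_mult) (auto simp: sobolev_const_def \<omega>_def)
  \<comment> \<open>Here \<open>d\<close> appears with exponent \<open>2 / p\<close>, so the outer
    power \<open>p / 2\<close> makes the bound linear in \<open>d\<close>. This is what allows it to
    be integrated in \<open>x\<close>.\<close>
  also have "v powr (1 - 2 / p) * d = P powr ((2 / p) * (1 - 2 / p)) * d powr (2 / p)"
  proof -
    have "v powr (1 - 2 / p) = P powr ((2 / p) * (1 - 2 / p)) / d powr (1 - 2 / p)"
      using assms by (simp add: v_def powr_divide powr_powr)
    also have "d powr (1 - 2 / p) = d / d powr (2 / p)" using \<open>0 < d\<close> by (simp add: powr_diff)
    finally show ?thesis using \<open>0 < d\<close> by simp
  qed
  also have "\<dots> powr (p / 2) = P powr (1 - 2 / p) * d"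
  proof -
    have e: "2 / p * (1 - 2 / p) * (p / 2) = 1 - 2 / p" "2 / p * (p / 2) = 1"
      using \<open>2 < p\<close> by (simp_all add: field_simps)
    show ?thesis using assms by (subst powr_mult) (auto simp only: powr_powr e powr_ge_zero powr_one)
  qed
  also have "((w x)\<^sup>2) powr (p / 2) = \<bar>w x\<bar> powr p"
    using powr_powr[of "\<bar>w x\<bar>" 2 "p / 2"] by simp
  finally show ?thesis by (simp add: mult.assoc)
qed

lemma sobolev_const_pos: "0 < sobolev_const n p"
proof -
  have "0 < 2 / unit_ball_vol (real n) + 4 * (1 / unit_ball_vol (real n)) powr (2 / p)"
    by (intro add_pos_nonneg) auto
  then show ?thesis by (simp add: sobolev_const_def)
qed

lemma fractional_sobolev_bounded:
  fixes w :: "'a::euclidean_space \<Rightarrow> real" and p M e :: real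
  assumes w[measurable]: "w \<in> borel_measurable borel" and "2 < p" "0 \<le> e"
    and a: "a = real DIM('a) * (2 - 2 / p)"
    and A: "bounded A" "\<And>x. x \<notin> A \<Longrightarrow> w x = 0" and M: "\<And>x. \<bar>w x\<bar> \<le> M"
    and e: "(\<integral>\<^sup>+x. \<integral>\<^sup>+y. ennreal ((w x - w y)\<^sup>2 / norm (x - y) powr a) \<partial>lborel \<partial>lborel) \<le> ennreal e"
  shows "(\<integral>\<^sup>+x. ennreal (\<bar>w x\<bar> powr p) \<partial>lborel) \<le> ennreal ((sobolev_const DIM('a) p * e) powr (p / 2))"
proof -
  let ?K = "sobolev_const DIM('a) p"
  let ?D = "\<lambda>x. \<integral>\<^sup>+y. ennreal ((w x - w y)\<^sup>2 / norm (x - y) powr a) \<partial>lborel"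
  obtain R where R: "\<And>x. x \<in> A \<Longrightarrow> norm x \<le> R"
    using A(1) by (auto simp: bounded_iff)
  have bd: "\<bar>w x\<bar> powr p \<le> (M powr p) * indicator (cball 0 R) x" for x :: 'a
    using A(2)[of x] R[of x] M[of x] \<open>2 < p\<close>
    by (cases "x \<in> A") (auto intro!: powr_mono2)
  have "(\<integral>\<^sup>+x. ennreal (\<bar>w x\<bar> powr p) \<partial>lborel) \<le> (\<integral>\<^sup>+x. ennreal ((M powr p) * indicator (cball (0::'a) R) x) \<partial>lborel)"
    by (intro nn_integral_mono ennreal_leI bd)
  also have "\<dots> = ennreal (M powr p) * emeasure lborel (cball (0::'a) R)"
    by (simp add: ennreal_mult' ennreal_indicator nn_integral_cmult_indicator)
  also have "\<dots> < \<infinity>"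
    using emeasure_compact_finite[of "cball (0::'a) R"] by (auto simp: ennreal_mult_less_top)
  finally obtain P where P: "(\<integral>\<^sup>+x. ennreal (\<bar>w x\<bar> powr p) \<partial>lborel) = ennreal P" "0 \<le> P"
    by (metis enn2real_nonneg ennreal_enn2real infinity_ennreal_def)
  show ?thesis
  proof (cases "P = 0")
    case False
    with P(2) have P0: "P > 0" by simp
    define c where "c = ?K * P powr (1 - 2 / p)"
    have c: "c > 0" using P0 sobolev_const_pos[of "DIM('a)" p] by (simp add: c_def)
    have pw: "ennreal (\<bar>w x\<bar> powr p) \<le> ennreal c * ?D x" for x
    proof (cases "?D x")
      case (real d)
      \<comment> \<open>The pointwise bound requires a positive majorant of the Gagliardo density,
        while \<open>d\<close> may vanish; hence the approach through all
        \<open>d' > d\<close>.\<close>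
      have "\<bar>w x\<bar> powr p / c \<le> d"
      proof (rule dense_ge)
        fix d' assume "d < d'"
        then have "\<bar>w x\<bar> powr p \<le> c * d'"
          unfolding c_def using real P P0 \<open>2 < p\<close>
          by (intro sobolev_pointwise[OF w _ _ _ a]) (auto intro: ennreal_leI)
        then show "\<bar>w x\<bar> powr p / c \<le> d'" using c by (simp add: field_simps)
      qed
      then have "\<bar>w x\<bar> powr p \<le> c * d" using c by (simp add: field_simps)
      then show ?thesis using real c by (simp add: ennreal_leI flip: ennreal_mult)
    next
      case top
      then show ?thesis using c by (simp add: ennreal_mult_top)
    qed
    have "ennreal P \<le> (\<integral>\<^sup>+x. ennreal c * ?D x \<partial>lborel)"
      unfolding P(1)[symmetric] by (intro nn_integral_mono pw)
    also have "\<dots> = ennreal c * (\<integral>\<^sup>+x. ?D x \<partial>lborel)"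
      by (intro nn_integral_cmult) measurable
    also have "\<dots> \<le> ennreal c * ennreal e" by (intro mult_left_mono e) auto
    also have "\<dots> = ennreal (c * e)" using c \<open>0 \<le> e\<close> by (simp add: ennreal_mult)
    finally have "P \<le> ?K * P powr (1 - 2 / p) * e" using c \<open>0 \<le> e\<close> by (simp add: c_def)
    moreover have "P = P powr (2 / p) * P powr (1 - 2 / p)"
      using P0 by (simp flip: powr_add)
    ultimately have "P powr (2 / p) * P powr (1 - 2 / p) \<le> (?K * e) * P powr (1 - 2 / p)"
      by (simp add: mult_ac)
    then have "P powr (2 / p) \<le> ?K * e" using P0 by simp
    then have "(P powr (2 / p)) powr (p / 2) \<le> (?K * e) powr (p / 2)"
      using \<open>2 < p\<close> by (intro powr_mono2) auto
    then show ?thesis using P P0 \<open>2 < p\<close> by (simp add: powr_powr ennreal_leI)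
  qed (use P in simp)
qed

theorem fractional_sobolev:
  fixes w :: "'a::euclidean_space \<Rightarrow> real" and p e :: real
  assumes w[measurable]: "w \<in> borel_measurable borel" and "2 < p" "0 \<le> e"
    and a: "a = real DIM('a) * (2 - 2 / p)"
    and A: "bounded A" "\<And>x. x \<notin> A \<Longrightarrow> w x = 0"
    and e: "(\<integral>\<^sup>+x. \<integral>\<^sup>+y. ennreal ((w x - w y)\<^sup>2 / norm (x - y) powr a) \<partial>lborel \<partial>lborel) \<le> ennreal e"
  shows "(\<integral>\<^sup>+x. ennreal (\<bar>w x\<bar> powr p) \<partial>lborel) \<le> ennreal ((sobolev_const DIM('a) p * e) powr (p / 2))"
proof -
  \<comment> \<open>Clamping to the interval from \<open>-N\<close> to \<open>N\<close> is
    1-Lipschitz, so it does not increase the Gagliardo energy. The resulting bound is uniform in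
    \<open>N\<close>, and Fatou's lemma carries it over to \<open>w\<close>.\<close>
  define t where "t = (\<lambda>N x. max (- real N) (min (real N) (w x)))"
  have tm[measurable]: "t N \<in> borel_measurable borel" for N unfolding t_def by measurable
  have le: "(\<integral>\<^sup>+x. ennreal (\<bar>t N x\<bar> powr p) \<partial>lborel) \<le> ennreal ((sobolev_const DIM('a) p * e) powr (p / 2))" for N
  proof (rule fractional_sobolev_bounded[where A = A and M = "real N", OF tm \<open>2 < p\<close> \<open>0 \<le> e\<close> a A(1)])
    show "x \<notin> A \<Longrightarrow> t N x = 0" for x using A(2) by (simp add: t_def)
    show "\<bar>t N x\<bar> \<le> real N" for x by (auto simp: t_def)
    have "(t N x - t N y)\<^sup>2 \<le> (w x - w y)\<^sup>2" for x y
      by (rule abs_le_square_iff[THEN iffD1]) (auto simp: t_def max_def min_def)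
    then have "(\<integral>\<^sup>+x. \<integral>\<^sup>+y. ennreal ((t N x - t N y)\<^sup>2 / norm (x - y) powr a) \<partial>lborel \<partial>lborel)
        \<le> (\<integral>\<^sup>+x. \<integral>\<^sup>+y. ennreal ((w x - w y)\<^sup>2 / norm (x - y) powr a) \<partial>lborel \<partial>lborel)"
      by (intro nn_integral_mono ennreal_leI divide_right_mono) auto
    then show "(\<integral>\<^sup>+x. \<integral>\<^sup>+y. ennreal ((t N x - t N y)\<^sup>2 / norm (x - y) powr a) \<partial>lborel \<partial>lborel) \<le> ennreal e"
      using e by simp
  qed
  have "(\<lambda>N. ennreal (\<bar>t N x\<bar> powr p)) \<longlonglongrightarrow> ennreal (\<bar>w x\<bar> powr p)" for x
  proof (rule tendsto_eventually)
    obtain N0 where N0: "\<bar>w x\<bar> \<le> real N0" using real_arch_simple by blast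
    have "t N x = w x" if "N \<ge> N0" for N
      using N0 of_nat_mono[OF that, where 'a = real] by (auto simp: t_def max_def min_def)
    then show "\<forall>\<^sub>F N in sequentially. ennreal (\<bar>t N x\<bar> powr p) = ennreal (\<bar>w x\<bar> powr p)"
      unfolding eventually_sequentially by (intro exI[of _ N0] allI impI) simp
  qed
  then have "ennreal (\<bar>w x\<bar> powr p) = liminf (\<lambda>N. ennreal (\<bar>t N x\<bar> powr p))" for x
    by (metis lim_imp_Liminf trivial_limit_sequentially)
  then have "(\<integral>\<^sup>+x. ennreal (\<bar>w x\<bar> powr p) \<partial>lborel) = (\<integral>\<^sup>+x. liminf (\<lambda>N. ennreal (\<bar>t N x\<bar> powr p)) \<partial>lborel)"
    by (intro nn_integral_cong)
  also have "\<dots> \<le> liminf (\<lambda>N. \<integral>\<^sup>+x. ennreal (\<bar>t N x\<bar> powr p) \<partial>lborel)"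
    by (intro nn_integral_liminf) measurable
  also have "\<dots> \<le> liminf (\<lambda>N::nat. ennreal ((sobolev_const DIM('a) p * e) powr (p / 2)))"
    by (intro Liminf_mono always_eventually allI le)
  also have "\<dots> = ennreal ((sobolev_const DIM('a) p * e) powr (p / 2))"
    by (simp add: Liminf_const)
  finally show ?thesis .
qed

section \<open>Test functions and the lemma of du Bois-Reymond\<close>

lemma C_k_SucI:
  assumes D: "\<And>x. (f has_derivative D x) (at x)" and "\<And>v. C_k k (\<lambda>x. D x v)"
  shows "C_k (Suc k) f"
proof -
  have "frechet_derivative f (at x) = D x" for x
    by (rule frechet_derivative_at[OF D, symmetric])
  moreover have "f differentiable (at x)" for x
    unfolding differentiable_def using D by blast
  ultimately show ?thesis using assms(2) by simp
qed

lemma C_k_SucD: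
  assumes "C_k (Suc k) f"
  shows "(f has_derivative frechet_derivative f (at x)) (at x)"
    and "C_k k (\<lambda>x. frechet_derivative f (at x) v)"
  unfolding frechet_derivative_works[symmetric] using assms by simp_all

lemma C_k_continuous:
  fixes f :: "'a::euclidean_space \<Rightarrow> real"
  assumes "C_k k f"
  shows "continuous_on UNIV f"
proof (cases k)
  case (Suc j)
  show ?thesis
    using has_derivative_continuous[OF C_k_SucD(1)[OF assms[unfolded Suc]]]
    by (intro continuous_at_imp_continuous_on) blast
qed (use assms in simp)

lemma C_k_mono_Suc:
  fixes f :: "'a::euclidean_space \<Rightarrow> real"
  shows "C_k (Suc k) f \<Longrightarrow> C_k k f"
proof (induction k arbitrary: f)
  case 0
  show ?case using C_k_continuous[OF 0] by simp
next
  case (Suc k)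
  show ?case by (rule C_k_SucI[OF C_k_SucD(1)[OF Suc.prems]]) (rule Suc.IH[OF C_k_SucD(2)[OF Suc.prems]])
qed

lemma C_k_const: "C_k k (\<lambda>x. c)"
proof (induction k arbitrary: c)
  case (Suc k)
  show ?case by (rule C_k_SucI[OF has_derivative_const Suc])
qed simp

lemma C_k_add: "C_k k f \<Longrightarrow> C_k k g \<Longrightarrow> C_k k (\<lambda>x. f x + g x)"
proof (induction k arbitrary: f g)
  case (Suc k)
  show ?case
    by (rule C_k_SucI[OF has_derivative_add[OF Suc.prems[THEN C_k_SucD(1)]]])
       (rule Suc.IH[OF Suc.prems[THEN C_k_SucD(2)]])
qed (auto intro: continuous_on_add)

lemma C_k_mult: "C_k k f \<Longrightarrow> C_k k g \<Longrightarrow> C_k k (\<lambda>x. f x * g x)"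
proof (induction k arbitrary: f g)
  case (Suc k)
  show ?case
    by (rule C_k_SucI[OF has_derivative_mult[OF Suc.prems[THEN C_k_SucD(1)]]])
       (intro C_k_add Suc.IH Suc.prems[THEN C_k_SucD(2)] Suc.prems[THEN C_k_mono_Suc])
qed (auto intro: continuous_on_mult)

lemma C_k_prod: "(\<And>i. i \<in> A \<Longrightarrow> C_k k (f i)) \<Longrightarrow> C_k k (\<lambda>x. \<Prod>i\<in>A. f i x)"
  by (induction A rule: infinite_finite_induct) (auto intro!: C_k_const C_k_mult)

lemma C_k_translate: "C_k k f \<Longrightarrow> C_k k (\<lambda>x. f (x + c))"
proof (induction k arbitrary: f)
  case (Suc k)
  have D: "((\<lambda>x. f (x + c)) has_derivative frechet_derivative f (at (x + c))) (at x)" for x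
  proof -
    have "((\<lambda>x. x + c) has_derivative (\<lambda>x. x)) (at x)"
      by (auto intro!: derivative_eq_intros)
    from has_derivative_compose[OF this C_k_SucD(1)[OF Suc.prems]]
    show ?thesis .
  qed
  show ?case by (rule C_k_SucI[OF D]) (rule Suc.IH[OF C_k_SucD(2)[OF Suc.prems]])
next
  case 0
  have "continuous_on UNIV (\<lambda>x. x + c)" by (intro continuous_intros)
  from continuous_on_compose2[OF _ this, of UNIV f] 0 show ?case by simp
qed

text \<open>With \<open>i = inverse t\<close> the family \<open>exp (- \<epsilon> i) i ^ m\<close> is closed under
  differentiation in \<open>t\<close> up to linear combinations.\<close>

definition flat_exp :: "real \<Rightarrow> nat \<Rightarrow> real \<Rightarrow> real" where
  "flat_exp \<epsilon> m t = (if t \<le> 0 then 0 else exp (- \<epsilon> * inverse t) * inverse t ^ m)"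

lemma flat_exp_tendsto:
  fixes \<epsilon> :: real
  assumes "\<epsilon> > 0"
  shows "((\<lambda>t. exp (- \<epsilon> * inverse t) * inverse t ^ m) \<longlongrightarrow> 0) (at_right 0)"
proof -
  have "filterlim (\<lambda>x::real. \<epsilon> * x) at_top at_top"
    by (rule filterlim_tendsto_pos_mult_at_top[where f = "\<lambda>_::real. \<epsilon>" and c = \<epsilon>])
       (use assms in \<open>auto intro: filterlim_ident\<close>)
  from filterlim_compose[OF tendsto_power_div_exp_0 this]
  have "((\<lambda>x. (\<epsilon> * x) ^ m / exp (\<epsilon> * x)) \<longlongrightarrow> 0) at_top" .
  then have "((\<lambda>x. (\<epsilon> * x) ^ m / exp (\<epsilon> * x) * (1 / \<epsilon> ^ m)) \<longlongrightarrow> 0) at_top"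
    by (rule tendsto_mult_left_zero)
  then have "((\<lambda>x. exp (- \<epsilon> * x) * x ^ m) \<longlongrightarrow> 0) at_top"
    using assms by (simp add: power_mult_distrib exp_minus field_simps)
  from filterlim_compose[OF this filterlim_inverse_at_top_right] show ?thesis .
qed

lemma flat_exp_deriv:
  assumes "\<epsilon> > 0"
  shows "(flat_exp \<epsilon> m has_real_derivative (\<epsilon> * flat_exp \<epsilon> (m + 2) t - real m * flat_exp \<epsilon> (m + 1) t)) (at t)"
proof -
  consider "t < 0" | "t = 0" | "t > 0" by linarith
  then show ?thesis
  proof cases
    case 1
    have "(flat_exp \<epsilon> m has_real_derivative 0) (at t)"
      by (rule has_field_derivative_transform_within_open[where f = "\<lambda>t. 0" and S = "{..<0}"])
         (use 1 in \<open>auto simp: flat_exp_def\<close>)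
    then show ?thesis using 1 by (simp add: flat_exp_def)
  next
    case 3
    have "((\<lambda>t. exp (- \<epsilon> * inverse t)) has_real_derivative exp (- \<epsilon> * inverse t) * (\<epsilon> * (inverse t)\<^sup>2)) (at t)"
      using 3 by (auto intro!: derivative_eq_intros simp: power2_eq_square)
    moreover have "((\<lambda>t. inverse t ^ m) has_real_derivative - real m * inverse t ^ (m + 1)) (at t)"
    proof -
      have "((\<lambda>t. inverse t ^ m) has_real_derivative real m * (- (inverse t ^ 2) * inverse t ^ (m - 1))) (at t)"
        using DERIV_power[OF DERIV_inverse, of t m] 3
        by (simp add: eval_nat_numeral mult_ac)
      \<comment> \<open>For \<open>m = 0\<close> the truncated exponent \<open>m - 1\<close> does no
        harm, because the factor \<open>real m\<close> vanishes.\<close>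
      moreover have "real m * (- (inverse t ^ 2) * inverse t ^ (m - 1)) = - real m * inverse t ^ (m + 1)"
        by (cases m) (simp_all add: power2_eq_square algebra_simps)
      ultimately show ?thesis by (simp only:)
    qed
    ultimately have "((\<lambda>t. exp (- \<epsilon> * inverse t) * inverse t ^ m) has_real_derivative
        (exp (- \<epsilon> * inverse t) * (\<epsilon> * (inverse t)\<^sup>2) * inverse t ^ m
          + - real m * inverse t ^ (m + 1) * exp (- \<epsilon> * inverse t))) (at t)"
      by (rule DERIV_mult)
    moreover have "exp (- \<epsilon> * inverse t) * (\<epsilon> * (inverse t)\<^sup>2) * inverse t ^ m
          + - real m * inverse t ^ (m + 1) * exp (- \<epsilon> * inverse t)
        = \<epsilon> * flat_exp \<epsilon> (m + 2) t - real m * flat_exp \<epsilon> (m + 1) t"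
      using 3 by (simp add: flat_exp_def power_add power2_eq_square algebra_simps)
    ultimately have "((\<lambda>t. exp (- \<epsilon> * inverse t) * inverse t ^ m) has_real_derivative
        (\<epsilon> * flat_exp \<epsilon> (m + 2) t - real m * flat_exp \<epsilon> (m + 1) t)) (at t)"
      by simp
    then show ?thesis
      by (rule has_field_derivative_transform_within_open[where S = "{0<..}"])
         (use 3 in \<open>auto simp: flat_exp_def\<close>)
  next
    case 2
    \<comment> \<open>To the right of 0 the difference quotient is the same expression with exponent
      \<open>Suc m\<close>, which tends to 0. The claimed derivative at 0 is 0 as well, since every
      \<open>flat_exp\<close> vanishes there.\<close>
    have "((\<lambda>h. flat_exp \<epsilon> m h / h) \<longlongrightarrow> 0) (at_right 0)"
    proof (rule Lim_transform_eventually[OF flat_exp_tendsto[OF assms, of "Suc m"]])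
      show "\<forall>\<^sub>F h in at_right 0. exp (- \<epsilon> * inverse h) * inverse h ^ Suc m = flat_exp \<epsilon> m h / h"
        using eventually_at_right_less[of "0::real"]
        by eventually_elim (simp add: flat_exp_def divide_inverse)
    qed
    moreover have "((\<lambda>h. flat_exp \<epsilon> m h / h) \<longlongrightarrow> 0) (at_left 0)"
    proof (rule tendsto_eventually)
      show "\<forall>\<^sub>F h in at_left 0. flat_exp \<epsilon> m h / h = 0"
        unfolding eventually_at_left_field by (intro exI[of _ "-1"]) (simp add: flat_exp_def)
    qed
    ultimately have "((\<lambda>h. flat_exp \<epsilon> m h / h) \<longlongrightarrow> 0) (at 0)"
      by (simp add: filterlim_split_at)
    then show ?thesis using 2 by (simp add: DERIV_def flat_exp_def)
  qed
qed

lemma C_k_flat_exp_inner: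
  fixes b :: "'a::euclidean_space"
  assumes "\<epsilon> > 0"
  shows "C_k k (\<lambda>x. flat_exp \<epsilon> m (x \<bullet> b + c))"
proof (induction k arbitrary: m)
  case 0
  have "continuous_on UNIV (flat_exp \<epsilon> m)"
    using flat_exp_deriv[OF assms] by (meson DERIV_isCont continuous_at_imp_continuous_on)
  moreover have "continuous_on UNIV (\<lambda>x. x \<bullet> b + c)" by (intro continuous_intros)
  ultimately show ?case by (auto intro: continuous_on_compose2[of UNIV "flat_exp \<epsilon> m"])
next
  case (Suc k)
  show ?case
  proof (rule C_k_SucI)
    show "((\<lambda>x. flat_exp \<epsilon> m (x \<bullet> b + c)) has_derivative
      (\<lambda>v. (\<epsilon> * flat_exp \<epsilon> (m + 2) (x \<bullet> b + c) + - real m * flat_exp \<epsilon> (m + 1) (x \<bullet> b + c)) * (v \<bullet> b))) (at x)" for x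
    proof -
      have "((\<lambda>x. x \<bullet> b + c) has_derivative (\<lambda>v. v \<bullet> b)) (at x)"
        by (auto intro!: derivative_eq_intros)
      from has_derivative_compose[OF this flat_exp_deriv[OF assms, of m "x \<bullet> b + c", unfolded has_field_derivative_def]]
      show ?thesis by simp
    qed
    show "C_k k (\<lambda>x. (\<epsilon> * flat_exp \<epsilon> (m + 2) (x \<bullet> b + c) + - real m * flat_exp \<epsilon> (m + 1) (x \<bullet> b + c)) * (v \<bullet> b))" for v
      by (intro C_k_add C_k_mult C_k_const Suc)
  qed
qed

text \<open>One flat factor for each face of the box, written in the affine form that
  \<open>C_k_flat_exp_inner\<close> accepts. The parameter \<epsilon> is there to tend to 0: each
  factor \<open>exp (- \<epsilon> / t)\<close> then tends to 1 inside the box, so the bumps converge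
  boundedly to the indicator and testing against them yields integrals over boxes.\<close>

definition box_bump :: "real \<Rightarrow> 'a::euclidean_space \<Rightarrow> 'a \<Rightarrow> 'a \<Rightarrow> real" where
  "box_bump \<epsilon> a b x = (\<Prod>i\<in>Basis. flat_exp \<epsilon> 0 (x \<bullet> i + - (a \<bullet> i)) * flat_exp \<epsilon> 0 (x \<bullet> - i + b \<bullet> i))"

lemma box_bump_nonzero_iff: "box_bump \<epsilon> a b x \<noteq> 0 \<longleftrightarrow> x \<in> box a b"
proof -
  have "flat_exp \<epsilon> 0 t \<noteq> 0 \<longleftrightarrow> t > 0" for t by (simp add: flat_exp_def)
  then show ?thesis by (auto simp: box_bump_def mem_box)
qed

lemma box_bump_abs_le_1: "\<epsilon> > 0 \<Longrightarrow> \<bar>box_bump \<epsilon> a b x\<bar> \<le> 1"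
  unfolding box_bump_def abs_prod
  by (intro prod_le_1) (simp_all add: flat_exp_def abs_mult mult_le_one)

lemma box_bump_tendsto:
  "(\<lambda>n. box_bump (1 / Suc n) a b x) \<longlonglongrightarrow> indicator (box a b) x"
proof (cases "x \<in> box a b")
  case True
  have "(\<lambda>n. flat_exp (1 / Suc n) 0 t) \<longlonglongrightarrow> 1" if "t > 0" for t
  proof -
    have "(\<lambda>n. exp (- (1 / real (Suc n)) * inverse t)) \<longlonglongrightarrow> exp (- 0 * inverse t)"
      by (intro tendsto_exp tendsto_mult_right tendsto_minus LIMSEQ_Suc lim_1_over_n)
    then show ?thesis using that by (simp add: flat_exp_def del: of_nat_Suc)
  qed
  then have "(\<lambda>n. box_bump (1 / Suc n) a b x) \<longlonglongrightarrow> (\<Prod>i\<in>(Basis::'a set). 1 * 1)"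
    unfolding box_bump_def using True by (intro tendsto_prod tendsto_mult) (auto simp: mem_box)
  then show ?thesis using True by simp
next
  case False
  then show ?thesis using box_bump_nonzero_iff[of _ a b x] by simp
qed

lemma test_function_box_bump:
  assumes "\<epsilon> > 0" "cbox a b \<subseteq> \<Omega>"
  shows "test_function \<Omega> (box_bump \<epsilon> a b)"
proof -
  have "C_k k (box_bump \<epsilon> a b)" for k
    unfolding box_bump_def by (intro C_k_prod C_k_mult C_k_flat_exp_inner assms)
  moreover have "closure {x. box_bump \<epsilon> a b x \<noteq> 0} \<subseteq> cbox a b"
    by (intro closure_minimal) (auto simp: box_bump_nonzero_iff box_subset_cbox[THEN subsetD])
  ultimately show ?thesis
    unfolding test_function_def using assms(2) bounded_closed_imp_seq_compact
    by (metis bounded_cbox bounded_subset closed_closure compact_eq_bounded_closed order_trans)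
qed


lemma test_functionD:
  assumes "test_function \<Omega> \<phi>"
  shows "(\<phi> has_derivative frechet_derivative \<phi> (at x)) (at x)"
    and "continuous_on UNIV (\<lambda>x. frechet_derivative \<phi> (at x) v)"
    and "continuous_on UNIV \<phi>"
    and "x \<notin> closure {x. \<phi> x \<noteq> 0} \<Longrightarrow> frechet_derivative \<phi> (at x) v = 0"
proof -
  have 1: "C_k (Suc 0) \<phi>" using assms unfolding test_function_def by blast
  from C_k_SucD(1)[OF 1] show D: "(\<phi> has_derivative frechet_derivative \<phi> (at x)) (at x)" for x .
  from C_k_SucD(2)[OF 1] show "continuous_on UNIV (\<lambda>x. frechet_derivative \<phi> (at x) v)"
    by simp
  from C_k_continuous[OF 1] show "continuous_on UNIV \<phi>" .
  assume x: "x \<notin> closure {x. \<phi> x \<noteq> 0}"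
  have "(\<phi> has_derivative (\<lambda>v. 0)) (at x)"
    by (rule has_derivative_transform_within_open[where f = "\<lambda>x. 0" and s = "- closure {x. \<phi> x \<noteq> 0}"])
       (use x closure_subset[of "{x. \<phi> x \<noteq> 0}"] in auto)
  from frechet_derivative_at[OF this] show "frechet_derivative \<phi> (at x) v = 0"
    by (metis (no_types))
qed

lemma test_function_mono: "test_function A \<phi> \<Longrightarrow> A \<subseteq> B \<Longrightarrow> test_function B \<phi>"
  unfolding test_function_def by blast

lemma test_function_translate:
  assumes "test_function \<Omega> \<phi>" "\<And>x. x \<in> closure {x. \<phi> x \<noteq> 0} \<Longrightarrow> x - c \<in> \<Omega>'"
  shows "test_function \<Omega>' (\<lambda>x. \<phi> (x + c))"
proof -
  have "{x. \<phi> (x + c) \<noteq> 0} = (+) (- c) ` {x. \<phi> x \<noteq> 0}"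
  proof safe
    fix x assume "\<phi> (x + c) \<noteq> 0"
    then show "x \<in> (+) (- c) ` {x. \<phi> x \<noteq> 0}" by (intro image_eqI[of _ _ "x + c"]) auto
  qed auto
  then have e: "closure {x. \<phi> (x + c) \<noteq> 0} = (+) (- c) ` closure {x. \<phi> x \<noteq> 0}"
    by (simp only: closure_translation)
  have "compact ((+) (- c) ` closure {x. \<phi> x \<noteq> 0})"
    using assms(1) unfolding test_function_def by (intro compact_translation) auto
  moreover have "C_k k (\<lambda>x. \<phi> (x + c))" for k
    using assms(1) unfolding test_function_def by (intro C_k_translate) auto
  ultimately show ?thesis
    unfolding test_function_def e using assms(2) by auto
qed

text \<open>Boxes form an intersection-stable generator of the Borel sets, so a Dynkin induction
  makes the integral vanish over every Borel set, and a density is determined almost everywhere by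
  these integrals.\<close>

lemma AE_zero_of_box_integrals:
  fixes f :: "'a::euclidean_space \<Rightarrow> real"
  assumes f: "integrable lborel f" and box: "\<And>a b. (LINT x:box a b|lborel. f x) = 0"
  shows "AE x in lborel. f x = 0"
proof (rule density_unique_real[OF f integrable_zero])
  have si: "set_integrable lborel A f" if "A \<in> sets borel" for A
    using f that unfolding set_integrable_def by (intro integrable_mult_indicator) auto
  \<comment> \<open>The complement case of the Dynkin induction needs the integral over the whole
    space, which is reached by exhausting it with growing boxes.\<close>
  have "(\<lambda>n. LINT x:(box (- real n *\<^sub>R One) (real n *\<^sub>R One :: 'a))|lborel. f x) \<longlonglongrightarrow>
      (LINT x:(\<Union>n. box (- real n *\<^sub>R One) (real n *\<^sub>R One))|lborel. f x)"
  proof (intro set_integral_cont_up si)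
    show "incseq (\<lambda>n. box (- real n *\<^sub>R One) (real n *\<^sub>R One :: 'a))"
      unfolding incseq_def
    proof (intro allI impI subsetI)
      fix m n :: nat and x :: 'a
      assume "m \<le> n" and x: "x \<in> box (- real m *\<^sub>R One) (real m *\<^sub>R One)"
      then have "real m \<le> real n" by simp
      with x show "x \<in> box (- real n *\<^sub>R One) (real n *\<^sub>R One)"
        unfolding mem_box by fastforce
    qed
  qed auto
  then have UNIV: "(LINT x:UNIV|lborel. f x) = 0"
    using LIMSEQ_unique[OF tendsto_const[of 0]] by (simp add: box UN_box_eq_UNIV[simplified])
  let ?E = "range (\<lambda>(a, b). box a b :: 'a set)"
  fix A assume "A \<in> sets (lborel :: 'a measure)"
  then have A: "A \<in> sigma_sets UNIV ?E"
    by (simp add: borel_eq_box)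
  have E: "Int_stable ?E" "?E \<subseteq> Pow UNIV" by (auto simp: Int_stable_def box_Int_box)
  from E A have "(LINT x:A|lborel. f x) = 0"
  proof (induction rule: sigma_sets_induct_disjoint)
    case (compl A)
    have "A \<in> sets borel" using compl by (simp add: borel_eq_box)
    then show ?case
      using set_integral_Un[of A "UNIV - A" lborel f] si UNIV compl by (simp add: Diff_disjoint)
  next
    case (union B)
    have "\<And>i. B i \<in> sets borel" using union by (auto simp: borel_eq_box)
    then show ?case
      using lebesgue_integral_countable_add[of B lborel f] union si by (auto simp: disjoint_family_on_def)
  qed (auto simp: box, simp add: set_lebesgue_integral_def)
  then show "(LINT x:A|lborel. f x) = (LINT x:A|lborel. 0)" by simp
qed


lemma lebesgue_integrable_representative:
  fixes f :: "'a::euclidean_space \<Rightarrow> real"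
  assumes f: "integrable lebesgue f"
  obtains f' where "f' \<in> borel_measurable borel" "f' \<in> borel_measurable lebesgue" "integrable lborel f'"
    "AE x in lebesgue. f x = f' x"
proof -
  obtain f' where f': "f' \<in> borel_measurable lborel" "AE x in lborel. f x = f' x"
    using completion_ex_borel_measurable_real f by blast
  have eq: "AE x in lebesgue. f x = f' x" using f'(2) by (rule AE_completion)
  have f'm: "f' \<in> borel_measurable lebesgue" using f'(1) by (rule measurable_completion)
  have "integrable lebesgue f'"
    using f f'm eq integrable_cong_AE by blast
  then have "integrable lborel f'" using f'(1) integrable_completion by blast
  then show ?thesis using that f' f'm eq by simp
qed

lemma AE_zero_of_box_integrals_lebesgue:
  fixes f :: "'a::euclidean_space \<Rightarrow> real"
  assumes f: "integrable lebesgue f" and box: "\<And>a b. (LINT x:box a b|lebesgue. f x) = 0"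
  shows "AE x in lebesgue. f x = 0"
proof -
  obtain f' where f': "f' \<in> borel_measurable borel" and f'm: "f' \<in> borel_measurable lebesgue"
    and i: "integrable lborel f'" and eq: "AE x in lebesgue. f x = f' x"
    by (rule lebesgue_integrable_representative[OF f])
  have "(LINT x:box a b|lborel. f' x) = 0" for a b
  proof -
    have "(LINT x:box a b|lborel. f' x) = (LINT x:box a b|lebesgue. f' x)"
      unfolding set_lebesgue_integral_def using f' by (intro integral_completion[symmetric]) auto
    also have "\<dots> = (LINT x:box a b|lebesgue. f x)"
      unfolding set_lebesgue_integral_def using eq f f'm
      by (intro integral_cong_AE borel_measurable_scaleR borel_measurable_indicator) auto
    finally show ?thesis using box by simp
  qed
  with i have "AE x in lborel. f' x = 0" by (rule AE_zero_of_box_integrals)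
  then have "AE x in lebesgue. f' x = 0" by (rule AE_completion)
  with eq show ?thesis by eventually_elim simp
qed

lemma integral_lebesgue_on:
  fixes f :: "'a::euclidean_space \<Rightarrow> 'b::{banach, second_countable_topology}"
  assumes "A \<in> sets lebesgue"
  shows "integral\<^sup>L (lebesgue_on A) f = (LINT x:A|lebesgue. f x)"
  using assms by (simp add: integral_restrict_space set_lebesgue_integral_def)

lemma integrable_lebesgue_on_iff:
  fixes f :: "'a::euclidean_space \<Rightarrow> 'b::{banach, second_countable_topology}"
  assumes "A \<in> sets lebesgue"
  shows "integrable (lebesgue_on A) f \<longleftrightarrow> set_integrable lebesgue A f"
  using assms by (simp add: integrable_restrict_space set_integrable_def)

text \<open>On a closed box inside \<Omega> the function is integrable, and testing with bumps on
  the open box makes its integral over that box vanish. The same holds for all smaller boxes, which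
  gives the claim on each closed box, and countably many closed boxes cover \<Omega>.\<close>

theorem du_bois_reymond:
  fixes f :: "'a::euclidean_space \<Rightarrow> real"
  assumes "open \<Omega>" and loc: "locally_integrable \<Omega> f"
    and zero: "\<And>\<phi>. test_function \<Omega> \<phi> \<Longrightarrow> (\<integral>x. f x * \<phi> x \<partial>lebesgue_on \<Omega>) = 0"
  shows "AE x in lebesgue_on \<Omega>. f x = 0"
proof -
  have \<Omega>: "\<Omega> \<in> sets lebesgue" using \<open>open \<Omega>\<close> by auto
  have cb: "set_integrable lebesgue (cbox a b) f" if "cbox a b \<subseteq> \<Omega>" for a b
    using loc that unfolding locally_integrable_def by (subst integrable_lebesgue_on_iff[symmetric]) auto
  have box: "(LINT x:box a b|lebesgue. f x) = 0" if ab: "cbox a b \<subseteq> \<Omega>" for a b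
  proof -
    let ?g = "\<lambda>x. indicator (cbox a b) x *\<^sub>R f x"
    have g: "integrable lebesgue ?g" using cb[OF ab] by (simp add: set_integrable_def)
    have pos: "1 / real (Suc n) > 0" for n by simp
    have "(\<lambda>n. \<integral>x. ?g x * box_bump (1 / Suc n) a b x \<partial>lebesgue) \<longlonglongrightarrow> (\<integral>x. ?g x * indicator (box a b) x \<partial>lebesgue)"
    proof (rule integral_dominated_convergence[where w = "\<lambda>x. \<bar>?g x\<bar>"])
      have "box_bump (1 / Suc n) a b \<in> borel_measurable lebesgue" for n
        using test_functionD(3)[OF test_function_box_bump[OF pos subset_UNIV]]
        by (intro measurable_completion) (auto intro!: borel_measurable_continuous_onI)
      then show "(\<lambda>x. ?g x * box_bump (1 / Suc n) a b x) \<in> borel_measurable lebesgue" for n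
        using g by (intro borel_measurable_times) auto
      show "(\<lambda>x. ?g x * indicator (box a b) x) \<in> borel_measurable lebesgue"
        using g by (intro borel_measurable_times borel_measurable_indicator) auto
      show "integrable lebesgue (\<lambda>x. \<bar>?g x\<bar>)" using g by (rule integrable_abs)
      show "AE x in lebesgue. (\<lambda>n. ?g x * box_bump (1 / Suc n) a b x) \<longlonglongrightarrow> ?g x * indicator (box a b) x"
        by (intro AE_I2 tendsto_mult tendsto_const box_bump_tendsto)
      have "\<bar>?g x\<bar> * \<bar>box_bump (1 / Suc n) a b x\<bar> \<le> \<bar>?g x\<bar> * 1" for n x
        by (intro mult_left_mono box_bump_abs_le_1 pos) auto
      then show "AE x in lebesgue. norm (?g x * box_bump (1 / Suc n) a b x) \<le> \<bar>?g x\<bar>" for n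
        by (intro AE_I2) (simp add: abs_mult del: of_nat_Suc)
    qed
    moreover have "(\<integral>x. ?g x * box_bump (1 / Suc n) a b x \<partial>lebesgue) = 0" for n
    proof -
      have "(\<integral>x. ?g x * box_bump (1 / Suc n) a b x \<partial>lebesgue)
          = (LINT x:\<Omega>|lebesgue. f x * box_bump (1 / Suc n) a b x)"
        unfolding set_lebesgue_integral_def
        using ab box_bump_nonzero_iff[of "1 / Suc n" a b] box_subset_cbox[of a b]
        by (intro Bochner_Integration.integral_cong refl) (auto simp: indicator_def)
      also have "\<dots> = 0"
        using zero[OF test_function_box_bump[OF pos ab]] by (simp only: integral_lebesgue_on[OF \<Omega>])
      finally show ?thesis .
    qed
    ultimately have "(\<integral>x. ?g x * indicator (box a b) x \<partial>lebesgue) = 0"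
      by (simp add: LIMSEQ_const_iff del: of_nat_Suc)
    moreover have "?g x * indicator (box a b) x = indicator (box a b) x *\<^sub>R f x" for x
      using box_subset_cbox[of a b] by (auto simp: indicator_def)
    ultimately show ?thesis unfolding set_lebesgue_integral_def by (simp only:)
  qed
  have AEbox: "AE x in lebesgue. x \<in> cbox a b \<longrightarrow> f x = 0" if ab: "cbox a b \<subseteq> \<Omega>" for a b
  proof -
    \<comment> \<open>Cutting off to an open box gives a globally integrable function. Its integral
      over any box is an integral of \<open>f\<close> over an intersection of two boxes, again a
      box.\<close>
    have "AE x in lebesgue. indicator (box a b) x *\<^sub>R f x = 0"
    proof (rule AE_zero_of_box_integrals_lebesgue)
      show "integrable lebesgue (\<lambda>x. indicator (box a b) x *\<^sub>R f x)"
        using set_integrable_subset[OF cb[OF ab], of "box a b"] box_subset_cbox[of a b]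
        by (simp add: set_integrable_def)
      fix c d
      obtain e h where eh: "box c d \<inter> box a b = box e h" using box_Int_box by blast
      have "(LINT x:box c d|lebesgue. indicator (box a b) x *\<^sub>R f x) = (LINT x:box e h|lebesgue. f x)"
        unfolding set_lebesgue_integral_def eh[symmetric]
        by (intro Bochner_Integration.integral_cong refl) (auto simp: indicator_def)
      also have "\<dots> = 0"
      \<comment> \<open>When the open box is empty, nothing is known about the position of
        \<open>cbox e h\<close>. Otherwise \<open>cbox e h\<close> is its closure and hence stays
        inside \<open>cbox a b\<close>.\<close>
      proof (cases "box e h = {}")
        case False
        then have "cbox e h = closure (box e h)" by simp
        also have "\<dots> \<subseteq> cbox a b"
          using eh box_subset_cbox[of a b] by (intro closure_minimal) auto
        finally show ?thesis using box ab by blast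
      qed (simp add: set_lebesgue_integral_def)
      finally show "(LINT x:box c d|lebesgue. indicator (box a b) x *\<^sub>R f x) = 0" .
    qed
    moreover have "AE x in lebesgue. x \<notin> cbox a b - box a b"
      using negligible_frontier_interval[of a b] by (intro AE_not_in) (simp add: negligible_iff_null_sets)
    ultimately show ?thesis by eventually_elim (auto simp: indicator_def)
  qed
  obtain \<D> where \<D>: "countable \<D>" "\<D> \<subseteq> Pow \<Omega>" "\<And>X. X \<in> \<D> \<Longrightarrow> \<exists>a b. X = cbox a b" "\<Union>\<D> = \<Omega>"
    using open_countable_Union_open_cbox[OF \<open>open \<Omega>\<close>] by metis
  have "AE x in lebesgue. \<forall>X\<in>\<D>. x \<in> X \<longrightarrow> f x = 0"
    using \<D> AEbox by (subst AE_ball_countable) (auto, metis Pow_iff subsetD)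
  then have "AE x in lebesgue. x \<in> \<Omega> \<longrightarrow> f x = 0"
    by eventually_elim (use \<D>(4) in auto)
  then show ?thesis using \<Omega> by (simp add: AE_restrict_space_iff)
qed

section \<open>Weak derivatives along lines\<close>

lemma nn_integral_lborel_translate:
  fixes f :: "'a::euclidean_space \<Rightarrow> ennreal"
  assumes [measurable]: "f \<in> borel_measurable borel"
  shows "(\<integral>\<^sup>+x. f (x + c) \<partial>lborel) = (\<integral>\<^sup>+x. f x \<partial>lborel)"
proof -
  have "(\<integral>\<^sup>+x. f x \<partial>lborel) = (\<integral>\<^sup>+x. f x \<partial>distr lborel borel ((+) c))"
    by (simp add: lborel_distr_plus)
  also have "\<dots> = (\<integral>\<^sup>+x. f (c + x) \<partial>lborel)" by (rule nn_integral_distr) auto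
  finally show ?thesis by (simp add: add.commute)
qed

lemma integrable_lborel_translate:
  fixes f :: "'a::euclidean_space \<Rightarrow> 'b::{banach, second_countable_topology}"
  assumes "integrable lborel f"
  shows "integrable lborel (\<lambda>x. f (x + c))"
proof -
  have "integrable (distr lborel borel ((+) c)) f" using assms by (simp add: lborel_distr_plus)
  then show ?thesis by (subst (asm) integrable_distr_eq) (use assms in \<open>auto simp: add.commute\<close>)
qed

lemma integral_lborel_translate:
  fixes f :: "'a::euclidean_space \<Rightarrow> 'b::{banach, second_countable_topology}"
  assumes [measurable]: "f \<in> borel_measurable borel"
  shows "(LBINT x. f (x + c)) = (LBINT x. f x)"
proof -
  have "(LBINT x. f x) = (\<integral>x. f x \<partial>distr lborel borel ((+) c))"
    by (simp add: lborel_distr_plus)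
  also have "\<dots> = (LBINT x. f (c + x))" by (rule integral_distr) auto
  finally show ?thesis by (simp add: add.commute)
qed

text \<open>For fixed \<tau> the map \<open>x \<mapsto> x + \<tau> *\<^sub>R v\<close> preserves
  Lebesgue measure, so Tonelli bounds the double integral by \<open>C\<close> times the length of
  the interval times the integral of \<open>\<bar>h\<bar>\<close>. It justifies each exchange of the
  integrals over \<open>x\<close> and over the line parameter.\<close>

lemma integrable_shear:
  fixes h :: "'a::euclidean_space \<Rightarrow> real" and B :: "'a \<times> real \<Rightarrow> real"
  assumes h: "integrable lborel h" and B[measurable]: "B \<in> borel_measurable (borel \<Otimes>\<^sub>M borel)"
    and C: "\<And>z. \<bar>B z\<bar> \<le> C"
  shows "integrable (lborel \<Otimes>\<^sub>M lborel) (\<lambda>(x, \<tau>). indicator {0..t} \<tau> * (h (x + \<tau> *\<^sub>R v) * B (x, \<tau>)))"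
proof (rule integrableI_bounded)
  have hm[measurable]: "h \<in> borel_measurable borel" using h by auto
  show "(\<lambda>(x, \<tau>). indicator {0..t} \<tau> * (h (x + \<tau> *\<^sub>R v) * B (x, \<tau>))) \<in> borel_measurable (lborel \<Otimes>\<^sub>M lborel)"
    by measurable
  have C0: "C \<ge> 0" using C[of undefined] by linarith
  have "(\<integral>\<^sup>+z. ennreal (norm (case z of (x, \<tau>) \<Rightarrow> indicator {0..t} \<tau> * (h (x + \<tau> *\<^sub>R v) * B (x, \<tau>)))) \<partial>(lborel \<Otimes>\<^sub>M lborel))
     \<le> (\<integral>\<^sup>+z. (case z of (x, \<tau>) \<Rightarrow> ennreal (C * indicator {0..t} \<tau>) * ennreal \<bar>h (x + \<tau> *\<^sub>R v)\<bar>) \<partial>(lborel \<Otimes>\<^sub>M lborel))"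
  proof (intro nn_integral_mono, clarify)
    fix x \<tau>
    have "\<bar>h (x + \<tau> *\<^sub>R v)\<bar> * \<bar>B (x, \<tau>)\<bar> \<le> \<bar>h (x + \<tau> *\<^sub>R v)\<bar> * C" by (intro mult_left_mono C) auto
    then show "ennreal (norm (indicator {0..t} \<tau> * (h (x + \<tau> *\<^sub>R v) * B (x, \<tau>))))
       \<le> ennreal (C * indicator {0..t} \<tau>) * ennreal \<bar>h (x + \<tau> *\<^sub>R v)\<bar>"
      using C0 by (auto simp: abs_mult indicator_def mult.commute ennreal_mult'[symmetric] intro!: ennreal_leI)
  qed
  also have "\<dots> = (\<integral>\<^sup>+\<tau>. \<integral>\<^sup>+x. ennreal (C * indicator {0..t} \<tau>) * ennreal \<bar>h (x + \<tau> *\<^sub>R v)\<bar> \<partial>lborel \<partial>lborel)"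
    by (subst lborel_pair.nn_integral_snd[symmetric]) (auto, measurable)
  also have "\<dots> = (\<integral>\<^sup>+\<tau>. ennreal (C * indicator {0..t} \<tau>) * (\<integral>\<^sup>+x. ennreal \<bar>h x\<bar> \<partial>lborel) \<partial>lborel)"
    by (intro nn_integral_cong)
       (simp add: nn_integral_cmult nn_integral_lborel_translate[where f = "\<lambda>x. ennreal \<bar>h x\<bar>"])
  also have "\<dots> = ennreal C * emeasure lborel {0..t} * (\<integral>\<^sup>+x. ennreal \<bar>h x\<bar> \<partial>lborel)"
    using C0 by (simp add: nn_integral_multc ennreal_mult ennreal_indicator nn_integral_cmult)
  also have "\<dots> < \<infinity>"
    using h by (auto simp: integrable_iff_bounded ennreal_mult_less_top emeasure_lborel_Icc_eq)
  finally show "(\<integral>\<^sup>+z. ennreal (norm (case z of (x, \<tau>) \<Rightarrow> indicator {0..t} \<tau> * (h (x + \<tau> *\<^sub>R v) * B (x, \<tau>)))) \<partial>(lborel \<Otimes>\<^sub>M lborel)) < \<infinity>" .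
qed

lemma test_function_bounded:
  assumes "test_function \<Omega> \<phi>"
  obtains C where "C \<ge> 0" "\<And>x. \<bar>\<phi> x\<bar> \<le> C" "\<And>x. \<bar>frechet_derivative \<phi> (at x) v\<bar> \<le> C"
proof -
  let ?K = "closure {x. \<phi> x \<noteq> 0}" and ?D = "\<lambda>x. frechet_derivative \<phi> (at x) v"
  have K: "compact ?K" using assms by (simp add: test_function_def)
  have "bounded (\<phi> ` ?K)" "bounded (?D ` ?K)"
    using test_functionD(2,3)[OF assms]
    by (auto intro!: compact_imp_bounded compact_continuous_image K intro: continuous_on_subset)
  then obtain a b where a: "\<And>x. x \<in> ?K \<Longrightarrow> \<bar>\<phi> x\<bar> \<le> a" and b: "\<And>x. x \<in> ?K \<Longrightarrow> \<bar>?D x\<bar> \<le> b"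
    unfolding bounded_iff by auto
  show ?thesis
  proof (rule that[of "max 0 (max a b)"])
    show "\<bar>\<phi> x\<bar> \<le> max 0 (max a b)" for x
      using a[of x] closure_subset[of "{x. \<phi> x \<noteq> 0}"] by (cases "\<phi> x = 0") fastforce+
    show "\<bar>?D x\<bar> \<le> max 0 (max a b)" for x
      using b[of x] test_functionD(4)[OF assms, of x v] by (cases "x \<in> ?K") auto
  qed simp
qed

lemma test_function_line_derivative:
  assumes \<phi>: "test_function \<Omega> \<phi>"
  shows "((\<lambda>\<tau>. - \<phi> (x - \<tau> *\<^sub>R v)) has_real_derivative frechet_derivative \<phi> (at (x - \<tau> *\<^sub>R v)) v) (at \<tau>)"
proof -
  have "((\<lambda>\<tau>. x - \<tau> *\<^sub>R v) has_derivative (\<lambda>h. - (h *\<^sub>R v))) (at \<tau>)"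
    by (auto intro!: derivative_eq_intros)
  from has_derivative_compose[OF this test_functionD(1)[OF \<phi>]]
  have 1: "((\<lambda>\<tau>. \<phi> (x - \<tau> *\<^sub>R v)) has_derivative (\<lambda>h. frechet_derivative \<phi> (at (x - \<tau> *\<^sub>R v)) (- (h *\<^sub>R v)))) (at \<tau>)" .
  have "linear (frechet_derivative \<phi> (at (x - \<tau> *\<^sub>R v)))"
    using test_functionD(1)[OF \<phi>] has_derivative_linear by blast
  then have 2: "- frechet_derivative \<phi> (at (x - \<tau> *\<^sub>R v)) (- (h *\<^sub>R v)) = h * frechet_derivative \<phi> (at (x - \<tau> *\<^sub>R v)) v" for h
    by (simp add: linear_neg linear_scale)
  show ?thesis
    using has_derivative_minus[OF 1] unfolding 2 has_field_derivative_def by (simp add: mult_commute_abs)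
qed

lemma test_function_FTC:
  assumes \<phi>: "test_function \<Omega> \<phi>" and "0 \<le> t"
  shows "(LBINT \<tau>. indicator {0..t} \<tau> * frechet_derivative \<phi> (at (x - \<tau> *\<^sub>R v)) v) = \<phi> x - \<phi> (x - t *\<^sub>R v)"
proof -
  have "continuous_on {0..t} (\<lambda>\<tau>. frechet_derivative \<phi> (at (x - \<tau> *\<^sub>R v)) v)"
    using test_functionD(2)[OF \<phi>, of v]
    by (rule continuous_on_compose2) (auto intro!: continuous_intros)
  then have "(LINT \<tau>:{0..t}|lborel. frechet_derivative \<phi> (at (x - \<tau> *\<^sub>R v)) v) = - \<phi> (x - t *\<^sub>R v) - - \<phi> (x - 0 *\<^sub>R v)"
    using test_function_line_derivative[OF \<phi>] \<open>0 \<le> t\<close> unfolding set_lebesgue_integral_def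
    by (intro integral_FTC_Icc[unfolded set_lebesgue_integral_def])
       (auto simp: has_real_derivative_iff_has_vector_derivative intro: has_vector_derivative_at_within)
  then show ?thesis by (simp add: set_lebesgue_integral_def)
qed

lemma integrable_mult_bounded:
  fixes f b :: "'a \<Rightarrow> real"
  assumes "integrable M f" "b \<in> borel_measurable M" "\<And>x. \<bar>b x\<bar> \<le> C"
  shows "integrable M (\<lambda>x. f x * b x)"
proof (rule Bochner_Integration.integrable_bound[of M "\<lambda>x. C * f x"])
  have "\<bar>f x\<bar> * \<bar>b x\<bar> \<le> \<bar>C\<bar> * \<bar>f x\<bar>" for x
    using assms(3)[of x] by (subst mult.commute) (intro mult_right_mono, auto)
  then show "AE x in M. norm (f x * b x) \<le> norm (C * f x)" by (simp add: abs_mult)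
qed (use assms in auto)

text \<open>A fundamental theorem of calculus for weak derivatives at one fixed \<open>t\<close>;
  the exceptional null set may depend on \<open>t\<close>. The defect \<open>d\<close> is shown to
  be orthogonal to every test function \<phi> on \<open>W\<close>: translates of \<phi> by
  \<open>\<tau> *\<^sub>R v\<close> are supported in \<open>K\<close>, so the weak identity applies
  to each of them, and integrating it over \<tau> produces the increment of \<phi>.\<close>

lemma weak_derivative_on_lines:
  fixes u g :: "'a::euclidean_space \<Rightarrow> real"
  assumes u: "integrable lborel u" and g: "integrable lborel g"
    and weak: "\<And>\<psi>. test_function K \<psi> \<Longrightarrow>
      (LBINT x. u x * frechet_derivative \<psi> (at x) v) = - (LBINT x. g x * \<psi> x)"
    and "open W" "0 \<le> t" and W: "\<And>x \<tau>. x \<in> W \<Longrightarrow> 0 \<le> \<tau> \<Longrightarrow> \<tau> \<le> t \<Longrightarrow> x + \<tau> *\<^sub>R v \<in> K"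
  shows "AE x in lborel. x \<in> W \<longrightarrow>
    u (x + t *\<^sub>R v) - u x = (LBINT \<tau>. indicator {0..t} \<tau> * g (x + \<tau> *\<^sub>R v))"
proof -
  define J where "J x = (LBINT \<tau>. indicator {0..t} \<tau> * g (x + \<tau> *\<^sub>R v))" for x
  define d where "d x = u (x + t *\<^sub>R v) - u x - J x" for x
  have [measurable]: "u \<in> borel_measurable borel" "g \<in> borel_measurable borel" using u g by auto
  have J: "integrable lborel J"
    using lborel_pair.integrable_fst'[OF integrable_shear[OF g, of "\<lambda>_. 1" 1 t v]]
    by (simp add: J_def[abs_def])
  have ut: "integrable lborel (\<lambda>x. u (x + t *\<^sub>R v))" by (rule integrable_lborel_translate[OF u])
  have d: "integrable lborel d" unfolding d_def using ut u J by auto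
  have "AE x in lebesgue_on W. d x = 0"
  proof (rule du_bois_reymond[OF \<open>open W\<close>])
    have dl: "integrable lebesgue d" using d by (simp add: integrable_completion)
    show "locally_integrable W d"
      unfolding locally_integrable_def
    proof (intro allI impI)
      fix C assume "compact C \<and> C \<subseteq> W"
      then have "C \<in> sets borel" by (auto intro: borel_compact)
      then have "C \<in> sets lebesgue" by auto
      then show "integrable (lebesgue_on C) d"
        using dl by (subst integrable_lebesgue_on_iff) (auto simp: set_integrable_def intro!: integrable_mult_indicator[of _ lebesgue d, simplified])
    qed
    fix \<phi> assume \<phi>: "test_function W \<phi>"
    let ?D = "\<lambda>x. frechet_derivative \<phi> (at x) v"
    obtain C where C: "C \<ge> 0" "\<And>x. \<bar>\<phi> x\<bar> \<le> C" "\<And>x. \<bar>?D x\<bar> \<le> C"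
      using test_function_bounded[OF \<phi>] by blast
    have [measurable]: "\<phi> \<in> borel_measurable borel" "?D \<in> borel_measurable borel"
      using test_functionD(2,3)[OF \<phi>] by (auto intro!: borel_measurable_continuous_onI)
    have supp: "\<phi> x = 0" if "x \<notin> W" for x
      using \<phi> that closure_subset[of "{x. \<phi> x \<noteq> 0}"] unfolding test_function_def by blast
    have tf: "test_function K (\<lambda>x. \<phi> (x + - (\<tau> *\<^sub>R v)))" if "\<tau> \<in> {0..t}" for \<tau>
      using that \<phi> W by (intro test_function_translate[OF \<phi>]) (auto simp: test_function_def)
    have fd: "frechet_derivative (\<lambda>x. \<phi> (x + - (\<tau> *\<^sub>R v))) (at x) v = ?D (x - \<tau> *\<^sub>R v)" for x \<tau>
    proof -
      have "((\<lambda>x. x + - (\<tau> *\<^sub>R v)) has_derivative (\<lambda>x. x)) (at x)"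
        by (auto intro!: derivative_eq_intros)
      from has_derivative_compose[OF this test_functionD(1)[OF \<phi>]]
      have "((\<lambda>x. \<phi> (x + - (\<tau> *\<^sub>R v))) has_derivative frechet_derivative \<phi> (at (x - \<tau> *\<^sub>R v))) (at x)" by simp
      from frechet_derivative_at[OF this] show ?thesis by metis
    qed
    have I1: "(LBINT x. u (x + t *\<^sub>R v) * \<phi> x) = (LBINT x. u x * \<phi> (x - t *\<^sub>R v))"
      using integral_lborel_translate[of "\<lambda>x. u x * \<phi> (x - t *\<^sub>R v)" "t *\<^sub>R v"] by simp
    have i1: "integrable (lborel \<Otimes>\<^sub>M lborel) (\<lambda>(x, \<tau>). indicator {0..t} \<tau> * (g (x + \<tau> *\<^sub>R v) * \<phi> x))"
      using integrable_shear[OF g, of "\<lambda>z. \<phi> (fst z)" C t v] C by simp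
    \<comment> \<open>Here only the bounded factor moves with \<tau>, so the shear lemma is applied
      with direction 0.\<close>
    have i2: "integrable (lborel \<Otimes>\<^sub>M lborel) (\<lambda>(x, \<tau>). indicator {0..t} \<tau> * (u x * ?D (x - \<tau> *\<^sub>R v)))"
      using integrable_shear[OF u, of "\<lambda>z. ?D (fst z - snd z *\<^sub>R v)" C t 0] C by simp
    have "(LBINT x. J x * \<phi> x) = (LBINT x. \<integral>\<tau>. indicator {0..t} \<tau> * (g (x + \<tau> *\<^sub>R v) * \<phi> x) \<partial>lborel)"
      by (simp add: J_def mult.assoc[symmetric])
    also have "\<dots> = (LBINT \<tau>. \<integral>x. indicator {0..t} \<tau> * (g (x + \<tau> *\<^sub>R v) * \<phi> x) \<partial>lborel)"
      using lborel_pair.Fubini_integral[OF i1] by simp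
    also have "\<dots> = (LBINT \<tau>. \<integral>x. indicator {0..t} \<tau> * (- (u x * ?D (x - \<tau> *\<^sub>R v))) \<partial>lborel)"
    proof (rule Bochner_Integration.integral_cong[OF refl])
      fix \<tau> :: real
      show "(LBINT x. indicator {0..t} \<tau> * (g (x + \<tau> *\<^sub>R v) * \<phi> x))
         = (LBINT x. indicator {0..t} \<tau> * (- (u x * ?D (x - \<tau> *\<^sub>R v))))"
      proof (cases "\<tau> \<in> {0..t}")
        case True
        have "(LBINT x. g (x + \<tau> *\<^sub>R v) * \<phi> x) = (LBINT x. g x * \<phi> (x + - (\<tau> *\<^sub>R v)))"
          using integral_lborel_translate[of "\<lambda>x. g x * \<phi> (x - \<tau> *\<^sub>R v)" "\<tau> *\<^sub>R v"] by simp
        also have "\<dots> = - (LBINT x. u x * ?D (x - \<tau> *\<^sub>R v))"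
          using weak[OF tf[OF True]] unfolding fd by simp
        finally show ?thesis using True by simp
      qed simp
    qed
    also have "\<dots> = - (LBINT \<tau>. \<integral>x. indicator {0..t} \<tau> * (u x * ?D (x - \<tau> *\<^sub>R v)) \<partial>lborel)" by simp
    also have "\<dots> = - (LBINT x. \<integral>\<tau>. indicator {0..t} \<tau> * (u x * ?D (x - \<tau> *\<^sub>R v)) \<partial>lborel)"
      using lborel_pair.Fubini_integral[OF i2] by simp
    also have "\<dots> = - (LBINT x. u x * (\<phi> x - \<phi> (x - t *\<^sub>R v)))"
      by (simp add: test_function_FTC[OF \<phi> \<open>0 \<le> t\<close>, symmetric] mult.left_commute)
    finally have I2: "(LBINT x. J x * \<phi> x) = - (LBINT x. u x * (\<phi> x - \<phi> (x - t *\<^sub>R v)))" .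
    have "(LBINT x. d x * \<phi> x) = (LBINT x. u (x + t *\<^sub>R v) * \<phi> x - u x * \<phi> x - J x * \<phi> x)"
      by (simp add: d_def algebra_simps)
    also have "\<dots> = (LBINT x. u (x + t *\<^sub>R v) * \<phi> x) - (LBINT x. u x * \<phi> x) - (LBINT x. J x * \<phi> x)"
      using integrable_mult_bounded[OF ut _ C(2)] integrable_mult_bounded[OF u _ C(2)] integrable_mult_bounded[OF J _ C(2)]
      by simp
    also have "\<dots> = 0"
      unfolding I1 I2
      using integrable_mult_bounded[OF u _ C(2)] integrable_mult_bounded[OF u, of "\<lambda>x. \<phi> (x - t *\<^sub>R v)", OF _ C(2)]
      by (simp add: right_diff_distrib)
    finally have 0: "(LBINT x. d x * \<phi> x) = 0" .
    have "(\<integral>x. d x * \<phi> x \<partial>lebesgue_on W) = (\<integral>x. indicator W x *\<^sub>R (d x * \<phi> x) \<partial>lebesgue)"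
      using \<open>open W\<close> by (subst integral_lebesgue_on) (auto simp: set_lebesgue_integral_def)
    also have "\<dots> = (\<integral>x. d x * \<phi> x \<partial>lebesgue)"
      using supp by (intro Bochner_Integration.integral_cong refl) (auto simp: indicator_def)
    also have "\<dots> = 0" using 0 d by (subst integral_completion) auto
    finally show "(\<integral>x. d x * \<phi> x \<partial>lebesgue_on W) = 0" .
  qed
  then have "AE x in lebesgue. x \<in> W \<longrightarrow> d x = 0"
    using \<open>open W\<close> by (subst (asm) AE_restrict_space_iff) auto
  then have "AE x in lborel. x \<in> W \<longrightarrow> d x = 0" by (simp add: AE_completion_iff)
  then show ?thesis by eventually_elim (simp add: d_def J_def)
qed

section \<open>The chain rule for weak gradients\<close>

text \<open>A function that is not integrable has Bochner integral 0 by convention, so a bound on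
  the nonnegative integral of the absolute value decides both cases.\<close>

lemma abs_integral_le:
  fixes f :: "'a \<Rightarrow> real"
  assumes "(\<integral>\<^sup>+x. ennreal \<bar>f x\<bar> \<partial>M) \<le> ennreal r" "0 \<le> r"
  shows "\<bar>integral\<^sup>L M f\<bar> \<le> r"
proof (cases "integrable M f")
  case True
  have "ennreal \<bar>integral\<^sup>L M f\<bar> \<le> (\<integral>\<^sup>+x. ennreal \<bar>f x\<bar> \<partial>M)"
    using integral_norm_bound_ennreal[OF True] by simp
  then have "ennreal \<bar>integral\<^sup>L M f\<bar> \<le> ennreal r" using assms(1) by (rule order_trans)
  then show ?thesis using assms(2) by simp
qed (use assms in \<open>simp add: not_integrable_integral_eq\<close>)

lemma ennreal_abs_integral_le:
  fixes f :: "'a \<Rightarrow> real"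
  shows "ennreal \<bar>integral\<^sup>L M f\<bar> \<le> (\<integral>\<^sup>+x. ennreal \<bar>f x\<bar> \<partial>M)"
  using integral_norm_bound_ennreal[of M f]
  by (cases "integrable M f") (auto simp: not_integrable_integral_eq)

lemma abs_integral_Icc_le:
  fixes f :: "real \<Rightarrow> real"
  assumes "\<And>\<tau>. \<tau> \<in> {0..t} \<Longrightarrow> \<bar>f \<tau>\<bar> \<le> c" "0 \<le> c" "0 \<le> t"
  shows "\<bar>\<integral>\<tau>. indicator {0..t} \<tau> * f \<tau> \<partial>lborel\<bar> \<le> c * t"
proof (rule abs_integral_le)
  have "(\<integral>\<^sup>+\<tau>. ennreal \<bar>indicator {0..t} \<tau> * f \<tau>\<bar> \<partial>lborel) \<le> (\<integral>\<^sup>+\<tau>. ennreal c * indicator {0..t} \<tau> \<partial>lborel)"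
    using assms by (intro nn_integral_mono) (auto simp: indicator_def intro: ennreal_leI)
  also have "\<dots> = ennreal (c * t)"
    using assms by (subst nn_integral_cmult_indicator) (auto simp: ennreal_mult)
  finally show "(\<integral>\<^sup>+\<tau>. ennreal \<bar>indicator {0..t} \<tau> * f \<tau>\<bar> \<partial>lborel) \<le> ennreal (c * t)" .
qed (use assms in auto)

text \<open>The increment is written as a line integral of \<open>g\<close>, and each product of two
  translates of \<open>g\<close> is bounded by half the sum of their squares. By translation
  invariance each \<sigma> then contributes at most \<open>N\<close>, and \<sigma> ranges over an
  interval of length \<open>t\<close>. The offset \<rho> is kept independent of \<tau> because the
  bound on the squared increment integrates over it.\<close>

lemma increment_product_bound:
  fixes u g :: "'a::euclidean_space \<Rightarrow> real"
  assumes [measurable]: "u \<in> borel_measurable borel" "g \<in> borel_measurable borel"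
    and N: "(\<integral>\<^sup>+x. ennreal ((g x)\<^sup>2) \<partial>lborel) \<le> ennreal N" "0 \<le> N"
    and line: "AE x in lborel. x \<in> W \<longrightarrow>
      u (x + \<tau> *\<^sub>R v) - u x = (LBINT \<sigma>. indicator {0..\<tau>} \<sigma> * g (x + \<sigma> *\<^sub>R v))"
    and "\<tau> \<le> t" "0 \<le> t"
  shows "(\<integral>\<^sup>+x. ennreal (indicator W x * \<bar>u (x + \<tau> *\<^sub>R v) - u x\<bar> * \<bar>g (x + \<rho> *\<^sub>R v)\<bar>) \<partial>lborel) \<le> ennreal (N * t)"
proof -
  let ?P = "\<lambda>x. ennreal (indicator W x * \<bar>u (x + \<tau> *\<^sub>R v) - u x\<bar> * \<bar>g (x + \<rho> *\<^sub>R v)\<bar>)"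
  let ?Q = "\<lambda>x \<sigma>. ennreal (indicator {0..t} \<sigma>) * (ennreal ((g (x + \<sigma> *\<^sub>R v))\<^sup>2 / 2) + ennreal ((g (x + \<rho> *\<^sub>R v))\<^sup>2 / 2))"
  have trN: "(\<integral>\<^sup>+x. ennreal ((g (x + c))\<^sup>2) \<partial>lborel) \<le> ennreal N" for c
    using nn_integral_lborel_translate[of "\<lambda>x. ennreal ((g x)\<^sup>2)" c] N by simp
  have "(\<integral>\<^sup>+x. ?P x \<partial>lborel)
     \<le> (\<integral>\<^sup>+x. \<integral>\<^sup>+\<sigma>. ?Q x \<sigma> \<partial>lborel \<partial>lborel)"
    using line
  proof (intro nn_integral_mono_AE, eventually_elim)
    fix x assume x: "x \<in> W \<longrightarrow> u (x + \<tau> *\<^sub>R v) - u x = (LBINT \<sigma>. indicator {0..\<tau>} \<sigma> * g (x + \<sigma> *\<^sub>R v))"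
    show "?P x
      \<le> (\<integral>\<^sup>+\<sigma>. ?Q x \<sigma> \<partial>lborel)"
    proof (cases "x \<in> W")
      case True
      have "?P x
         = ennreal \<bar>\<integral>\<sigma>. indicator {0..\<tau>} \<sigma> * g (x + \<sigma> *\<^sub>R v) \<partial>lborel\<bar> * ennreal \<bar>g (x + \<rho> *\<^sub>R v)\<bar>"
        using True x by (simp add: ennreal_mult)
      also have "\<dots> \<le> (\<integral>\<^sup>+\<sigma>. ennreal \<bar>indicator {0..\<tau>} \<sigma> * g (x + \<sigma> *\<^sub>R v)\<bar> \<partial>lborel) * ennreal \<bar>g (x + \<rho> *\<^sub>R v)\<bar>"
        by (intro mult_right_mono ennreal_abs_integral_le) auto
      also have "\<dots> = (\<integral>\<^sup>+\<sigma>. ennreal \<bar>indicator {0..\<tau>} \<sigma> * g (x + \<sigma> *\<^sub>R v)\<bar> * ennreal \<bar>g (x + \<rho> *\<^sub>R v)\<bar> \<partial>lborel)"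
        by (intro nn_integral_multc[symmetric]) measurable
      also have "\<dots> \<le> (\<integral>\<^sup>+\<sigma>. ?Q x \<sigma> \<partial>lborel)"
      proof (intro nn_integral_mono)
        fix \<sigma>
        have "\<bar>g (x + \<sigma> *\<^sub>R v)\<bar> * \<bar>g (x + \<rho> *\<^sub>R v)\<bar> \<le> (g (x + \<sigma> *\<^sub>R v))\<^sup>2 / 2 + (g (x + \<rho> *\<^sub>R v))\<^sup>2 / 2"
          using sum_squares_bound[of "\<bar>g (x + \<sigma> *\<^sub>R v)\<bar>" "\<bar>g (x + \<rho> *\<^sub>R v)\<bar>"] by simp
        then show "ennreal \<bar>indicator {0..\<tau>} \<sigma> * g (x + \<sigma> *\<^sub>R v)\<bar> * ennreal \<bar>g (x + \<rho> *\<^sub>R v)\<bar>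
           \<le> ?Q x \<sigma>"
          using \<open>\<tau> \<le> t\<close>
          by (auto simp: indicator_def ennreal_mult[symmetric] ennreal_plus[symmetric] simp del: ennreal_plus intro!: ennreal_leI)
      qed
      finally show ?thesis .
    qed simp
  qed
  also have "\<dots> = (\<integral>\<^sup>+\<sigma>. \<integral>\<^sup>+x. ?Q x \<sigma> \<partial>lborel \<partial>lborel)"
    by (intro lborel_pair.Fubini'[symmetric]) measurable
  also have "\<dots> \<le> (\<integral>\<^sup>+\<sigma>. ennreal (indicator {0..t} \<sigma>) * ennreal N \<partial>lborel)"
  proof (intro nn_integral_mono)
    fix \<sigma>
    have h: "(\<integral>\<^sup>+x. ennreal ((g (x + c))\<^sup>2 / 2) \<partial>lborel) \<le> ennreal (N / 2)" for c
    proof -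
      have "(\<integral>\<^sup>+x. ennreal ((g (x + c))\<^sup>2 / 2) \<partial>lborel) = (\<integral>\<^sup>+x. ennreal (1/2) * ennreal ((g (x + c))\<^sup>2) \<partial>lborel)"
        by (intro nn_integral_cong) (simp add: ennreal_mult[symmetric] del: ennreal_half)
      also have "\<dots> = ennreal (1/2) * (\<integral>\<^sup>+x. ennreal ((g (x + c))\<^sup>2) \<partial>lborel)"
        by (intro nn_integral_cmult) measurable
      also have "\<dots> \<le> ennreal (1/2) * ennreal N" by (intro mult_left_mono trN) auto
      finally show ?thesis using N(2) by (simp add: ennreal_mult[symmetric] del: ennreal_half)
    qed
    have "(\<integral>\<^sup>+x. ?Q x \<sigma> \<partial>lborel)
      = ennreal (indicator {0..t} \<sigma>) * ((\<integral>\<^sup>+x. ennreal ((g (x + \<sigma> *\<^sub>R v))\<^sup>2 / 2) \<partial>lborel) + (\<integral>\<^sup>+x. ennreal ((g (x + \<rho> *\<^sub>R v))\<^sup>2 / 2) \<partial>lborel))"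
      by (simp add: nn_integral_cmult nn_integral_add)
    also have "\<dots> \<le> ennreal (indicator {0..t} \<sigma>) * (ennreal (N / 2) + ennreal (N / 2))"
      by (intro mult_left_mono add_mono h) auto
    also have "ennreal (N / 2) + ennreal (N / 2) = ennreal N"
      using N(2) by (simp add: ennreal_plus[symmetric] del: ennreal_plus)
    finally show "(\<integral>\<^sup>+x. ?Q x \<sigma> \<partial>lborel)
      \<le> ennreal (indicator {0..t} \<sigma>) * ennreal N" .
  qed
  also have "\<dots> = ennreal (N * t)"
    using N(2) \<open>0 \<le> t\<close> by (simp add: ennreal_indicator mult.commute[of "indicator _ _"] nn_integral_cmult_indicator ennreal_mult)
  finally show ?thesis .
qed

text \<open>Only one of the two factors of the square is expanded as a line integral; the other
  stays an increment. For each \<sigma> the product is then covered by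
  \<open>increment_product_bound\<close>, and integrating over \<sigma> gives the second factor
  \<open>t\<close>.\<close>

lemma increment_square_bound:
  fixes u g :: "'a::euclidean_space \<Rightarrow> real"
  assumes [measurable]: "u \<in> borel_measurable borel" "g \<in> borel_measurable borel" "W \<in> sets borel"
    and N: "(\<integral>\<^sup>+x. ennreal ((g x)\<^sup>2) \<partial>lborel) \<le> ennreal N" "0 \<le> N"
    and line: "AE x in lborel. x \<in> W \<longrightarrow>
      u (x + t *\<^sub>R v) - u x = (LBINT \<sigma>. indicator {0..t} \<sigma> * g (x + \<sigma> *\<^sub>R v))"
    and "0 \<le> t"
  shows "(\<integral>\<^sup>+x. ennreal (indicator W x * (u (x + t *\<^sub>R v) - u x)\<^sup>2) \<partial>lborel) \<le> ennreal (N * t * t)"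
proof -
  let ?\<Delta> = "\<lambda>x. u (x + t *\<^sub>R v) - u x"
  let ?Q = "\<lambda>x \<sigma>. indicator {0..t} \<sigma> * ennreal (indicator W x * \<bar>?\<Delta> x\<bar> * \<bar>g (x + \<sigma> *\<^sub>R v)\<bar>)"
  have "(\<integral>\<^sup>+x. ennreal (indicator W x * (?\<Delta> x)\<^sup>2) \<partial>lborel)
     \<le> (\<integral>\<^sup>+x. \<integral>\<^sup>+\<sigma>. ?Q x \<sigma> \<partial>lborel \<partial>lborel)"
    using line
  proof (intro nn_integral_mono_AE, eventually_elim)
    fix x assume x: "x \<in> W \<longrightarrow> u (x + t *\<^sub>R v) - u x = (LBINT \<sigma>. indicator {0..t} \<sigma> * g (x + \<sigma> *\<^sub>R v))"
    have "ennreal (indicator W x * (?\<Delta> x)\<^sup>2) = ennreal (indicator W x * \<bar>?\<Delta> x\<bar>) * ennreal (indicator W x * \<bar>?\<Delta> x\<bar>)"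
      by (auto simp: ennreal_mult[symmetric] indicator_def power2_eq_square)
    also have "\<dots> \<le> ennreal (indicator W x * \<bar>?\<Delta> x\<bar>) * (\<integral>\<^sup>+\<sigma>. ennreal \<bar>indicator {0..t} \<sigma> * g (x + \<sigma> *\<^sub>R v)\<bar> \<partial>lborel)"
      using x ennreal_abs_integral_le[of lborel "\<lambda>\<sigma>. indicator {0..t} \<sigma> * g (x + \<sigma> *\<^sub>R v)"]
      by (intro mult_left_mono) (auto simp: indicator_def)
    also have "\<dots> = (\<integral>\<^sup>+\<sigma>. ennreal (indicator W x * \<bar>?\<Delta> x\<bar>) * ennreal \<bar>indicator {0..t} \<sigma> * g (x + \<sigma> *\<^sub>R v)\<bar> \<partial>lborel)"
      by (intro nn_integral_cmult[symmetric]) measurable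
    also have "\<dots> = (\<integral>\<^sup>+\<sigma>. ?Q x \<sigma> \<partial>lborel)"
      by (intro nn_integral_cong) (auto simp: indicator_def ennreal_mult)
    finally show "ennreal (indicator W x * (?\<Delta> x)\<^sup>2)
      \<le> (\<integral>\<^sup>+\<sigma>. ?Q x \<sigma> \<partial>lborel)" .
  qed
  also have "\<dots> = (\<integral>\<^sup>+\<sigma>. \<integral>\<^sup>+x. ?Q x \<sigma> \<partial>lborel \<partial>lborel)"
    by (intro lborel_pair.Fubini'[symmetric]) measurable
  also have "\<dots> = (\<integral>\<^sup>+\<sigma>. indicator {0..t} \<sigma> * (\<integral>\<^sup>+x. ennreal (indicator W x * \<bar>?\<Delta> x\<bar> * \<bar>g (x + \<sigma> *\<^sub>R v)\<bar>) \<partial>lborel) \<partial>lborel)"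
    by (intro nn_integral_cong nn_integral_cmult) measurable
  also have "\<dots> \<le> (\<integral>\<^sup>+\<sigma>. indicator {0..t} \<sigma> * ennreal (N * t) \<partial>lborel)"
    by (intro nn_integral_mono mult_left_mono increment_product_bound[OF _ _ N line]) (use \<open>0 \<le> t\<close> in auto)
  also have "\<dots> = ennreal (N * t * t)"
    using N(2) \<open>0 \<le> t\<close> by (subst nn_integral_multc) (auto simp: ennreal_mult[symmetric] mult.commute)
  finally show ?thesis .
qed

lemma derivative_borel_measurable:
  fixes F F' :: "real \<Rightarrow> real"
  assumes "\<And>t. (F has_real_derivative F' t) (at t)"
  shows "F \<in> borel_measurable borel"
  using DERIV_isCont[OF assms] by (intro borel_measurable_continuous_onI continuous_at_imp_continuous_on ballI)

lemma lipschitz_borel_measurable: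
  fixes F :: "real \<Rightarrow> real"
  assumes M: "\<And>a b. \<bar>F a - F b\<bar> \<le> M * \<bar>a - b\<bar>"
  shows "F \<in> borel_measurable borel"
proof -
  have "M-lipschitz_on UNIV F"
    using M[of 0 1] by (intro lipschitz_onI) (auto simp: dist_real_def M)
  then show ?thesis
    by (intro borel_measurable_continuous_onI lipschitz_on_continuous_on)
qed

lemma bounded_derivative_lipschitz:
  fixes F F' :: "real \<Rightarrow> real"
  assumes F: "\<And>t. (F has_real_derivative F' t) (at t)" and L: "\<And>a. \<bar>F' a\<bar> \<le> L"
  shows "\<bar>F a - F b\<bar> \<le> L * \<bar>a - b\<bar>"
  using field_differentiable_bound[of UNIV F F' L a b] F L by (auto intro: has_field_derivative_at_within)

text \<open>By the mean value theorem the remainder is \<open>(F' z - F' a) * (b - a)\<close> with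
  \<open>z\<close> no farther from \<open>a\<close> than \<open>b\<close> is. This gives the
  constant \<open>M\<close> directly from the Lipschitz bound on \<open>F'\<close>.\<close>

lemma lipschitz_derivative_taylor:
  fixes F F' :: "real \<Rightarrow> real"
  assumes F: "\<And>t. (F has_real_derivative F' t) (at t)" and M: "\<And>a b. \<bar>F' a - F' b\<bar> \<le> M * \<bar>a - b\<bar>"
  shows "\<bar>F b - F a - F' a * (b - a)\<bar> \<le> M * (b - a)\<^sup>2"
proof -
  have *: "\<exists>z. F b - F a = F' z * (b - a) \<and> \<bar>z - a\<bar> \<le> \<bar>b - a\<bar>"
  proof (cases a b rule: linorder_cases)
    case less
    from MVT2[OF less, of F F'] F obtain z where "a < z" "z < b" "F b - F a = (b - a) * F' z" by auto
    then show ?thesis by (intro exI[of _ z]) (auto simp: mult.commute)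
  next
    case greater
    from MVT2[OF greater, of F F'] F obtain z where "b < z" "z < a" "F a - F b = (a - b) * F' z" by auto
    then show ?thesis by (intro exI[of _ z]) (auto simp: algebra_simps)
  qed auto
  then obtain z where z: "F b - F a = F' z * (b - a)" "\<bar>z - a\<bar> \<le> \<bar>b - a\<bar>" by blast
  have "0 \<le> M" using M[of 0 1] by simp
  have "\<bar>F b - F a - F' a * (b - a)\<bar> = \<bar>F' z - F' a\<bar> * \<bar>b - a\<bar>"
    unfolding z(1) by (simp add: abs_mult[symmetric] algebra_simps)
  also have "\<dots> \<le> (M * \<bar>z - a\<bar>) * \<bar>b - a\<bar>" by (intro mult_right_mono M) auto
  also have "\<dots> \<le> (M * \<bar>b - a\<bar>) * \<bar>b - a\<bar>"
    using z(2) \<open>0 \<le> M\<close> by (intro mult_right_mono mult_left_mono) auto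
  also have "\<dots> = M * (b - a)\<^sup>2" by (simp add: power2_eq_square)
  finally show ?thesis .
qed

text \<open>No mollification is needed: the error is quadratic in the increments \<open>u (x + \<tau> v) - u x\<close>,
  and since \<open>g\<close> is square integrable their squares integrate to \<open>O(t\<^sup>2)\<close>.\<close>

lemma chain_rule_translation_estimate:
  fixes u g :: "'a::euclidean_space \<Rightarrow> real" and F F' :: "real \<Rightarrow> real"
  assumes u: "integrable lborel u" and g: "integrable lborel g"
    and N: "(\<integral>\<^sup>+x. ennreal ((g x)\<^sup>2) \<partial>lborel) \<le> ennreal N" "0 \<le> N"
    and weak: "\<And>\<psi>. test_function K \<psi> \<Longrightarrow>
      (LBINT x. u x * frechet_derivative \<psi> (at x) v) = - (LBINT x. g x * \<psi> x)"
    and F: "\<And>t. (F has_real_derivative F' t) (at t)"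
    and L: "\<And>a. \<bar>F' a\<bar> \<le> L" and M: "\<And>a b. \<bar>F' a - F' b\<bar> \<le> M * \<bar>a - b\<bar>"
    and Fu: "integrable lborel (\<lambda>x. F (u x))"
    and \<phi>: "test_function \<Omega> \<phi>" and C: "\<And>x. \<bar>\<phi> x\<bar> \<le> C" "\<And>x. \<bar>frechet_derivative \<phi> (at x) v\<bar> \<le> C"
    and K: "\<And>x \<tau>. \<phi> x \<noteq> 0 \<Longrightarrow> 0 \<le> \<tau> \<Longrightarrow> \<tau> \<le> t \<Longrightarrow> x + \<tau> *\<^sub>R v \<in> K" and "0 \<le> t"
  shows "\<bar>(LBINT x. F (u x) * (\<phi> (x - t *\<^sub>R v) - \<phi> x)) - t * (LBINT x. F' (u x) * g x * \<phi> x)\<bar>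
    \<le> (2 * M * C * N + L * C * (LBINT x. \<bar>g x\<bar>)) * (t * t)"
proof -
  define W where "W = {x. \<phi> x \<noteq> 0}"
  define I where "I = (LBINT x. \<bar>g x\<bar>)"
  define w where "w x = F' (u x) * g x" for x
  have C0: "C \<ge> 0" using C(1)[of 0] by linarith
  have M0: "M \<ge> 0" using M[of 0 1] by simp
  have L0: "L \<ge> 0" using L[of 0] by linarith
  have I0: "I \<ge> 0" by (simp add: I_def)
  have W: "open W"
    using open_Collect_neq[OF test_functionD(3)[OF \<phi>] continuous_on_const] by (simp add: W_def)
  have [measurable]: "F' \<in> borel_measurable borel" by (rule lipschitz_borel_measurable[OF M])
  have [measurable]: "F \<in> borel_measurable borel" by (rule derivative_borel_measurable[OF F])
  have [measurable]: "u \<in> borel_measurable borel" "g \<in> borel_measurable borel" "W \<in> sets borel"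
    using u g W by auto
  have [measurable]: "\<phi> \<in> borel_measurable borel"
    using test_functionD(3)[OF \<phi>] by (rule borel_measurable_continuous_onI)
  have w: "integrable lborel w"
    using integrable_mult_bounded[OF g, of "\<lambda>x. F' (u x)" L] L by (simp add: w_def[abs_def] mult.commute)
  have F'b: "\<bar>F' (u x) * \<phi> y\<bar> \<le> L * C" for x y
    unfolding abs_mult using L C(1) by (intro mult_mono) (auto simp: L0)
  have line: "AE x in lborel. x \<in> W \<longrightarrow>
      u (x + \<tau> *\<^sub>R v) - u x = (LBINT \<sigma>. indicator {0..\<tau>} \<sigma> * g (x + \<sigma> *\<^sub>R v))" if "\<tau> \<in> {0..t}" for \<tau>
    using that K by (intro weak_derivative_on_lines[OF u g weak W]) (auto simp: W_def)
  have linet: "AE x in lborel. x \<in> W \<longrightarrow>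
      u (x + t *\<^sub>R v) - u x = (LBINT \<sigma>. indicator {0..t} \<sigma> * g (x + \<sigma> *\<^sub>R v))"
    using line[of t] \<open>0 \<le> t\<close> by simp
  let ?\<Delta> = "\<lambda>x. u (x + t *\<^sub>R v) - u x"
  let ?E = "\<lambda>x. (F (u (x + t *\<^sub>R v)) - F (u x)) * \<phi> x - ?\<Delta> x * (F' (u x) * \<phi> x)"
  let ?G = "\<lambda>x \<tau>. indicator {0..t} \<tau> * (g (x + \<tau> *\<^sub>R v) * (F' (u x) * \<phi> x))"

  \<comment> \<open>The estimate follows the chain \<open>A0\<close>, \<open>A1 = A2\<close>,
    \<open>A3\<close>, \<open>t * B4\<close>. From \<open>A0\<close> to \<open>A1\<close> the
    increment of \<open>F\<close> is linearised; \<open>A1 = A2\<close> is the line representation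
    with Fubini; from \<open>B2\<close> to \<open>B3\<close> the argument of \<open>F'\<close> moves
    from \<open>u x\<close> to \<open>u (x + \<tau> *\<^sub>R v)\<close>; from \<open>B3\<close> to
    \<open>B4\<close> the translation is put on \<phi>, which is Lipschitz along \<open>v\<close>.
    The errors at fixed \<tau> are \<open>O(t)\<close>, hence \<open>O(t\<^sup>2)\<close> after
    integration over \<tau>.\<close>
  define A0 where "A0 = (LBINT x. (F (u (x + t *\<^sub>R v)) - F (u x)) * \<phi> x)"
  define A1 where "A1 = (LBINT x. ?\<Delta> x * (F' (u x) * \<phi> x))"
  define B2 where "B2 \<tau> = (LBINT x. g (x + \<tau> *\<^sub>R v) * (F' (u x) * \<phi> x))" for \<tau>
  define B3 where "B3 \<tau> = (LBINT x. w (x + \<tau> *\<^sub>R v) * \<phi> x)" for \<tau>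
  define B4 where "B4 = (LBINT x. w x * \<phi> x)"
  define A2 where "A2 = (LBINT \<tau>. indicator {0..t} \<tau> * B2 \<tau>)"
  define A3 where "A3 = (LBINT \<tau>. indicator {0..t} \<tau> * B3 \<tau>)"

  have iFt: "integrable lborel (\<lambda>x. F (u (x + t *\<^sub>R v)))" by (rule integrable_lborel_translate[OF Fu])
  have iut: "integrable lborel (\<lambda>x. u (x + t *\<^sub>R v))" by (rule integrable_lborel_translate[OF u])
  have S: "(LBINT x. F (u x) * (\<phi> (x - t *\<^sub>R v) - \<phi> x)) = A0"
  proof -
    have "(LBINT x. F (u x) * (\<phi> (x - t *\<^sub>R v) - \<phi> x))
       = (LBINT x. F (u x) * \<phi> (x - t *\<^sub>R v)) - (LBINT x. F (u x) * \<phi> x)"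
      using integrable_mult_bounded[OF Fu, of \<phi>, OF _ C(1)] integrable_mult_bounded[OF Fu, of "\<lambda>x. \<phi> (x - t *\<^sub>R v)", OF _ C(1)]
      by (simp add: right_diff_distrib)
    also have "(LBINT x. F (u x) * \<phi> (x - t *\<^sub>R v)) = (LBINT x. F (u (x + t *\<^sub>R v)) * \<phi> x)"
      using integral_lborel_translate[of "\<lambda>x. F (u x) * \<phi> (x - t *\<^sub>R v)" "t *\<^sub>R v"] by simp
    also have "\<dots> - (LBINT x. F (u x) * \<phi> x) = A0"
      unfolding A0_def
      using integrable_mult_bounded[OF Fu, of \<phi>, OF _ C(1)] integrable_mult_bounded[OF iFt, of \<phi>, OF _ C(1)]
      by (simp add: left_diff_distrib)
    finally show ?thesis .
  qed
  have 01: "\<bar>A0 - A1\<bar> \<le> M * C * (N * t * t)"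
  proof -
    have "A0 - A1 = (LBINT x. ?E x)"
      unfolding A0_def A1_def
      by (intro Bochner_Integration.integral_diff[symmetric] integrable_mult_bounded[OF _ _ C(1)]
            integrable_mult_bounded[OF _ _ F'b] Bochner_Integration.integrable_diff iFt Fu iut u) measurable
    also have "\<bar>\<dots>\<bar> \<le> M * C * (N * t * t)"
    proof (rule abs_integral_le)
      have "(\<integral>\<^sup>+x. ennreal \<bar>?E x\<bar> \<partial>lborel)
        \<le> (\<integral>\<^sup>+x. ennreal (M * C) * ennreal (indicator W x * (?\<Delta> x)\<^sup>2) \<partial>lborel)"
      proof (intro nn_integral_mono)
        fix x
        have "\<bar>?E x\<bar>
           = \<bar>F (u (x + t *\<^sub>R v)) - F (u x) - F' (u x) * ?\<Delta> x\<bar> * \<bar>\<phi> x\<bar>"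
          by (simp add: abs_mult[symmetric] algebra_simps)
        also have "\<dots> \<le> (M * (?\<Delta> x)\<^sup>2) * (C * indicator W x)"
          using C(1) M0 by (intro mult_mono lipschitz_derivative_taylor[OF F M]) (auto simp: W_def indicator_def)
        finally show "ennreal \<bar>?E x\<bar>
          \<le> ennreal (M * C) * ennreal (indicator W x * (?\<Delta> x)\<^sup>2)"
          using M0 C0 by (simp add: ennreal_mult[symmetric] mult_ac ennreal_leI)
      qed
      also have "\<dots> = ennreal (M * C) * (\<integral>\<^sup>+x. ennreal (indicator W x * (?\<Delta> x)\<^sup>2) \<partial>lborel)"
        by (intro nn_integral_cmult) measurable
      also have "\<dots> \<le> ennreal (M * C) * ennreal (N * t * t)"
        using \<open>0 \<le> t\<close> by (intro mult_left_mono increment_square_bound[OF _ _ _ N line]) auto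
      finally show "(\<integral>\<^sup>+x. ennreal \<bar>?E x\<bar> \<partial>lborel)
         \<le> ennreal (M * C * (N * t * t))"
        using M0 C0 N(2) \<open>0 \<le> t\<close> by (simp add: ennreal_mult[symmetric])
    qed (use M0 C0 N(2) \<open>0 \<le> t\<close> in auto)
    finally show ?thesis .
  qed
  have i2: "integrable (lborel \<Otimes>\<^sub>M lborel) (\<lambda>(x, \<tau>). ?G x \<tau>)"
    using integrable_shear[OF g, of "\<lambda>z. F' (u (fst z)) * \<phi> (fst z)" "L * C" t v] F'b by simp
  have i3: "integrable (lborel \<Otimes>\<^sub>M lborel) (\<lambda>(x, \<tau>). indicator {0..t} \<tau> * (w (x + \<tau> *\<^sub>R v) * \<phi> x))"
    using integrable_shear[OF w, of "\<lambda>z. \<phi> (fst z)" C t v] C(1) by simp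
  have iB2: "integrable lborel (\<lambda>\<tau>. indicator {0..t} \<tau> * B2 \<tau>)"
    using lborel_pair.integrable_snd[OF i2] by (simp add: B2_def)
  have iB3: "integrable lborel (\<lambda>\<tau>. indicator {0..t} \<tau> * B3 \<tau>)"
    using lborel_pair.integrable_snd[OF i3] by (simp add: B3_def)
  have 12: "A1 = A2"
  proof -
    have "A1 = (LBINT x. \<integral>\<tau>. ?G x \<tau> \<partial>lborel)"
      unfolding A1_def
    proof (rule integral_cong_AE)
      show "(\<lambda>x. \<integral>\<tau>. ?G x \<tau> \<partial>lborel) \<in> borel_measurable lborel"
        using lborel_pair.integrable_fst'[OF i2] by auto
      show "AE x in lborel. ?\<Delta> x * (F' (u x) * \<phi> x) = (LBINT \<tau>. ?G x \<tau>)"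
        using linet
      proof eventually_elim
        fix x assume "x \<in> W \<longrightarrow> ?\<Delta> x = (LBINT \<sigma>. indicator {0..t} \<sigma> * g (x + \<sigma> *\<^sub>R v))"
        then show "?\<Delta> x * (F' (u x) * \<phi> x) = (LBINT \<tau>. ?G x \<tau>)"
          by (cases "x \<in> W") (simp_all add: mult.assoc[symmetric], simp add: W_def)
      qed
    qed measurable
    also have "\<dots> = (LBINT \<tau>. \<integral>x. ?G x \<tau> \<partial>lborel)"
      using lborel_pair.Fubini_integral[OF i2] by simp
    also have "\<dots> = A2" by (simp add: A2_def B2_def)
    finally show ?thesis .
  qed
  have B23: "\<bar>B2 \<tau> - B3 \<tau>\<bar> \<le> M * C * (N * t)" if \<tau>: "\<tau> \<in> {0..t}" for \<tau>
  proof -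
    let ?\<Delta>' = "\<lambda>x. u (x + \<tau> *\<^sub>R v) - u x"
    let ?E' = "\<lambda>x. g (x + \<tau> *\<^sub>R v) * (F' (u x) * \<phi> x) - w (x + \<tau> *\<^sub>R v) * \<phi> x"
    have "B2 \<tau> - B3 \<tau> = (LBINT x. ?E' x)"
      unfolding B2_def B3_def
      by (intro Bochner_Integration.integral_diff[symmetric] integrable_mult_bounded[OF _ _ C(1)]
            integrable_mult_bounded[OF _ _ F'b] integrable_lborel_translate g w) measurable
    also have "\<bar>\<dots>\<bar> \<le> M * C * (N * t)"
    proof (rule abs_integral_le)
      have "(\<integral>\<^sup>+x. ennreal \<bar>?E' x\<bar> \<partial>lborel)
        \<le> (\<integral>\<^sup>+x. ennreal (M * C) * ennreal (indicator W x * \<bar>?\<Delta>' x\<bar> * \<bar>g (x + \<tau> *\<^sub>R v)\<bar>) \<partial>lborel)"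
      proof (intro nn_integral_mono)
        fix x
        have "\<bar>?E' x\<bar>
           = \<bar>F' (u x) - F' (u (x + \<tau> *\<^sub>R v))\<bar> * (\<bar>g (x + \<tau> *\<^sub>R v)\<bar> * \<bar>\<phi> x\<bar>)"
          unfolding w_def by (simp add: abs_mult[symmetric] algebra_simps)
        also have "\<dots> \<le> (M * \<bar>u x - u (x + \<tau> *\<^sub>R v)\<bar>) * (\<bar>g (x + \<tau> *\<^sub>R v)\<bar> * (C * indicator W x))"
          using C(1) M0 by (intro mult_mono M) (auto simp: W_def indicator_def)
        finally show "ennreal \<bar>?E' x\<bar>
          \<le> ennreal (M * C) * ennreal (indicator W x * \<bar>?\<Delta>' x\<bar> * \<bar>g (x + \<tau> *\<^sub>R v)\<bar>)"
          using M0 C0 by (simp add: ennreal_mult[symmetric] mult_ac ennreal_leI abs_minus_commute)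
      qed
      also have "\<dots> = ennreal (M * C) * (\<integral>\<^sup>+x. ennreal (indicator W x * \<bar>?\<Delta>' x\<bar> * \<bar>g (x + \<tau> *\<^sub>R v)\<bar>) \<partial>lborel)"
        by (intro nn_integral_cmult) measurable
      also have "\<dots> \<le> ennreal (M * C) * ennreal (N * t)"
        using \<tau> by (intro mult_left_mono increment_product_bound[OF _ _ N line]) auto
      finally show "(\<integral>\<^sup>+x. ennreal \<bar>?E' x\<bar> \<partial>lborel)
         \<le> ennreal (M * C * (N * t))"
        using M0 C0 N(2) \<open>0 \<le> t\<close> by (simp add: ennreal_mult[symmetric])
    qed (use M0 C0 N(2) \<open>0 \<le> t\<close> in auto)
    finally show ?thesis .
  qed
  have B34: "\<bar>B3 \<tau> - B4\<bar> \<le> L * C * I * t" if \<tau>: "\<tau> \<in> {0..t}" for \<tau>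
  proof -
    have \<phi>lip: "\<bar>\<phi> (x - \<tau> *\<^sub>R v) - \<phi> x\<bar> \<le> C * t" for x
    proof -
      have "\<bar>\<integral>\<sigma>. indicator {0..\<tau>} \<sigma> * frechet_derivative \<phi> (at (x - \<sigma> *\<^sub>R v)) v \<partial>lborel\<bar> \<le> C * \<tau>"
        using \<tau> C0 by (intro abs_integral_Icc_le C(2)) auto
      also have "\<dots> \<le> C * t" using \<tau> C0 by (intro mult_left_mono) auto
      finally show ?thesis using test_function_FTC[OF \<phi>, of \<tau> x v] \<tau> by (simp add: abs_minus_commute)
    qed
    have "B3 \<tau> = (LBINT x. w x * \<phi> (x - \<tau> *\<^sub>R v))"
      using integral_lborel_translate[of "\<lambda>x. w x * \<phi> (x - \<tau> *\<^sub>R v)" "\<tau> *\<^sub>R v"] w by (simp add: B3_def)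
    then have "B3 \<tau> - B4 = (LBINT x. w x * \<phi> (x - \<tau> *\<^sub>R v) - w x * \<phi> x)"
      unfolding B4_def
      by (simp only:) (intro Bochner_Integration.integral_diff[symmetric] integrable_mult_bounded[OF _ _ C(1)] w; measurable)
    also have "\<bar>\<dots>\<bar> \<le> L * C * I * t"
    proof -
      have "\<bar>\<integral>x. w x * \<phi> (x - \<tau> *\<^sub>R v) - w x * \<phi> x \<partial>lborel\<bar> \<le> (LBINT x. L * C * t * \<bar>g x\<bar>)"
      proof (rule order_trans[OF integral_abs_bound integral_mono'])
        show "integrable lborel (\<lambda>x. L * C * t * \<bar>g x\<bar>)" using g by auto
        fix x
        have "\<bar>w x * \<phi> (x - \<tau> *\<^sub>R v) - w x * \<phi> x\<bar> = \<bar>F' (u x)\<bar> * \<bar>g x\<bar> * \<bar>\<phi> (x - \<tau> *\<^sub>R v) - \<phi> x\<bar>"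
          by (simp add: w_def abs_mult[symmetric] algebra_simps)
        also have "\<dots> \<le> L * \<bar>g x\<bar> * (C * t)"
          using L0 by (intro mult_mono L \<phi>lip) auto
        finally show "\<bar>w x * \<phi> (x - \<tau> *\<^sub>R v) - w x * \<phi> x\<bar> \<le> L * C * t * \<bar>g x\<bar>" by (simp add: mult_ac)
      qed (use L0 C0 \<open>0 \<le> t\<close> in auto)
      then show ?thesis by (simp add: I_def mult_ac)
    qed
    finally show ?thesis .
  qed
  have "A3 - t * B4 = (LBINT \<tau>. indicator {0..t} \<tau> * (B3 \<tau> - B4))"
  proof -
    have "integrable lborel (\<lambda>\<tau>::real. indicator {0..t} \<tau> * B4)"
      by (intro integrable_mult_left integrable_real_indicator) (auto simp: emeasure_lborel_Icc_eq)
    then show ?thesis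
      using iB3 \<open>0 \<le> t\<close> by (simp add: A3_def right_diff_distrib)
  qed
  also have "\<bar>\<dots>\<bar> \<le> L * C * I * t * t"
    using L0 C0 I0 \<open>0 \<le> t\<close> by (intro abs_integral_Icc_le B34) auto
  finally have 34: "\<bar>A3 - t * B4\<bar> \<le> L * C * I * t * t" .
  have "A2 - A3 = (LBINT \<tau>. indicator {0..t} \<tau> * (B2 \<tau> - B3 \<tau>))"
    using iB2 iB3 by (simp add: A2_def A3_def right_diff_distrib)
  also have "\<bar>\<dots>\<bar> \<le> M * C * (N * t) * t"
    using M0 C0 N(2) \<open>0 \<le> t\<close> by (intro abs_integral_Icc_le B23) auto
  finally have "\<bar>A0 - t * B4\<bar> \<le> M * C * (N * t * t) + M * C * (N * t) * t + L * C * I * t * t"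
    using 01 12 34 by linarith
  then show ?thesis unfolding S by (simp add: B4_def w_def I_def algebra_simps)
qed

text \<open>Divide the translation estimate by the step \<open>h n\<close>. The quotients
  \<open>Q n\<close> then have two limits: the estimate gives the integral with
  \<open>F' (u x) * g x\<close>, while dominated convergence gives the one with the derivative of
  \<phi> along \<open>- v\<close>, which accounts for the sign.\<close>

lemma chain_rule_lborel:
  fixes u g :: "'a::euclidean_space \<Rightarrow> real" and F F' :: "real \<Rightarrow> real"
  assumes u: "integrable lborel u" and g: "integrable lborel g" and g2: "integrable lborel (\<lambda>x. (g x)\<^sup>2)"
    and weak: "\<And>\<psi>. test_function K \<psi> \<Longrightarrow>
      (LBINT x. u x * frechet_derivative \<psi> (at x) v) = - (LBINT x. g x * \<psi> x)"
    and F: "\<And>t. (F has_real_derivative F' t) (at t)" "F 0 = 0"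
    and L: "\<And>a. \<bar>F' a\<bar> \<le> L" and M: "\<And>a b. \<bar>F' a - F' b\<bar> \<le> M * \<bar>a - b\<bar>"
    and \<phi>: "test_function \<Omega> \<phi>"
    and K: "\<And>x \<tau>. \<phi> x \<noteq> 0 \<Longrightarrow> 0 \<le> \<tau> \<Longrightarrow> \<tau> \<le> e \<Longrightarrow> x + \<tau> *\<^sub>R v \<in> K" and "0 < e"
  shows "(LBINT x. F (u x) * frechet_derivative \<phi> (at x) v) = - (LBINT x. F' (u x) * g x * \<phi> x)"
proof -
  obtain C where C: "C \<ge> 0" "\<And>x. \<bar>\<phi> x\<bar> \<le> C" "\<And>x. \<bar>frechet_derivative \<phi> (at x) v\<bar> \<le> C"
    using test_function_bounded[OF \<phi>] by blast
  define N where "N = (LBINT x. (g x)\<^sup>2)"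
  have N: "(\<integral>\<^sup>+x. ennreal ((g x)\<^sup>2) \<partial>lborel) \<le> ennreal N" "0 \<le> N"
    unfolding N_def using nn_integral_eq_integral[OF g2] by auto
  have [measurable]: "F \<in> borel_measurable borel" by (rule derivative_borel_measurable[OF F(1)])
  have [measurable]: "u \<in> borel_measurable borel" using u by auto
  have [measurable]: "\<phi> \<in> borel_measurable borel"
    using test_functionD(3)[OF \<phi>] by (rule borel_measurable_continuous_onI)
  have [measurable]: "(\<lambda>x. frechet_derivative \<phi> (at x) v) \<in> borel_measurable borel"
    using test_functionD(2)[OF \<phi>] by (rule borel_measurable_continuous_onI)
  have Fu: "integrable lborel (\<lambda>x. F (u x))"
  proof (rule Bochner_Integration.integrable_bound[of _ "\<lambda>x. L * u x"])
    have "\<bar>F a\<bar> \<le> \<bar>L * a\<bar>" for a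
      using bounded_derivative_lipschitz[OF F(1) L, of a 0] F(2) L[of 0] by (simp add: abs_mult)
    then show "AE x in lborel. norm (F (u x)) \<le> norm (L * u x)" by simp
  qed (use u in auto)
  define c where "c = 2 * M * C * N + L * C * (LBINT x. \<bar>g x\<bar>)"
  define B where "B = (LBINT x. F' (u x) * g x * \<phi> x)"
  define h where "h n = e / real (Suc n)" for n
  have h: "0 < h n" "h n \<le> e" for n using \<open>0 < e\<close> by (auto simp: h_def field_simps)
  have h0: "h \<longlonglongrightarrow> 0"
    unfolding h_def using LIMSEQ_Suc[OF lim_const_over_n[of e]] by simp
  define Q where "Q n x = F (u x) * ((\<phi> (x - h n *\<^sub>R v) - \<phi> x) / h n)" for n x
  have est: "\<bar>(LBINT x. Q n x) - B\<bar> \<le> c * h n" for n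
  proof -
    have "\<bar>(LBINT x. F (u x) * (\<phi> (x - h n *\<^sub>R v) - \<phi> x)) - h n * B\<bar> \<le> c * (h n * h n)"
      unfolding c_def B_def
      by (rule chain_rule_translation_estimate[OF u g N weak F(1) L M Fu \<phi> C(2,3) K]) (use h[of n] in auto)
    moreover have "(LBINT x. F (u x) * (\<phi> (x - h n *\<^sub>R v) - \<phi> x)) = h n * (LBINT x. Q n x)"
    proof -
      have "F (u x) * (\<phi> (x - h n *\<^sub>R v) - \<phi> x) = h n * Q n x" for x
        using h(1)[of n] by (simp add: Q_def)
      then show ?thesis by simp
    qed
    moreover have "\<bar>h n * (LBINT x. Q n x) - h n * B\<bar> = h n * \<bar>(LBINT x. Q n x) - B\<bar>"
      using h(1)[of n] by (simp only: right_diff_distrib[symmetric] abs_mult abs_of_pos)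
    ultimately have "h n * \<bar>(LBINT x. Q n x) - B\<bar> \<le> h n * (c * h n)"
      by (simp only: mult.left_commute[of c])
    then show ?thesis using h(1)[of n] by simp
  qed
  have "(\<lambda>n. (LBINT x. Q n x) - B) \<longlonglongrightarrow> 0"
  proof (rule Lim_null_comparison)
    show "\<forall>\<^sub>F n in sequentially. norm ((LBINT x. Q n x) - B) \<le> c * h n"
      using est by simp
    show "(\<lambda>n. c * h n) \<longlonglongrightarrow> 0" using tendsto_mult_right_zero[OF h0] .
  qed
  then have 1: "(\<lambda>n. \<integral>x. Q n x \<partial>lborel) \<longlonglongrightarrow> B" by (rule LIM_zero_cancel)
  have 2: "(\<lambda>n. \<integral>x. Q n x \<partial>lborel) \<longlonglongrightarrow> (LBINT x. F (u x) * (- frechet_derivative \<phi> (at x) v))"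
  proof (rule integral_dominated_convergence[where w = "\<lambda>x. C * \<bar>F (u x)\<bar>"])
    show "integrable lborel (\<lambda>x. C * \<bar>F (u x)\<bar>)" using Fu by auto
    show "AE x in lborel. (\<lambda>n. Q n x) \<longlonglongrightarrow> F (u x) * (- frechet_derivative \<phi> (at x) v)"
    proof (rule AE_I2)
      fix x
      have "((\<lambda>k. (- \<phi> (x - k *\<^sub>R v) + \<phi> x) / k) \<longlongrightarrow> frechet_derivative \<phi> (at x) v) (at 0)"
        using test_function_line_derivative[OF \<phi>, of x v 0] unfolding DERIV_def by simp
      moreover have "filterlim h (at 0) sequentially"
        unfolding filterlim_at using h0 h(1) by (auto simp: less_imp_neq[symmetric] intro!: always_eventually)
      ultimately have "(\<lambda>n. (- \<phi> (x - h n *\<^sub>R v) + \<phi> x) / h n) \<longlonglongrightarrow> frechet_derivative \<phi> (at x) v"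
        by (rule filterlim_compose)
      then have "(\<lambda>n. F (u x) * - ((- \<phi> (x - h n *\<^sub>R v) + \<phi> x) / h n)) \<longlonglongrightarrow> F (u x) * (- frechet_derivative \<phi> (at x) v)"
        by (intro tendsto_mult tendsto_const tendsto_minus)
      moreover have "F (u x) * - ((- \<phi> (x - h n *\<^sub>R v) + \<phi> x) / h n) = Q n x" for n
        by (simp add: Q_def minus_divide_left)
      ultimately show "(\<lambda>n. Q n x) \<longlonglongrightarrow> F (u x) * (- frechet_derivative \<phi> (at x) v)" by (simp only:)
    qed
    fix n
    have "\<bar>\<phi> (x - h n *\<^sub>R v) - \<phi> x\<bar> \<le> C * h n" for x
    proof -
      have "\<bar>\<integral>\<sigma>. indicator {0..h n} \<sigma> * frechet_derivative \<phi> (at (x - \<sigma> *\<^sub>R v)) v \<partial>lborel\<bar> \<le> C * h n"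
        using h(1)[of n] C(1) by (intro abs_integral_Icc_le C(3)) auto
      then show ?thesis using test_function_FTC[OF \<phi>, of "h n" x v] h(1)[of n] by (simp add: abs_minus_commute)
    qed
    then have "\<bar>(\<phi> (x - h n *\<^sub>R v) - \<phi> x) / h n\<bar> \<le> C" for x
      using h(1)[of n] by (simp add: field_simps)
    then show "AE x in lborel. norm (Q n x) \<le> C * \<bar>F (u x)\<bar>"
      by (intro AE_I2) (simp only: Q_def real_norm_def abs_mult, subst mult.commute, intro mult_right_mono, auto)
  qed (simp_all add: Q_def)
  from LIMSEQ_unique[OF 1 2] show ?thesis by (simp add: B_def)
qed

text \<open>The line argument needs functions integrable on the whole space. For a given \<phi>,
  both \<open>u\<close> and \<open>G\<close> are therefore cut off to a compact neighbourhood of its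
  support and replaced by Borel representatives. Square integrability of \<open>G\<close> is what
  makes the quadratic error of the translation estimate finite.\<close>

theorem has_weak_gradient_chain_rule:
  fixes u :: "'a::euclidean_space \<Rightarrow> real" and F F' :: "real \<Rightarrow> real"
  assumes "open \<Omega>" and weak: "has_weak_gradient \<Omega> u G"
    and G2: "L2 (lebesgue_on \<Omega>) G"
    and F: "\<And>t. (F has_real_derivative F' t) (at t)" "F 0 = 0"
    and L: "\<And>a. \<bar>F' a\<bar> \<le> L" and M: "\<And>a b. \<bar>F' a - F' b\<bar> \<le> M * \<bar>a - b\<bar>"
  shows "has_weak_gradient \<Omega> (\<lambda>x. F (u x)) (\<lambda>x. F' (u x) *\<^sub>R G x)"
  unfolding has_weak_gradient_def
proof (intro conjI allI impI)
  have \<Omega>: "\<Omega> \<in> sets lebesgue" using \<open>open \<Omega>\<close> by auto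
  have lu: "locally_integrable \<Omega> u" and lG: "locally_integrable \<Omega> G" and
    W: "\<And>\<phi> v. test_function \<Omega> \<phi> \<Longrightarrow> (\<integral>x. u x * frechet_derivative \<phi> (at x) v \<partial>lebesgue_on \<Omega>) =
        - (\<integral>x. (G x \<bullet> v) * \<phi> x \<partial>lebesgue_on \<Omega>)"
    using weak by (auto simp: has_weak_gradient_def)
  have Fm[measurable]: "F \<in> borel_measurable borel" by (rule derivative_borel_measurable[OF F(1)])
  have F'm[measurable]: "F' \<in> borel_measurable borel" by (rule lipschitz_borel_measurable[OF M])
  have FL: "\<bar>F a\<bar> \<le> \<bar>L * a\<bar>" for a
    using bounded_derivative_lipschitz[OF F(1) L, of a 0] F(2) L[of 0] by (simp add: abs_mult)
  show "locally_integrable \<Omega> (\<lambda>x. F (u x))"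
    unfolding locally_integrable_def
  proof (intro allI impI)
    fix K assume "compact K \<and> K \<subseteq> \<Omega>"
    then have u: "integrable (lebesgue_on K) u" using lu unfolding locally_integrable_def by blast
    show "integrable (lebesgue_on K) (\<lambda>x. F (u x))"
    proof (rule Bochner_Integration.integrable_bound)
      show "integrable (lebesgue_on K) (\<lambda>x. L * u x)" using u by simp
      show "AE x in lebesgue_on K. norm (F (u x)) \<le> norm (L * u x)"
        using FL by (intro AE_I2) simp
      show "(\<lambda>x. F (u x)) \<in> borel_measurable (lebesgue_on K)"
        using borel_measurable_integrable[OF u] Fm by (rule measurable_compose)
    qed
  qed
  show "locally_integrable \<Omega> (\<lambda>x. F' (u x) *\<^sub>R G x)"
    unfolding locally_integrable_def
  proof (intro allI impI)
    fix K assume "compact K \<and> K \<subseteq> \<Omega>"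
    then have u: "integrable (lebesgue_on K) u" and G: "integrable (lebesgue_on K) G"
      using lu lG unfolding locally_integrable_def by blast+
    show "integrable (lebesgue_on K) (\<lambda>x. F' (u x) *\<^sub>R G x)"
    proof (rule Bochner_Integration.integrable_bound)
      show "integrable (lebesgue_on K) (\<lambda>x. L *\<^sub>R G x)" using G by simp
      have "\<bar>F' (u x)\<bar> * norm (G x) \<le> \<bar>L\<bar> * norm (G x)" for x
        using L[of "u x"] by (intro mult_right_mono) auto
      then show "AE x in lebesgue_on K. norm (F' (u x) *\<^sub>R G x) \<le> norm (L *\<^sub>R G x)"
        by (intro AE_I2) simp
      show "(\<lambda>x. F' (u x) *\<^sub>R G x) \<in> borel_measurable (lebesgue_on K)"
        using measurable_compose[OF borel_measurable_integrable[OF u] F'm] borel_measurable_integrable[OF G]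
        by (rule borel_measurable_scaleR)
    qed
  qed
  fix \<phi> v assume \<phi>: "test_function \<Omega> \<phi>"
  define K0 where "K0 = closure {x. \<phi> x \<noteq> 0}"
  have K0: "compact K0" "K0 \<subseteq> \<Omega>" using \<phi> by (auto simp: test_function_def K0_def)
  obtain \<delta> where \<delta>: "\<delta> > 0" "(\<Union>x\<in>K0. cball x \<delta>) \<subseteq> \<Omega>"
    using compact_subset_open_imp_cball_epsilon_subset[OF K0(1) \<open>open \<Omega>\<close> K0(2)] by metis
  \<comment> \<open>The closed \<delta>-neighbourhood of the support: it is compact, lies in
    \<Omega>, and contains the support moved along \<open>v\<close> for a short time.\<close>
  define K where "K = {x + y |x y. x \<in> K0 \<and> y \<in> cball 0 \<delta>}"
  have Kc: "compact K" unfolding K_def using K0(1) by (intro compact_sums) auto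
  have K\<Omega>: "K \<subseteq> \<Omega>"
  proof
    fix z assume "z \<in> K"
    then obtain x y where "x \<in> K0" "norm y \<le> \<delta>" "z = x + y" by (auto simp: K_def)
    then have "z \<in> cball x \<delta>" by (simp add: dist_norm)
    then show "z \<in> \<Omega>" using \<delta>(2) \<open>x \<in> K0\<close> by blast
  qed
  have KI: "x + y \<in> K" if "x \<in> K0" "norm y \<le> \<delta>" for x y using that by (auto simp: K_def)
  have Kl: "K \<in> sets lebesgue" using borel_compact[OF Kc] by simp
  define u1 where "u1 x = indicator K x *\<^sub>R u x" for x
  define g1 where "g1 x = indicator K x *\<^sub>R (G x \<bullet> v)" for x
  have u1: "integrable lebesgue u1"
  proof -
    have "integrable (lebesgue_on K) u"
      using lu Kc K\<Omega> unfolding locally_integrable_def by blast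
    then show ?thesis
      using Kl by (simp add: u1_def[abs_def] integrable_lebesgue_on_iff set_integrable_def)
  qed
  have "integrable (lebesgue_on K) (\<lambda>x. G x \<bullet> v)"
    using lG Kc K\<Omega> unfolding locally_integrable_def by auto
  then have g1: "integrable lebesgue g1"
    using Kl by (simp add: g1_def[abs_def] integrable_lebesgue_on_iff set_integrable_def)
  have g12: "integrable lebesgue (\<lambda>x. (g1 x)\<^sup>2)"
  proof (rule Bochner_Integration.integrable_bound)
    show "integrable lebesgue (\<lambda>x. (norm v)\<^sup>2 * (indicator \<Omega> x * (norm (G x))\<^sup>2))"
      using G2 \<Omega> by (simp add: L2_def integrable_lebesgue_on_iff set_integrable_def)
    have "(G x \<bullet> v)\<^sup>2 \<le> (norm v)\<^sup>2 * (norm (G x))\<^sup>2" for x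
      using power_mono[OF Cauchy_Schwarz_ineq2[of "G x" v], of 2] by (simp add: power_mult_distrib mult.commute)
    then show "AE x in lebesgue. norm ((g1 x)\<^sup>2) \<le> norm ((norm v)\<^sup>2 * (indicator \<Omega> x * (norm (G x))\<^sup>2))"
      using K\<Omega> by (intro AE_I2) (auto simp: g1_def indicator_def)
  qed (use g1 in auto)
  obtain u2 where [measurable]: "u2 \<in> borel_measurable borel" "u2 \<in> borel_measurable lebesgue"
    and iu2: "integrable lborel u2" and ue: "AE x in lebesgue. u1 x = u2 x"
    by (rule lebesgue_integrable_representative[OF u1])
  obtain g2 where [measurable]: "g2 \<in> borel_measurable borel" "g2 \<in> borel_measurable lebesgue"
    and ig2: "integrable lborel g2" and ge: "AE x in lebesgue. g1 x = g2 x"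
    by (rule lebesgue_integrable_representative[OF g1])
  have [measurable]: "u1 \<in> borel_measurable lebesgue" "g1 \<in> borel_measurable lebesgue" using u1 g1 by auto
  have ig22: "integrable lborel (\<lambda>x. (g2 x)\<^sup>2)"
  proof -
    have "integrable lebesgue (\<lambda>x. (g2 x)\<^sup>2)"
      using g12 by (rule integrable_cong_AE_imp) (use ge in auto)
    then show ?thesis by (subst (asm) integrable_completion) auto
  qed
  have meas_b: "\<psi> \<in> borel_measurable borel" "(\<lambda>x. frechet_derivative \<psi> (at x) v) \<in> borel_measurable borel"
    if "test_function A \<psi>" for A \<psi>
    using test_functionD(2,3)[OF that] by (auto intro!: borel_measurable_continuous_onI)
  have meas_tf: "\<psi> \<in> borel_measurable lebesgue" "(\<lambda>x. frechet_derivative \<psi> (at x) v) \<in> borel_measurable lebesgue"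
    if "test_function A \<psi>" for A \<psi>
    using test_functionD(2,3)[OF that] by (auto intro!: measurable_completion borel_measurable_continuous_onI)
  \<comment> \<open>A test function on \<open>K\<close> and its derivative vanish off
    \<open>K\<close>, so the weak identity on \<Omega> does not see the cut-off.\<close>
  have weak2: "(LBINT x. u2 x * frechet_derivative \<psi> (at x) v) = - (LBINT x. g2 x * \<psi> x)"
    if \<psi>: "test_function K \<psi>" for \<psi>
  proof -
    note [measurable] = meas_b[OF \<psi>] meas_tf[OF \<psi>]
    have z: "\<psi> x = 0" "frechet_derivative \<psi> (at x) v = 0" if "x \<notin> K" for x
    proof -
      have x: "x \<notin> closure {x. \<psi> x \<noteq> 0}" using \<psi> that by (auto simp: test_function_def)
      then show "\<psi> x = 0" using closure_subset[of "{x. \<psi> x \<noteq> 0}"] by auto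
      show "frechet_derivative \<psi> (at x) v = 0" using test_functionD(4)[OF \<psi> x] .
    qed
    have "(LBINT x. u2 x * frechet_derivative \<psi> (at x) v) = (\<integral>x. u2 x * frechet_derivative \<psi> (at x) v \<partial>lebesgue)"
      by (intro integral_completion[symmetric]) measurable
    also have "\<dots> = (\<integral>x. indicator \<Omega> x *\<^sub>R (u x * frechet_derivative \<psi> (at x) v) \<partial>lebesgue)"
    proof -
      have "(\<integral>x. u2 x * frechet_derivative \<psi> (at x) v \<partial>lebesgue) = (\<integral>x. u1 x * frechet_derivative \<psi> (at x) v \<partial>lebesgue)"
      proof (rule integral_cong_AE, goal_cases)
        case 3
        from ue show ?case by eventually_elim simp
      qed measurable
      also have "\<dots> = (\<integral>x. indicator \<Omega> x *\<^sub>R (u x * frechet_derivative \<psi> (at x) v) \<partial>lebesgue)"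
        using z K\<Omega> by (intro Bochner_Integration.integral_cong refl) (auto simp: u1_def indicator_def)
      finally show ?thesis .
    qed
    also have "\<dots> = - (\<integral>x. indicator \<Omega> x *\<^sub>R ((G x \<bullet> v) * \<psi> x) \<partial>lebesgue)"
      using W[OF test_function_mono[OF \<psi> K\<Omega>], of v] by (simp add: integral_lebesgue_on[OF \<Omega>] set_lebesgue_integral_def)
    also have "(\<integral>x. indicator \<Omega> x *\<^sub>R ((G x \<bullet> v) * \<psi> x) \<partial>lebesgue) = (\<integral>x. g1 x * \<psi> x \<partial>lebesgue)"
      using z K\<Omega> by (intro Bochner_Integration.integral_cong refl) (auto simp: g1_def indicator_def)
    also have "\<dots> = (\<integral>x. g2 x * \<psi> x \<partial>lebesgue)"
    proof (rule integral_cong_AE, goal_cases)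
      case 3
      from ge show ?case by eventually_elim simp
    qed measurable
    also have "\<dots> = (LBINT x. g2 x * \<psi> x)"
      by (intro integral_completion) measurable
    finally show ?thesis .
  qed
  note [measurable] = meas_b[OF \<phi>] meas_tf[OF \<phi>]
  have z: "\<phi> x = 0" "frechet_derivative \<phi> (at x) v = 0" if "x \<notin> K" for x
  proof -
    have "x \<notin> K0" using that KI[of x 0] \<delta> by auto
    then have x: "x \<notin> closure {x. \<phi> x \<noteq> 0}" by (simp add: K0_def)
    then show "\<phi> x = 0" using closure_subset[of "{x. \<phi> x \<noteq> 0}"] by auto
    show "frechet_derivative \<phi> (at x) v = 0" using test_functionD(4)[OF \<phi> x] .
  qed
  have main: "(LBINT x. F (u2 x) * frechet_derivative \<phi> (at x) v) = - (LBINT x. F' (u2 x) * g2 x * \<phi> x)"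
  \<comment> \<open>The choice of \<open>e\<close> keeps \<open>\<tau> *\<^sub>R v\<close> within
    norm \<delta>; the summand 1 in the denominator covers \<open>v = 0\<close>.\<close>
  proof (rule chain_rule_lborel[OF iu2 ig2 ig22 weak2 F L M \<phi>, where e = "\<delta> / (norm v + 1)"])
    show "0 < \<delta> / (norm v + 1)" using \<delta> by (simp add: add_nonneg_pos)
    fix x \<tau> assume "\<phi> x \<noteq> 0" and \<tau>: "0 \<le> \<tau>" "\<tau> \<le> \<delta> / (norm v + 1)"
    then have "x \<in> K0" using closure_subset[of "{x. \<phi> x \<noteq> 0}"] by (auto simp: K0_def)
    moreover have "\<tau> * norm v \<le> \<delta>"
    proof -
      have "\<tau> * norm v \<le> \<tau> * (norm v + 1)" using \<tau> by (intro mult_left_mono) auto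
      also have "\<dots> \<le> \<delta>"
        using \<tau>(2) pos_le_divide_eq[of "norm v + 1" \<tau> \<delta>] by (simp add: add_nonneg_pos)
      finally show ?thesis .
    qed
    ultimately show "x + \<tau> *\<^sub>R v \<in> K" using \<tau> by (intro KI) auto
  qed
  have "(\<integral>x. F (u x) * frechet_derivative \<phi> (at x) v \<partial>lebesgue_on \<Omega>) = (\<integral>x. F (u1 x) * frechet_derivative \<phi> (at x) v \<partial>lebesgue)"
    unfolding integral_lebesgue_on[OF \<Omega>] set_lebesgue_integral_def
    using z K\<Omega> by (intro Bochner_Integration.integral_cong refl) (auto simp: u1_def indicator_def)
  also have "\<dots> = (\<integral>x. F (u2 x) * frechet_derivative \<phi> (at x) v \<partial>lebesgue)"
  proof (rule integral_cong_AE, goal_cases)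
    case 3
    from ue show ?case by eventually_elim simp
  qed measurable
  also have "\<dots> = (LBINT x. F (u2 x) * frechet_derivative \<phi> (at x) v)"
    by (intro integral_completion) measurable
  also have "\<dots> = - (LBINT x. F' (u2 x) * g2 x * \<phi> x)" by (rule main)
  also have "(LBINT x. F' (u2 x) * g2 x * \<phi> x) = (\<integral>x. F' (u2 x) * g2 x * \<phi> x \<partial>lebesgue)"
    by (intro integral_completion[symmetric]) measurable
  also have "\<dots> = (\<integral>x. F' (u1 x) * g1 x * \<phi> x \<partial>lebesgue)"
  proof (rule integral_cong_AE, goal_cases)
    case 3
    from ue ge show ?case by eventually_elim simp
  qed measurable
  also have "\<dots> = (\<integral>x. (F' (u x) *\<^sub>R G x \<bullet> v) * \<phi> x \<partial>lebesgue_on \<Omega>)"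
    unfolding integral_lebesgue_on[OF \<Omega>] set_lebesgue_integral_def
    using z K\<Omega> by (intro Bochner_Integration.integral_cong refl) (auto simp: u1_def g1_def indicator_def)
  finally show "(\<integral>x. F (u x) * frechet_derivative \<phi> (at x) v \<partial>lebesgue_on \<Omega>) =
        - (\<integral>x. (F' (u x) *\<^sub>R G x \<bullet> v) * \<phi> x \<partial>lebesgue_on \<Omega>)" .
qed

text \<open>Subtracting the two weak identities leaves, in each coordinate, a locally integrable
  function orthogonal to all test functions. Uniqueness is what identifies the gradient chosen by
  \<open>weak_gradient\<close> with an explicitly computed one.\<close>

lemma has_weak_gradient_unique:
  fixes u :: "'a::euclidean_space \<Rightarrow> real"
  assumes "open \<Omega>" and G: "has_weak_gradient \<Omega> u G" and H: "has_weak_gradient \<Omega> u H"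
  shows "AE x in lebesgue_on \<Omega>. G x = H x"
proof -
  have \<Omega>: "\<Omega> \<in> sets lebesgue" using \<open>open \<Omega>\<close> by auto
  have lG: "locally_integrable \<Omega> G" and lH: "locally_integrable \<Omega> H"
    using G H by (auto simp: has_weak_gradient_def)
  have "AE x in lebesgue_on \<Omega>. (G x - H x) \<bullet> i = 0" for i
  proof (rule du_bois_reymond[OF \<open>open \<Omega>\<close>])
    show "locally_integrable \<Omega> (\<lambda>x. (G x - H x) \<bullet> i)"
      unfolding locally_integrable_def
    proof (intro allI impI)
      fix K assume K: "compact K \<and> K \<subseteq> \<Omega>"
      show "integrable (lebesgue_on K) (\<lambda>x. (G x - H x) \<bullet> i)"
        using lG[unfolded locally_integrable_def, rule_format, OF K] lH[unfolded locally_integrable_def, rule_format, OF K]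
        by (intro integrable_inner_left Bochner_Integration.integrable_diff)
    qed
    fix \<phi> assume \<phi>: "test_function \<Omega> \<phi>"
    \<comment> \<open>Splitting the integral of the difference requires both products to be
      integrable; they are, because \<phi> is bounded and supported on a compact set, where the
      gradients are integrable.\<close>
    have i: "integrable (lebesgue_on \<Omega>) (\<lambda>x. (E x \<bullet> i) * \<phi> x)" if E: "locally_integrable \<Omega> E" for E
    proof -
      define K where "K = closure {x. \<phi> x \<noteq> 0}"
      have K: "compact K" "K \<subseteq> \<Omega>" using \<phi> by (auto simp: test_function_def K_def)
      have Kl: "K \<in> sets lebesgue" using borel_compact[OF K(1)] by simp
      obtain C where C: "\<And>x. \<bar>\<phi> x\<bar> \<le> C" using test_function_bounded[OF \<phi>] by blast
      have \<phi>m: "\<phi> \<in> borel_measurable lebesgue"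
        using test_functionD(3)[OF \<phi>] by (auto intro!: measurable_completion borel_measurable_continuous_onI)
      have "integrable (lebesgue_on K) E" using E K unfolding locally_integrable_def by blast
      then have "integrable (lebesgue_on K) (\<lambda>x. E x \<bullet> i)" by (rule integrable_inner_left)
      then have "integrable lebesgue (\<lambda>x. indicator K x *\<^sub>R (E x \<bullet> i))"
        using Kl by (simp add: integrable_lebesgue_on_iff set_integrable_def)
      from integrable_mult_bounded[OF this \<phi>m C]
      have "integrable lebesgue (\<lambda>x. indicator K x *\<^sub>R (E x \<bullet> i) * \<phi> x)" .
      moreover have "indicator K x *\<^sub>R (E x \<bullet> i) * \<phi> x = indicator \<Omega> x *\<^sub>R ((E x \<bullet> i) * \<phi> x)" for x
        using K(2) closure_subset[of "{x. \<phi> x \<noteq> 0}"] by (auto simp: indicator_def K_def)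
      ultimately show ?thesis using \<Omega> by (simp only: integrable_lebesgue_on_iff set_integrable_def)
    qed
    have "- (\<integral>x. (G x \<bullet> i) * \<phi> x \<partial>lebesgue_on \<Omega>) = (\<integral>x. u x * frechet_derivative \<phi> (at x) i \<partial>lebesgue_on \<Omega>)"
      using G \<phi> unfolding has_weak_gradient_def by simp
    also have "\<dots> = - (\<integral>x. (H x \<bullet> i) * \<phi> x \<partial>lebesgue_on \<Omega>)"
      using H \<phi> unfolding has_weak_gradient_def by simp
    finally show "(\<integral>x. (G x - H x) \<bullet> i * \<phi> x \<partial>lebesgue_on \<Omega>) = 0"
      using i[OF lG] i[OF lH] by (simp add: inner_diff_left left_diff_distrib)
  qed
  then have "AE x in lebesgue_on \<Omega>. \<forall>i\<in>Basis. (G x - H x) \<bullet> i = 0"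
    by (intro AE_finite_allI) auto
  then show ?thesis
  proof eventually_elim
    fix x assume "\<forall>i\<in>Basis. (G x - H x) \<bullet> i = 0"
    then have "G x - H x = 0" by (simp only: euclidean_all_zero_iff)
    then show "G x = H x" by simp
  qed
qed

section \<open>Truncated powers\<close>

lemma powr_lipschitz_Icc:
  fixes a T x y :: real
  assumes "1 \<le> a" "0 \<le> x" "x \<le> T" "0 \<le> y" "y \<le> T"
  shows "\<bar>x powr a - y powr a\<bar> \<le> a * T powr (a - 1) * \<bar>x - y\<bar>"
proof -
  have *: "y powr a - x powr a \<le> a * T powr (a - 1) * (y - x)" if "0 \<le> x" "x < y" "y \<le> T" for x y
  proof -
    have "continuous_on {x..y} (\<lambda>z. z powr a)"
      using assms(1) that by (intro continuous_on_powr' continuous_intros) auto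
    moreover have "((\<lambda>z. z powr a) has_real_derivative a * z powr (a - 1)) (at z)" if "x < z" for z
      using that \<open>0 \<le> x\<close> by (intro has_real_derivative_powr) auto
    ultimately obtain l z where z: "x < z" "z < y" "((\<lambda>z. z powr a) has_real_derivative l) (at z)"
      "y powr a - x powr a = (y - x) * l" and "l = a * z powr (a - 1)"
      using MVT[OF \<open>x < y\<close>, of "\<lambda>z. z powr a"] by (metis DERIV_unique real_differentiable_def)
    moreover have "z powr (a - 1) \<le> T powr (a - 1)"
      using z that assms(1) by (intro powr_mono2) auto
    then have "(y - x) * (a * z powr (a - 1)) \<le> (y - x) * (a * T powr (a - 1))"
      using z assms(1) that by (intro mult_left_mono) auto
    ultimately show ?thesis by (simp add: mult_ac)
  qed
  have m: "0 \<le> u powr a \<and> (u \<le> w \<longrightarrow> u powr a \<le> w powr a)" if "0 \<le> u" for u w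
    using that assms(1) by (auto intro: powr_mono2)
  show ?thesis
  proof (cases x y rule: linorder_cases)
    case less
    then show ?thesis using *[of x y] m[of x y] assms by simp
  next
    case greater
    then show ?thesis using *[of y x] m[of y x] assms by simp
  qed simp
qed

text \<open>The conclusions fall into three groups. The bounds on \<open>F'\<close> make
  \<open>F\<close> composed with \<open>u\<close> admissible, and
  \<open>1 / 2 \<le> \<kappa>\<close> makes the exponent \<open>2 * \<kappa>\<close> of
  \<open>F'\<close> at least 1, hence \<open>F'\<close> Lipschitz. The inequalities relating
  \<open>F\<close>, \<open>H\<close> and pure powers carry constants free of \<open>T\<close>, so
  they survive \<open>T \<rightarrow> \<infinity>\<close>. The linear bound on \<open>H\<close> does
  depend on \<open>T\<close> and serves only for finiteness.\<close>

lemma truncated_power_test_functions: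
  fixes T \<kappa> :: real
  assumes T: "0 < T" and \<kappa>: "1 / 2 \<le> \<kappa>"
  obtains F H F' :: "real \<Rightarrow> real" and M where
    "\<And>t. (F has_real_derivative F' t) (at t)" "F 0 = 0"
    "\<And>t. 0 \<le> F' t" "\<And>t. F' t \<le> T powr (2 * \<kappa>)"
    "\<And>a b. \<bar>F' a - F' b\<bar> \<le> M * \<bar>a - b\<bar>"
    "continuous_on UNIV H"
    "\<And>a b. (H a - H b)\<^sup>2 \<le> (a - b) * (F a - F b)"
    "\<And>t. \<bar>t\<bar> * \<bar>F t\<bar> \<le> (\<kappa> + 1) * (H t)\<^sup>2"
    "\<And>t. \<bar>F t\<bar> \<le> \<bar>t\<bar> powr (2 * \<kappa> + 1)"
    "\<And>t. \<bar>t\<bar> \<le> T \<Longrightarrow> \<bar>H t\<bar> = \<bar>t\<bar> powr (\<kappa> + 1) / (\<kappa> + 1)"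
    "\<And>t. \<bar>H t\<bar> \<le> T powr \<kappa> * \<bar>t\<bar>"
proof -
  define h where "h t = (min \<bar>t\<bar> T) powr \<kappa>" for t
  have h0: "0 \<le> h t" for t by (simp add: h_def)
  have hmono: "h s \<le> h t" if "\<bar>s\<bar> \<le> \<bar>t\<bar>" for s t
    unfolding h_def using that T \<kappa> by (intro powr_mono2) auto
  have hT: "h t \<le> T powr \<kappa>" for t
    unfolding h_def using T \<kappa> by (intro powr_mono2) auto
  have hneg: "h (- t) = h t" for t by (simp add: h_def)
  have hsq: "(h t)\<^sup>2 = (min \<bar>t\<bar> T) powr (2 * \<kappa>)" for t
    unfolding h_def by (simp add: power2_eq_square flip: powr_add)
  have ht: "h t \<le> \<bar>t\<bar> powr \<kappa>" for t
    unfolding h_def using T \<kappa> by (intro powr_mono2) auto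
  have cont: "continuous_on UNIV h"
    unfolding h_def using T \<kappa> by (intro continuous_on_powr' continuous_intros) auto
  have anti: "\<exists>F. F 0 = 0 \<and> (\<forall>x. (F has_real_derivative f x) (at x))" if "continuous_on UNIV f" for f :: "real \<Rightarrow> real"
  proof -
    have "\<exists>F. \<forall>x::real. -\<infinity> < ereal x \<longrightarrow> ereal x < \<infinity> \<longrightarrow> (F has_vector_derivative f x) (at x)"
      using that by (intro einterval_antiderivative) (auto simp: continuous_on_eq_continuous_at)
    then obtain F where "\<And>x. (F has_real_derivative f x) (at x)"
      by (auto simp: has_real_derivative_iff_has_vector_derivative)
    then have "((\<lambda>x. F x - F 0) has_real_derivative f x) (at x)" for x
      by (auto intro!: derivative_eq_intros)
    then show ?thesis by (intro exI[of _ "\<lambda>x. F x - F 0"]) auto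
  qed
  obtain H where H: "H 0 = 0" "\<And>x. (H has_real_derivative h x) (at x)" using anti[OF cont] by blast
  have "continuous_on UNIV (\<lambda>t. (h t)\<^sup>2)" using cont by (intro continuous_intros)
  then obtain F where F: "F 0 = 0" "\<And>x. (F has_real_derivative (h x)\<^sup>2) (at x)" using anti by blast
  have odd: "P (- t) = - P t" if P: "P 0 = 0" "\<And>x. (P has_real_derivative p x) (at x)" "\<And>t. p (- t) = p t" for P p and t :: real
  proof -
    have "((\<lambda>t. P t + P (- t)) has_real_derivative 0) (at x)" for x
      using P(2)[of x] DERIV_chain2[OF P(2)[of "- x"] DERIV_minus[OF DERIV_ident]] P(3)[of x]
      by (auto intro!: derivative_eq_intros)
    then have "P t + P (- t) = P 0 + P (- 0)"
      using DERIV_isconst_all[of "\<lambda>t. P t + P (- t)"] by metis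
    then show ?thesis using P(1) by simp
  qed
  have Hodd: "H (- t) = - H t" and Fodd: "F (- t) = - F t" for t
    by (rule odd[OF H hneg], rule odd[OF F], simp add: hneg)
  have mvt: "\<exists>z. \<bar>z\<bar> \<le> \<bar>t\<bar> \<and> \<bar>P t\<bar> = \<bar>t\<bar> * \<bar>p z\<bar>" if P: "P 0 = 0" "\<And>x. (P has_real_derivative p x) (at x)" for P p and t :: real
  proof (cases t "0::real" rule: linorder_cases)
    case less
    then obtain z where "t < z" "z < 0" "P 0 - P t = (0 - t) * p z" using MVT2[OF less, of P p] P(2) by auto
    then show ?thesis using P(1) less by (intro exI[of _ z]) (auto simp: abs_mult)
  next
    case greater
    then obtain z where "0 < z" "z < t" "P t - P 0 = (t - 0) * p z" using MVT2[OF greater, of P p] P(2) by auto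
    then show ?thesis using P(1) greater by (intro exI[of _ z]) (auto simp: abs_mult)
  qed (use P in auto)
  have Fb: "\<bar>F t\<bar> \<le> \<bar>t\<bar> * (h t)\<^sup>2" for t
  proof -
    obtain z where "\<bar>z\<bar> \<le> \<bar>t\<bar>" "\<bar>F t\<bar> = \<bar>t\<bar> * (h z)\<^sup>2" using mvt[OF F, of t] by auto
    then show ?thesis using hmono[of z t] h0[of z] by (simp add: mult_left_mono power_mono)
  qed
  have Hb: "\<bar>H t\<bar> \<le> T powr \<kappa> * \<bar>t\<bar>" for t
  proof -
    obtain z where "\<bar>H t\<bar> = \<bar>t\<bar> * \<bar>h z\<bar>" using mvt[OF H, of t] by auto
    then show ?thesis using hT[of z] h0[of z] by (simp add: mult.commute[of _ "\<bar>t\<bar>"] mult_left_mono)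
  qed
  have Hpow: "H t = t powr (\<kappa> + 1) / (\<kappa> + 1)" if "0 \<le> t" "t \<le> T" for t
  proof (cases "t = 0")
    case False
    with that have "0 < t" by simp
    have "continuous_on {0..t} (\<lambda>x. H x - x powr (\<kappa> + 1) / (\<kappa> + 1))"
      using \<kappa> DERIV_isCont[OF H(2)]
      by (intro continuous_intros continuous_on_powr' continuous_at_imp_continuous_on) auto
    moreover have "((\<lambda>x. H x - x powr (\<kappa> + 1) / (\<kappa> + 1)) has_real_derivative 0) (at x)" if "0 < x" "x < t" for x
    proof -
      have "((\<lambda>x. H x - x powr (\<kappa> + 1) / (\<kappa> + 1)) has_real_derivative h x - (\<kappa> + 1) * x powr (\<kappa> + 1 - 1) / (\<kappa> + 1)) (at x)"
        by (intro DERIV_diff H(2) DERIV_cdivide has_real_derivative_powr that)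
      moreover have "h x = x powr \<kappa>" using that \<open>t \<le> T\<close> by (simp add: h_def)
      ultimately show ?thesis using \<kappa> by simp
    qed
    ultimately have "H t - t powr (\<kappa> + 1) / (\<kappa> + 1) = H 0 - 0 powr (\<kappa> + 1) / (\<kappa> + 1)"
      using DERIV_isconst_end[OF \<open>0 < t\<close>, of "\<lambda>x. H x - x powr (\<kappa> + 1) / (\<kappa> + 1)"] by blast
    then show ?thesis using H(1) by simp
  qed (simp add: H(1))
  have HT: "H t = T powr (\<kappa> + 1) / (\<kappa> + 1) + T powr \<kappa> * (t - T)" if Tt: "T < t" for t
  proof -
    obtain z where z: "T < z" "z < t" "H t - H T = (t - T) * h z"
      using MVT2[OF Tt, of H h, OF H(2)] by blast
    have "h z = T powr \<kappa>" using z(1) T by (simp add: h_def)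
    then have "H t - H T = (t - T) * T powr \<kappa>" using z(3) by simp
    moreover have "H T = T powr (\<kappa> + 1) / (\<kappa> + 1)" using T by (intro Hpow) auto
    ultimately show ?thesis by (simp only: diff_eq_eq mult.commute add.commute)
  qed
  \<comment> \<open>Up to \<open>T\<close> this is an equality. Beyond \<open>T\<close> the function
    \<open>H\<close> continues with constant slope \<open>T powr \<kappa>\<close>, and the surplus
    is \<open>\<kappa> * T powr \<kappa> * (t - T)\<close>.\<close>
  have H_lower: "t * h t \<le> (\<kappa> + 1) * H t" if "0 \<le> t" for t
  proof (cases "t \<le> T")
    case True
    have "t * h t = t powr (\<kappa> + 1)"
      using that True by (cases "t = 0") (simp_all add: h_def powr_add)
    then show ?thesis using Hpow[OF that True] \<kappa> by simp
  next
    case False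
    then have ht: "h t = T powr \<kappa>" using T by (simp add: h_def)
    have "0 \<le> \<kappa> * (T powr \<kappa> * (t - T))" using False \<kappa> by simp
    moreover have "(\<kappa> + 1) * H t = T powr (\<kappa> + 1) + (\<kappa> * (T powr \<kappa> * (t - T)) + T powr \<kappa> * (t - T))"
    proof -
      have "(\<kappa> + 1) * (T powr (\<kappa> + 1) / (\<kappa> + 1)) = T powr (\<kappa> + 1)" using \<kappa> by simp
      then show ?thesis using HT[of t] False by (simp only: not_le distrib_left distrib_right mult_1)
    qed
    moreover have "T powr (\<kappa> + 1) = T powr \<kappa> * T" using T by (simp add: powr_add)
    moreover have "t * T powr \<kappa> = T powr \<kappa> * T + T powr \<kappa> * (t - T)"
      by (simp add: algebra_simps)
    ultimately show ?thesis unfolding ht by linarith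
  qed
  have H_nonneg: "0 \<le> H t" if "0 \<le> t" for t
  proof -
    have "0 \<le> (\<kappa> + 1) * H t"
      using order_trans[OF mult_nonneg_nonneg[OF that h0[of t]] H_lower[OF that]] .
    then show ?thesis using \<kappa> by (simp add: zero_le_mult_iff)
  qed
  \<comment> \<open>\<open>F\<close> integrates \<open>h\<^sup>2\<close>, and on the interval from 0
    to \<open>t\<close> one factor \<open>h\<close> is at most \<open>h t\<close>; the remaining one
    integrates to \<open>H t\<close>.\<close>
  have F_upper: "F t \<le> h t * H t" if "0 \<le> t" for t
  proof -
    have "h t * H 0 - F 0 \<le> h t * H t - F t"
    proof (rule DERIV_nonneg_imp_nondecreasing[OF that])
      fix x assume x: "0 \<le> x" "x \<le> t"
      have "((\<lambda>x. h t * H x - F x) has_real_derivative h t * h x - (h x)\<^sup>2) (at x)"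
        by (intro DERIV_diff DERIV_cmult H(2) F(2))
      moreover have "0 \<le> (h t - h x) * h x" using hmono[of x t] x h0[of x] by (intro mult_nonneg_nonneg) auto
      then have "0 \<le> h t * h x - (h x)\<^sup>2" by (simp add: power2_eq_square left_diff_distrib)
      ultimately show "\<exists>y. ((\<lambda>x. h t * H x - F x) has_real_derivative y) (at x) \<and> 0 \<le> y" by blast
    qed
    then show ?thesis using H F by simp
  qed
  have key: "t * F t \<le> (\<kappa> + 1) * (H t)\<^sup>2 \<and> 0 \<le> F t" if "0 \<le> t" for t
  proof
    have "t * F t \<le> t * (h t * H t)" using F_upper[OF that] that by (rule mult_left_mono)
    also have "\<dots> = (t * h t) * H t" by simp
    also have "\<dots> \<le> ((\<kappa> + 1) * H t) * H t" by (intro mult_right_mono H_lower H_nonneg that)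
    finally show "t * F t \<le> (\<kappa> + 1) * (H t)\<^sup>2" by (simp add: power2_eq_square mult.assoc)
    have "F 0 \<le> F t" using F(2) by (intro DERIV_nonneg_imp_nondecreasing[OF that]) (blast intro: zero_le_power2)
    then show "0 \<le> F t" using F by simp
  qed
  show ?thesis
  proof (rule that[of F "\<lambda>t. (h t)\<^sup>2" "2 * \<kappa> * T powr (2 * \<kappa> - 1)" H])
    show "(F has_real_derivative (h t)\<^sup>2) (at t)" for t by (rule F(2))
    show "F 0 = 0" by (rule F(1))
    show "0 \<le> (h t)\<^sup>2" for t by simp
    show "(h t)\<^sup>2 \<le> T powr (2 * \<kappa>)" for t
      unfolding hsq using T \<kappa> by (intro powr_mono2) auto
    show "\<bar>(h a)\<^sup>2 - (h b)\<^sup>2\<bar> \<le> 2 * \<kappa> * T powr (2 * \<kappa> - 1) * \<bar>a - b\<bar>" for a b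
    proof -
      have "\<bar>(h a)\<^sup>2 - (h b)\<^sup>2\<bar> \<le> 2 * \<kappa> * T powr (2 * \<kappa> - 1) * \<bar>min \<bar>a\<bar> T - min \<bar>b\<bar> T\<bar>"
        unfolding hsq using T \<kappa> by (intro powr_lipschitz_Icc) auto
      also have "\<dots> \<le> 2 * \<kappa> * T powr (2 * \<kappa> - 1) * \<bar>a - b\<bar>"
        using \<kappa> by (intro mult_left_mono) auto
      finally show ?thesis .
    qed
    show "continuous_on UNIV H"
      using DERIV_isCont[OF H(2)] by (intro continuous_at_imp_continuous_on) auto
    have CS: "(H b - H a)\<^sup>2 \<le> (b - a) * (F b - F a)" if "a < b" for a b
    proof -
      \<comment> \<open>Cauchy-Schwarz without integrals: \<open>l\<close> is the mean slope of
        \<open>H\<close>, and \<open>F - 2 * l * H + l\<^sup>2 * x\<close> is nondecreasing because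
        its derivative is the square \<open>(h x - l)\<^sup>2\<close>.\<close>
      define l where "l = (H b - H a) / (b - a)"
      have "F a - 2 * l * H a + l\<^sup>2 * a \<le> F b - 2 * l * H b + l\<^sup>2 * b"
      proof (rule DERIV_nonneg_imp_nondecreasing[of a b "\<lambda>x. F x - 2 * l * H x + l\<^sup>2 * x"])
        fix x
        have "((\<lambda>x. F x - 2 * l * H x + l\<^sup>2 * x) has_real_derivative (h x)\<^sup>2 - 2 * l * h x + l\<^sup>2 * 1) (at x)"
          by (intro DERIV_diff DERIV_add DERIV_cmult H(2) F(2) DERIV_ident)
        moreover have "(h x)\<^sup>2 - 2 * l * h x + l\<^sup>2 * 1 = (h x - l)\<^sup>2" by (simp add: power2_diff)
        then have "0 \<le> (h x)\<^sup>2 - 2 * l * h x + l\<^sup>2 * 1" by simp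
        ultimately show "\<exists>y. ((\<lambda>x. F x - 2 * l * H x + l\<^sup>2 * x) has_real_derivative y) (at x) \<and> 0 \<le> y"
          by blast
      qed (use that in simp)
      then have "2 * l * (H b - H a) - l\<^sup>2 * (b - a) \<le> F b - F a" by (simp add: algebra_simps)
      moreover have "l * (b - a) = H b - H a" using that by (simp add: l_def)
      then have "l\<^sup>2 * (b - a) = l * (H b - H a)" by (simp add: power2_eq_square mult.assoc)
      ultimately have "l * (H b - H a) \<le> F b - F a" by (simp add: mult.assoc)
      then have "(b - a) * (l * (H b - H a)) \<le> (b - a) * (F b - F a)"
        using that by (intro mult_left_mono) auto
      then show ?thesis using that by (simp add: l_def power2_eq_square)
    qed
    show "(H a - H b)\<^sup>2 \<le> (a - b) * (F a - F b)" for a b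
    proof (cases a b rule: linorder_cases)
      case less
      have "(a - b) * (F a - F b) = (b - a) * (F b - F a)" by (simp add: algebra_simps)
      then show ?thesis using CS[OF less] power2_commute[of "H a" "H b"] by simp
    next
      case greater
      then show ?thesis by (rule CS)
    qed simp
    show "\<bar>t\<bar> * \<bar>F t\<bar> \<le> (\<kappa> + 1) * (H t)\<^sup>2" for t
      using key[of t] key[of "- t"] Hodd[of t] Fodd[of t] by (cases "0 \<le> t") auto
    show "\<bar>F t\<bar> \<le> \<bar>t\<bar> powr (2 * \<kappa> + 1)" for t
    proof -
      have "\<bar>F t\<bar> \<le> \<bar>t\<bar> * (h t)\<^sup>2" by (rule Fb)
      also have "\<dots> \<le> \<bar>t\<bar> * (\<bar>t\<bar> powr \<kappa>)\<^sup>2" by (intro mult_left_mono power_mono ht h0) auto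
      also have "\<dots> = \<bar>t\<bar> powr (2 * \<kappa> + 1)"
      proof -
        have "(\<bar>t\<bar> powr \<kappa>)\<^sup>2 = \<bar>t\<bar> powr (2 * \<kappa>)"
          by (simp add: power2_eq_square flip: powr_add)
        then show ?thesis using powr_add[of "\<bar>t\<bar>" "2 * \<kappa>" 1] by (simp add: mult.commute)
      qed
      finally show ?thesis .
    qed
    show "\<bar>H t\<bar> = \<bar>t\<bar> powr (\<kappa> + 1) / (\<kappa> + 1)" if "\<bar>t\<bar> \<le> T" for t
    proof -
      have "\<bar>H t\<bar> = \<bar>H \<bar>t\<bar>\<bar>" using Hodd[of t] by (cases "0 \<le> t") auto
      also have "H \<bar>t\<bar> = \<bar>t\<bar> powr (\<kappa> + 1) / (\<kappa> + 1)" using that by (intro Hpow) auto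
      finally show ?thesis using \<kappa> by simp
    qed
    show "\<bar>H t\<bar> \<le> T powr \<kappa> * \<bar>t\<bar>" for t by (rule Hb)
  qed
qed

section \<open>The energy inequality\<close>

lemma AE_lborel_pair:
  fixes P :: "'a::euclidean_space \<Rightarrow> bool"
  assumes "AE x in lborel. P x"
  shows "AE z in (lborel :: ('a \<times> 'a) measure). P (fst z) \<and> P (snd z)"
proof -
  obtain N where N: "N \<in> null_sets lborel" "{x. \<not> P x} \<subseteq> N"
    using assms by (auto simp: eventually_ae_filter)
  have [measurable]: "N \<in> sets borel" and e: "emeasure lborel N = 0" using N(1) by (auto simp: null_sets_def)
  have "N \<times> UNIV \<in> null_sets (lborel \<Otimes>\<^sub>M lborel)" "UNIV \<times> N \<in> null_sets (lborel \<Otimes>\<^sub>M lborel)"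
    using lborel.emeasure_pair_measure_Times[of N lborel UNIV] lborel.emeasure_pair_measure_Times[of UNIV lborel N] e
    by (auto simp: null_sets_def)
  then have "N \<times> UNIV \<union> UNIV \<times> N \<in> null_sets (lborel \<Otimes>\<^sub>M lborel)" by (rule null_sets.Un)
  then have "N \<times> UNIV \<union> UNIV \<times> N \<in> null_sets (lborel :: ('a \<times> 'a) measure)" by (simp add: lborel_prod)
  then show ?thesis by (rule AE_I') (use N(2) in auto)
qed

text \<open>Borel measurability of a projection handles only Borel sets. For Lebesgue sets it must
  also be known that preimages of null sets are null in the product, which is
  \<open>AE_lborel_pair\<close>.\<close>

lemma lebesgue_measurable_fst_snd:
  fixes u :: "'a::euclidean_space \<Rightarrow> real"
  assumes "u \<in> borel_measurable lebesgue"
  shows "(\<lambda>z::'a \<times> 'a. u (fst z)) \<in> borel_measurable lebesgue"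
    and "(\<lambda>z::'a \<times> 'a. u (snd z)) \<in> borel_measurable lebesgue"
proof -
  have *: "f \<in> (lebesgue :: ('a \<times> 'a) measure) \<rightarrow>\<^sub>M lebesgue"
    if f: "f \<in> borel \<rightarrow>\<^sub>M borel" and P: "\<And>P. (AE x in lborel. P x) \<Longrightarrow> (AE z in (lborel :: ('a \<times> 'a) measure). P (f z))"
    for f :: "'a \<times> 'a \<Rightarrow> 'a"
  proof (rule completion.measurable_completion2)
    show fm: "f \<in> (lebesgue :: ('a \<times> 'a) measure) \<rightarrow>\<^sub>M lborel"
      using f by (auto intro!: measurable_completion)
    show "null_sets lborel \<subseteq> null_sets (distr lebesgue lborel f)"
    proof
      fix N :: "'a set" assume N: "N \<in> null_sets lborel"
      have "AE z in lborel. f z \<notin> N" by (rule P[OF AE_not_in[OF N]])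
      then have "AE z in lebesgue. f z \<notin> N" by (rule AE_completion)
      moreover have "f -` N \<inter> space lebesgue \<in> sets lebesgue"
        using fm N by (auto simp del: space_completion intro!: measurable_sets[OF fm])
      ultimately have "emeasure lebesgue (f -` N \<inter> space lebesgue) = 0"
        by (subst (asm) AE_iff_measurable[of "f -` N"]) auto
      then show "N \<in> null_sets (distr lebesgue lborel f)"
        using N fm by (auto simp: null_sets_def emeasure_distr)
    qed
  qed
  have "fst \<in> (lebesgue :: ('a \<times> 'a) measure) \<rightarrow>\<^sub>M lebesgue"
    by (rule *, rule borel_measurable_continuous_onI[OF continuous_on_fst[OF continuous_on_id]])
       (drule AE_lborel_pair, erule eventually_mono, simp)
  then show "(\<lambda>z::'a \<times> 'a. u (fst z)) \<in> borel_measurable lebesgue"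
    using assms by (rule measurable_compose)
  have "snd \<in> (lebesgue :: ('a \<times> 'a) measure) \<rightarrow>\<^sub>M lebesgue"
    by (rule *, rule borel_measurable_continuous_onI[OF continuous_on_snd[OF continuous_on_id]])
       (drule AE_lborel_pair, erule eventually_mono, simp)
  then show "(\<lambda>z::'a \<times> 'a. u (snd z)) \<in> borel_measurable lebesgue"
    using assms by (rule measurable_compose)
qed

lemma norm_diff_lebesgue_measurable:
  "(\<lambda>z::'a::euclidean_space \<times> 'a. norm (fst z - snd z)) \<in> borel_measurable lebesgue"
  by (intro measurable_completion) (auto intro!: borel_measurable_continuous_onI continuous_intros)

lemma critical_exponent_props:
  assumes "0 < s" "2 * s < real n"
  defines "p \<equiv> critical_exponent n s"
  shows "2 < p" "real n + 2 * s = real n * (2 - 2 / p)"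
  using assms by (auto simp: critical_exponent_def field_simps)

text \<open>Transfers the Borel version to Lebesgue measurable \<open>u\<close>. Multiplying a Borel
  representative by the indicator of \<Omega> turns vanishing almost everywhere outside \<Omega>
  into vanishing everywhere there, and \<open>H 0 = 0\<close> preserves this.\<close>

lemma fractional_sobolev_X1_0:
  fixes u :: "'a::euclidean_space \<Rightarrow> real" and H :: "real \<Rightarrow> real"
  assumes s: "0 < s" "2 * s < real DIM('a)" and p: "p = critical_exponent DIM('a) s"
    and \<Omega>: "open \<Omega>" "bounded \<Omega>"
    and u: "u \<in> borel_measurable lebesgue" "AE x in lebesgue. x \<notin> \<Omega> \<longrightarrow> u x = 0"
    and H: "continuous_on UNIV H" "H 0 = 0" and "0 \<le> e"
    and e: "(\<integral>\<^sup>+z. ennreal ((H (u (fst z)) - H (u (snd z)))\<^sup>2 / norm (fst z - snd z) powr (real DIM('a) + 2 * s))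
       \<partial>(lebesgue :: ('a \<times> 'a) measure)) \<le> ennreal e"
  shows "(\<integral>\<^sup>+x. ennreal (\<bar>H (u x)\<bar> powr p) \<partial>lebesgue_on \<Omega>) \<le> ennreal ((sobolev_const DIM('a) p * e) powr (p / 2))"
proof -
  have [measurable]: "H \<in> borel_measurable borel" using H(1) by (rule borel_measurable_continuous_onI)
  have [measurable]: "\<Omega> \<in> sets borel" using \<Omega>(1) by auto
  obtain u0 where u0[measurable]: "u0 \<in> borel_measurable lborel" and "AE x in lborel. u x = u0 x"
    using completion_ex_borel_measurable_real[OF u(1)] by blast
  moreover have "AE x in lborel. x \<notin> \<Omega> \<longrightarrow> u x = 0" using u(2) by (simp add: AE_completion_iff)
  ultimately have ae: "AE x in lborel. u x = indicator \<Omega> x * u0 x" by (auto simp: indicator_def)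
  define w where "w x = H (indicator \<Omega> x * u0 x)" for x
  have [measurable]: "w \<in> borel_measurable borel" unfolding w_def using u0 by measurable
  have aew: "AE x in lborel. H (u x) = w x" using ae by eventually_elim (simp add: w_def)
  let ?a = "real DIM('a) + 2 * s"
  have [measurable]: "(\<lambda>z::'a \<times> 'a. norm (fst z - snd z) powr ?a) \<in> borel_measurable borel"
  proof -
    have [measurable]: "(\<lambda>z::'a \<times> 'a. norm (fst z - snd z)) \<in> borel_measurable borel"
      by (intro borel_measurable_continuous_onI continuous_intros)
    show ?thesis by measurable
  qed
  have "(\<integral>\<^sup>+x. \<integral>\<^sup>+y. ennreal ((w x - w y)\<^sup>2 / norm (x - y) powr ?a) \<partial>lborel \<partial>lborel)
     = (\<integral>\<^sup>+z. ennreal ((w (fst z) - w (snd z))\<^sup>2 / norm (fst z - snd z) powr ?a) \<partial>(lborel \<Otimes>\<^sub>M lborel))"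
    by (subst lborel.nn_integral_fst[symmetric]) auto
  also have "\<dots> = (\<integral>\<^sup>+z. ennreal ((w (fst z) - w (snd z))\<^sup>2 / norm (fst z - snd z) powr ?a) \<partial>(lborel :: ('a \<times> 'a) measure))"
    by (simp add: lborel_prod)
  also have "\<dots> = (\<integral>\<^sup>+z. ennreal ((H (u (fst z)) - H (u (snd z)))\<^sup>2 / norm (fst z - snd z) powr ?a) \<partial>(lborel :: ('a \<times> 'a) measure))"
    by (intro nn_integral_cong_AE eventually_mono[OF AE_lborel_pair[OF aew]]) simp
  also have "\<dots> \<le> ennreal e" using e by (simp add: nn_integral_completion)
  finally have E: "(\<integral>\<^sup>+x. \<integral>\<^sup>+y. ennreal ((w x - w y)\<^sup>2 / norm (x - y) powr ?a) \<partial>lborel \<partial>lborel) \<le> ennreal e" .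
  have "(\<integral>\<^sup>+x. ennreal (\<bar>H (u x)\<bar> powr p) \<partial>lebesgue_on \<Omega>) \<le> (\<integral>\<^sup>+x. ennreal (\<bar>H (u x)\<bar> powr p) \<partial>lebesgue)"
    by (subst nn_integral_restrict_space) (auto intro!: nn_integral_mono simp: indicator_def)
  also have "\<dots> = (\<integral>\<^sup>+x. ennreal (\<bar>H (u x)\<bar> powr p) \<partial>lborel)" by (simp add: nn_integral_completion)
  also have "\<dots> = (\<integral>\<^sup>+x. ennreal (\<bar>w x\<bar> powr p) \<partial>lborel)"
    by (intro nn_integral_cong_AE eventually_mono[OF aew]) simp
  also have "\<dots> \<le> ennreal ((sobolev_const DIM('a) p * e) powr (p / 2))"
    using critical_exponent_props[OF s] H(2) unfolding p[symmetric]
    by (intro fractional_sobolev[OF _ _ \<open>0 \<le> e\<close> _ \<Omega>(2) _ E]) (auto simp: w_def)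
  finally show ?thesis .
qed

text \<open>Makes \<open>F\<close> composed with \<open>u\<close> available as a test function:
  since \<open>F\<close> is \<open>L\<close>-Lipschitz with \<open>F 0 = 0\<close>, the function,
  its weak gradient and the Gagliardo quotient are all dominated by \<open>L\<close> times those of
  \<open>u\<close>.\<close>

lemma X1_0_compose:
  fixes u :: "'a::euclidean_space \<Rightarrow> real" and F F' :: "real \<Rightarrow> real"
  assumes \<Omega>: "open \<Omega>" and u: "u \<in> X1_0 s \<Omega>"
    and F: "\<And>t. (F has_real_derivative F' t) (at t)" "F 0 = 0"
    and L: "\<And>a. \<bar>F' a\<bar> \<le> L" and M: "\<And>a b. \<bar>F' a - F' b\<bar> \<le> M * \<bar>a - b\<bar>"
  shows "(\<lambda>x. F (u x)) \<in> X1_0 s \<Omega>"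
proof -
  let ?a = "real DIM('a) + 2 * s"
  have [measurable]: "u \<in> borel_measurable lebesgue" using u by (simp add: X1_0_def X1_def)
  have [measurable]: "F \<in> borel_measurable borel" by (rule derivative_borel_measurable[OF F(1)])
  have F'm[measurable]: "F' \<in> borel_measurable borel" by (rule lipschitz_borel_measurable[OF M])
  have lip: "\<bar>F a - F b\<bar> \<le> L * \<bar>a - b\<bar>" for a b by (rule bounded_derivative_lipschitz[OF F(1) L])
  have L0: "0 \<le> L" using L[of 0] by linarith
  have lip2: "\<bar>F a - F b\<bar>\<^sup>2 \<le> L\<^sup>2 * \<bar>a - b\<bar>\<^sup>2" for a b
    using power_mono[OF lip[of a b], of 2] by (simp add: power_mult_distrib)
  have \<Omega>l: "\<Omega> \<in> sets lebesgue" using \<Omega> by auto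
  obtain G where G: "has_weak_gradient \<Omega> u G" "L2 (lebesgue_on \<Omega>) G" and u2: "L2 (lebesgue_on \<Omega>) u"
    using u by (auto simp: X1_0_def X1_def H1_def)
  have [measurable]: "u \<in> borel_measurable (lebesgue_on \<Omega>)" "G \<in> borel_measurable (lebesgue_on \<Omega>)"
    using u2 G(2) by (auto simp: L2_def)
  have "L2 (lebesgue_on \<Omega>) (\<lambda>x. F (u x))"
    unfolding L2_def
  proof
    show "integrable (lebesgue_on \<Omega>) (\<lambda>x. (norm (F (u x)))\<^sup>2)"
    proof (rule Bochner_Integration.integrable_bound)
      show "integrable (lebesgue_on \<Omega>) (\<lambda>x. L\<^sup>2 * (norm (u x))\<^sup>2)" using u2 by (simp add: L2_def)
      show "AE x in lebesgue_on \<Omega>. norm ((norm (F (u x)))\<^sup>2) \<le> norm (L\<^sup>2 * (norm (u x))\<^sup>2)"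
        using lip2[of _ 0] F(2) by (intro AE_I2) simp
    qed measurable
  qed measurable
  moreover have "L2 (lebesgue_on \<Omega>) (\<lambda>x. F' (u x) *\<^sub>R G x)"
    unfolding L2_def
  proof
    show "integrable (lebesgue_on \<Omega>) (\<lambda>x. (norm (F' (u x) *\<^sub>R G x))\<^sup>2)"
    proof (rule Bochner_Integration.integrable_bound)
      show "integrable (lebesgue_on \<Omega>) (\<lambda>x. L\<^sup>2 * (norm (G x))\<^sup>2)" using G(2) by (simp add: L2_def)
      have "\<bar>F' t\<bar>\<^sup>2 \<le> L\<^sup>2" for t using power_mono[OF L[of t], of 2] by simp
      then have "\<bar>F' t\<bar>\<^sup>2 * r\<^sup>2 \<le> L\<^sup>2 * r\<^sup>2" for t r :: real by (rule mult_right_mono) simp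
      then show "AE x in lebesgue_on \<Omega>. norm ((norm (F' (u x) *\<^sub>R G x))\<^sup>2) \<le> norm (L\<^sup>2 * (norm (G x))\<^sup>2)"
        by (intro AE_I2) (simp add: power_mult_distrib)
    qed measurable
  qed measurable
  ultimately have H1: "(\<lambda>x. F (u x)) \<in> H1 \<Omega>"
    using has_weak_gradient_chain_rule[OF \<Omega> G F L M] unfolding H1_def by blast
  let ?U = "\<lambda>z::'a \<times> 'a. \<bar>u (fst z) - u (snd z)\<bar> / norm (fst z - snd z) powr (?a / 2)"
  let ?V = "\<lambda>z::'a \<times> 'a. \<bar>F (u (fst z)) - F (u (snd z))\<bar> / norm (fst z - snd z) powr (?a / 2)"
  have U: "integrable lebesgue (\<lambda>z. (?U z)\<^sup>2)"
    using u by (simp add: X1_0_def X1_def L2_def case_prod_beta)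
  note [measurable] = lebesgue_measurable_fst_snd[OF \<open>u \<in> borel_measurable lebesgue\<close>] norm_diff_lebesgue_measurable
  have Vm: "?V \<in> borel_measurable lebesgue" by measurable
  have "integrable lebesgue (\<lambda>z. (?V z)\<^sup>2)"
  proof (rule Bochner_Integration.integrable_bound)
    show "integrable lebesgue (\<lambda>z. L\<^sup>2 * (?U z)\<^sup>2)" using U by simp
    show "AE z in lebesgue. norm ((?V z)\<^sup>2) \<le> norm (L\<^sup>2 * (?U z)\<^sup>2)"
      using lip2 by (intro AE_I2) (simp add: power_divide divide_right_mono)
  qed (use Vm in measurable)
  then have "L2 (lebesgue :: ('a \<times> 'a) measure)
       (\<lambda>(x, y). \<bar>F (u x) - F (u y)\<bar> / norm (x - y) powr (?a / 2))"
    using Vm by (simp add: L2_def case_prod_beta)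
  moreover have "AE x in lebesgue. x \<notin> \<Omega> \<longrightarrow> F (u x) = 0"
    using u F(2) by (auto simp: X1_0_def)
  ultimately show ?thesis using H1 by (simp add: X1_0_def X1_def)
qed

text \<open>Up to null sets the two chosen gradients are \<open>G\<close> and
  \<open>F' (u x) *\<^sub>R G x\<close>, so the integrand is \<open>F' (u x)\<close> times the
  squared norm of \<open>G x\<close>.\<close>

lemma local_energy_nonneg:
  fixes u :: "'a::euclidean_space \<Rightarrow> real" and F F' :: "real \<Rightarrow> real"
  assumes \<Omega>: "open \<Omega>" and u: "u \<in> X1_0 s \<Omega>"
    and F: "\<And>t. (F has_real_derivative F' t) (at t)" "F 0 = 0" "\<And>t. 0 \<le> F' t"
    and L: "\<And>a. \<bar>F' a\<bar> \<le> L" and M: "\<And>a b. \<bar>F' a - F' b\<bar> \<le> M * \<bar>a - b\<bar>"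
  shows "0 \<le> (\<integral>x. weak_gradient \<Omega> u x \<bullet> weak_gradient \<Omega> (\<lambda>x. F (u x)) x \<partial>lebesgue_on \<Omega>)"
proof (rule integral_nonneg_AE)
  obtain G where G: "has_weak_gradient \<Omega> u G" "L2 (lebesgue_on \<Omega>) G"
    using u by (auto simp: X1_0_def X1_def H1_def)
  have 1: "has_weak_gradient \<Omega> u (weak_gradient \<Omega> u)"
    unfolding weak_gradient_def using someI[of "has_weak_gradient \<Omega> u" G] G(1) by simp
  have 2: "has_weak_gradient \<Omega> (\<lambda>x. F (u x)) (\<lambda>x. F' (u x) *\<^sub>R G x)"
    by (rule has_weak_gradient_chain_rule[OF \<Omega> G F(1,2) L M])
  have 3: "has_weak_gradient \<Omega> (\<lambda>x. F (u x)) (weak_gradient \<Omega> (\<lambda>x. F (u x)))"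
    unfolding weak_gradient_def using someI[of "has_weak_gradient \<Omega> (\<lambda>x. F (u x))", OF 2] by simp
  from has_weak_gradient_unique[OF \<Omega> 1 G(1)] has_weak_gradient_unique[OF \<Omega> 3 2]
  show "AE x in lebesgue_on \<Omega>. 0 \<le> weak_gradient \<Omega> u x \<bullet> weak_gradient \<Omega> (\<lambda>x. F (u x)) x"
    by eventually_elim (simp add: F(3))
qed

text \<open>In the equation tested with \<open>F\<close> composed with \<open>u\<close>, the local
  term is discarded by its sign. What remains bounds the nonlocal term by \<open>e\<close>, hence
  also the Gagliardo energy of \<open>H\<close> composed with \<open>u\<close>.\<close>

lemma energy_inequality:
  fixes u :: "'a::euclidean_space \<Rightarrow> real" and F F' H :: "real \<Rightarrow> real"
  assumes s: "0 < s" "2 * s < real DIM('a)" and p: "p = critical_exponent DIM('a) s"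
    and \<Omega>: "open \<Omega>" "bounded \<Omega>" and sol: "weak_solution s \<Omega> g u"
    and F: "\<And>t. (F has_real_derivative F' t) (at t)" "F 0 = 0" "\<And>t. 0 \<le> F' t"
    and L: "\<And>a. \<bar>F' a\<bar> \<le> L" and M: "\<And>a b. \<bar>F' a - F' b\<bar> \<le> M * \<bar>a - b\<bar>"
    and H: "continuous_on UNIV H" "H 0 = 0" "\<And>a b. (H a - H b)\<^sup>2 \<le> (a - b) * (F a - F b)"
    and e: "(\<integral>\<^sup>+x. ennreal \<bar>g x (u x) * F (u x)\<bar> \<partial>lebesgue_on \<Omega>) \<le> ennreal e" "0 \<le> e"
  shows "(\<integral>\<^sup>+x. ennreal (\<bar>H (u x)\<bar> powr p) \<partial>lebesgue_on \<Omega>) \<le> ennreal ((sobolev_const DIM('a) p * e) powr (p / 2))"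
proof -
  let ?a = "real DIM('a) + 2 * s"
  have u: "u \<in> X1_0 s \<Omega>" using sol by (simp add: weak_solution_def)
  have um[measurable]: "u \<in> borel_measurable lebesgue" using u by (simp add: X1_0_def X1_def)
  have [measurable]: "F \<in> borel_measurable borel" by (rule derivative_borel_measurable[OF F(1)])
  have lip: "\<bar>F a - F b\<bar> \<le> L * \<bar>a - b\<bar>" for a b by (rule bounded_derivative_lipschitz[OF F(1) L])
  have L0: "0 \<le> L" using L[of 0] by linarith
  note [measurable] = lebesgue_measurable_fst_snd[OF um] norm_diff_lebesgue_measurable
  let ?E = "\<lambda>z::'a \<times> 'a. (u (fst z) - u (snd z)) * (F (u (fst z)) - F (u (snd z))) / norm (fst z - snd z) powr ?a"
  let ?U = "\<lambda>z::'a \<times> 'a. \<bar>u (fst z) - u (snd z)\<bar> / norm (fst z - snd z) powr (?a / 2)"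
  have U: "integrable lebesgue (\<lambda>z. (?U z)\<^sup>2)"
    using u by (simp add: X1_0_def X1_def L2_def case_prod_beta)
  \<comment> \<open>Without integrability the Bochner integral would be 0 by default and its bound
    would say nothing about the nonnegative integral.\<close>
  have E: "integrable lebesgue ?E"
  proof (rule Bochner_Integration.integrable_bound)
    show "integrable lebesgue (\<lambda>z. L * (?U z)\<^sup>2)" using U by simp
    have "norm (?E z) \<le> norm (L * (?U z)\<^sup>2)" for z
    proof -
      have "\<bar>u (fst z) - u (snd z)\<bar> * \<bar>F (u (fst z)) - F (u (snd z))\<bar> \<le> \<bar>u (fst z) - u (snd z)\<bar> * (L * \<bar>u (fst z) - u (snd z)\<bar>)"
        by (intro mult_left_mono lip) auto
      also have "\<dots> = L * (u (fst z) - u (snd z))\<^sup>2" by (simp add: power2_eq_square)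
      finally have "\<bar>u (fst z) - u (snd z)\<bar> * \<bar>F (u (fst z)) - F (u (snd z))\<bar> \<le> L * (u (fst z) - u (snd z))\<^sup>2" .
      moreover have "(norm (fst z - snd z) powr (?a / 2))\<^sup>2 = norm (fst z - snd z) powr ?a"
        by (simp add: power2_eq_square flip: powr_add)
      ultimately show ?thesis using L0 by (simp add: abs_mult power_divide divide_right_mono)
    qed
    then show "AE z in lebesgue. norm (?E z) \<le> norm (L * (?U z)\<^sup>2)" by (rule AE_I2)
  qed measurable
  have HE: "(H (u (fst z)) - H (u (snd z)))\<^sup>2 / norm (fst z - snd z) powr ?a \<le> ?E z" for z
    by (intro divide_right_mono H(3)) auto
  then have E0: "0 \<le> ?E z" for z by (rule order_trans[rotated]) simp
  have "(\<integral>x. weak_gradient \<Omega> u x \<bullet> weak_gradient \<Omega> (\<lambda>x. F (u x)) x \<partial>lebesgue_on \<Omega>) + (\<integral>z. ?E z \<partial>lebesgue)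
     = (\<integral>x. g x (u x) * F (u x) \<partial>lebesgue_on \<Omega>)"
    using sol[unfolded weak_solution_def, THEN conjunct2, THEN conjunct2, rule_format, OF X1_0_compose[OF \<Omega>(1) u F(1,2) L M]]
    unfolding case_prod_beta .
  moreover have "\<bar>\<integral>x. g x (u x) * F (u x) \<partial>lebesgue_on \<Omega>\<bar> \<le> e" by (rule abs_integral_le[OF e])
  ultimately have Ee: "(\<integral>z. ?E z \<partial>lebesgue) \<le> e"
    using local_energy_nonneg[OF \<Omega>(1) u F L M] by linarith
  have "(\<integral>\<^sup>+z. ennreal ((H (u (fst z)) - H (u (snd z)))\<^sup>2 / norm (fst z - snd z) powr ?a) \<partial>(lebesgue :: ('a \<times> 'a) measure))
     \<le> (\<integral>\<^sup>+z. ennreal (?E z) \<partial>lebesgue)"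
    by (intro nn_integral_mono ennreal_leI HE)
  also have "\<dots> = ennreal (\<integral>z. ?E z \<partial>lebesgue)" by (intro nn_integral_eq_integral E AE_I2 E0)
  also have "\<dots> \<le> ennreal e" using Ee by (rule ennreal_leI)
  finally show ?thesis
    using u by (intro fractional_sobolev_X1_0[OF s p \<Omega> um _ H(1,2) e(2)]) (auto simp: X1_0_def)
qed

section \<open>Auxiliary facts for the iteration\<close>

lemma one_plus_powr_le:
  fixes y r :: real
  assumes "0 \<le> y" "1 \<le> r"
  shows "1 + y powr r \<le> (1 + y) powr r"
proof -
  have "1 + y powr r = 1 + y * y powr (r - 1)"
    using assms by (cases "y = 0") (auto simp: powr_diff)
  also have "\<dots> \<le> 1 * (1 + y) powr (r - 1) + y * (1 + y) powr (r - 1)"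
    using assms by (intro add_mono mult_left_mono) (auto intro!: powr_mono2 ge_one_powr_ge_zero)
  also have "\<dots> = (1 + y) * (1 + y) powr (r - 1)" by (simp add: distrib_right)
  also have "\<dots> = (1 + y) powr r" using assms by (simp add: powr_diff)
  finally show ?thesis .
qed

lemma powr_le_one_plus_powr:
  fixes t a b :: real
  assumes "0 \<le> t" "0 \<le> a" "a \<le> b"
  shows "t powr a \<le> 1 + t powr b"
proof (cases "t \<le> 1")
  case True
  then have "t powr a \<le> 1 powr a" using assms by (intro powr_mono2) auto
  then show ?thesis by (simp add: add_increasing2)
next
  case False
  then have "t powr a \<le> t powr b" using assms by (intro powr_mono) auto
  then show ?thesis by simp
qed

text \<open>\<open>Z\<close> is the same for all \<open>T\<close>. At each point the truncated power
  equals the full power as soon as \<open>T\<close> exceeds \<open>\<bar>u x\<bar>\<close>, so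
  Fatou's lemma passes the bound to the limit; the factor \<open>(\<kappa> + 1) powr p\<close>
  undoes the normalisation of \<open>H\<close>.\<close>

lemma truncation_limit:
  fixes u :: "'a \<Rightarrow> real"
  assumes u[measurable]: "u \<in> borel_measurable M" and "0 \<le> \<kappa>" "0 < p" "0 \<le> Z"
    and H: "\<And>T. 0 < T \<Longrightarrow> \<exists>H. continuous_on UNIV H \<and> (\<forall>t. \<bar>t\<bar> \<le> T \<longrightarrow> \<bar>H t\<bar> = \<bar>t\<bar> powr (\<kappa> + 1) / (\<kappa> + 1)) \<and>
        (\<integral>\<^sup>+x. ennreal (\<bar>H (u x)\<bar> powr p) \<partial>M) \<le> ennreal Z"
  shows "integrable M (\<lambda>x. \<bar>u x\<bar> powr (p * (\<kappa> + 1)))"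
    and "(\<integral>x. \<bar>u x\<bar> powr (p * (\<kappa> + 1)) \<partial>M) \<le> (\<kappa> + 1) powr p * Z"
proof -
  have "\<exists>H. continuous_on UNIV H \<and> (\<forall>t. \<bar>t\<bar> \<le> real (Suc N) \<longrightarrow> \<bar>H t\<bar> = \<bar>t\<bar> powr (\<kappa> + 1) / (\<kappa> + 1)) \<and>
        (\<integral>\<^sup>+x. ennreal (\<bar>H (u x)\<bar> powr p) \<partial>M) \<le> ennreal Z" for N
    by (rule H) simp
  then obtain h where h: "\<And>N. continuous_on UNIV (h N)"
    "\<And>N t. \<bar>t\<bar> \<le> real (Suc N) \<Longrightarrow> \<bar>h N t\<bar> = \<bar>t\<bar> powr (\<kappa> + 1) / (\<kappa> + 1)"
    "\<And>N. (\<integral>\<^sup>+x. ennreal (\<bar>h N (u x)\<bar> powr p) \<partial>M) \<le> ennreal Z"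
    by metis
  have [measurable]: "h N \<in> borel_measurable borel" for N using h(1) by (rule borel_measurable_continuous_onI)
  have pw: "ennreal (\<bar>u x\<bar> powr (p * (\<kappa> + 1))) = ennreal ((\<kappa> + 1) powr p) * liminf (\<lambda>N. ennreal (\<bar>h N (u x)\<bar> powr p))" for x
  proof -
    obtain N0 where N0: "\<bar>u x\<bar> \<le> real N0" using real_arch_simple by blast
    have "\<bar>h N (u x)\<bar> = \<bar>u x\<bar> powr (\<kappa> + 1) / (\<kappa> + 1)" if "N0 \<le> N" for N
      using N0 that by (intro h(2)) auto
    then have "\<forall>\<^sub>F N in sequentially. ennreal (\<bar>h N (u x)\<bar> powr p) = ennreal ((\<bar>u x\<bar> powr (\<kappa> + 1) / (\<kappa> + 1)) powr p)"
      by (intro eventually_sequentiallyI[of N0]) simp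
    then have "(\<lambda>N. ennreal (\<bar>h N (u x)\<bar> powr p)) \<longlonglongrightarrow> ennreal ((\<bar>u x\<bar> powr (\<kappa> + 1) / (\<kappa> + 1)) powr p)"
      by (rule tendsto_eventually)
    then have "liminf (\<lambda>N. ennreal (\<bar>h N (u x)\<bar> powr p)) = ennreal ((\<bar>u x\<bar> powr (\<kappa> + 1) / (\<kappa> + 1)) powr p)"
      by (rule lim_imp_Liminf[OF trivial_limit_sequentially])
    also have "(\<bar>u x\<bar> powr (\<kappa> + 1) / (\<kappa> + 1)) powr p = \<bar>u x\<bar> powr (p * (\<kappa> + 1)) / (\<kappa> + 1) powr p"
      using \<open>0 \<le> \<kappa>\<close> by (simp add: powr_divide powr_powr mult.commute)
    finally show ?thesis using \<open>0 \<le> \<kappa>\<close> by (simp add: ennreal_mult[symmetric])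
  qed
  have "(\<integral>\<^sup>+x. ennreal (\<bar>u x\<bar> powr (p * (\<kappa> + 1))) \<partial>M)
     = ennreal ((\<kappa> + 1) powr p) * (\<integral>\<^sup>+x. liminf (\<lambda>N. ennreal (\<bar>h N (u x)\<bar> powr p)) \<partial>M)"
    unfolding pw by (intro nn_integral_cmult) measurable
  also have "\<dots> \<le> ennreal ((\<kappa> + 1) powr p) * liminf (\<lambda>N. \<integral>\<^sup>+x. ennreal (\<bar>h N (u x)\<bar> powr p) \<partial>M)"
    by (intro mult_left_mono nn_integral_liminf) auto
  also have "\<dots> \<le> ennreal ((\<kappa> + 1) powr p) * liminf (\<lambda>N::nat. ennreal Z)"
    by (intro mult_left_mono Liminf_mono always_eventually allI h(3)) auto
  also have "\<dots> = ennreal ((\<kappa> + 1) powr p * Z)"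
    using \<open>0 \<le> Z\<close> by (simp add: Liminf_const ennreal_mult)
  finally have le: "(\<integral>\<^sup>+x. ennreal (\<bar>u x\<bar> powr (p * (\<kappa> + 1))) \<partial>M) \<le> ennreal ((\<kappa> + 1) powr p * Z)" .
  show "integrable M (\<lambda>x. \<bar>u x\<bar> powr (p * (\<kappa> + 1)))"
    using le by (intro integrableI_bounded) (auto intro: order.strict_trans1)
  then have "ennreal (\<integral>x. \<bar>u x\<bar> powr (p * (\<kappa> + 1)) \<partial>M) \<le> ennreal ((\<kappa> + 1) powr p * Z)"
    using le nn_integral_eq_integral[of M "\<lambda>x. \<bar>u x\<bar> powr (p * (\<kappa> + 1))"] by simp
  then show "(\<integral>x. \<bar>u x\<bar> powr (p * (\<kappa> + 1)) \<partial>M) \<le> (\<kappa> + 1) powr p * Z"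
    using \<open>0 \<le> Z\<close> by simp
qed

text \<open>\<alpha> and \<gamma> are chosen so that
  \<open>x k + \<alpha> * real k + \<gamma>\<close> grows at most by the factor \<theta> in each
  step: comparing the coefficients of \<open>k\<close> gives
  \<open>\<theta> * b + \<alpha> = \<theta> * \<alpha>\<close>, and the constant terms give
  \<open>\<theta> * B + \<alpha> + \<gamma> = \<theta> * \<gamma>\<close>.\<close>

lemma affine_recursion_bound:
  fixes x :: "nat \<Rightarrow> real"
  assumes "1 < \<theta>" and x: "\<And>k. x (Suc k) \<le> \<theta> * (x k + B + real k * b)"
  defines "\<alpha> \<equiv> \<theta> * b / (\<theta> - 1)"
  defines "\<gamma> \<equiv> (\<theta> * B + \<alpha>) / (\<theta> - 1)"
  shows "x k + \<alpha> * real k + \<gamma> \<le> \<theta> ^ k * (x 0 + \<gamma>)"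
proof (induction k)
  case (Suc k)
  have "\<alpha> * (\<theta> - 1) = \<theta> * b" and "\<gamma> * (\<theta> - 1) = \<theta> * B + \<alpha>"
    using \<open>1 < \<theta>\<close> by (simp_all add: \<alpha>_def \<gamma>_def)
  then have 1: "\<theta> * b + \<alpha> = \<theta> * \<alpha>" and 2: "\<theta> * B + \<alpha> + \<gamma> = \<theta> * \<gamma>"
    by (simp_all add: algebra_simps)
  have "x (Suc k) + \<alpha> * real (Suc k) + \<gamma> \<le> \<theta> * (x k + B + real k * b) + \<alpha> * real (Suc k) + \<gamma>"
    using x[of k] by simp
  also have "\<dots> = \<theta> * x k + real k * (\<theta> * b + \<alpha>) + (\<theta> * B + \<alpha> + \<gamma>)" by (simp add: algebra_simps)
  also have "\<dots> = \<theta> * (x k + \<alpha> * real k + \<gamma>)" unfolding 1 2 by (simp add: algebra_simps)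
  also have "\<dots> \<le> \<theta> * (\<theta> ^ k * (x 0 + \<gamma>))" using Suc \<open>1 < \<theta>\<close> by (intro mult_left_mono) auto
  finally show ?case by simp
qed simp

text \<open>Chebyshev's inequality with exponent \<open>m k\<close> bounds the measure of the set
  where \<open>\<bar>u\<bar> > l\<close> by \<open>(S / l) powr m k\<close>, which tends to 0 for
  every \<open>l > S\<close>.\<close>

lemma AE_le_of_powr_integrals:
  fixes u :: "'a \<Rightarrow> real" and m :: "nat \<Rightarrow> real"
  assumes u[measurable]: "u \<in> borel_measurable M" and "0 < S" and m: "\<And>k. 0 < m k" "filterlim m at_top sequentially"
    and le: "\<And>k. (\<integral>\<^sup>+x. ennreal (\<bar>u x\<bar> powr m k) \<partial>M) \<le> ennreal (S powr m k)"
  shows "AE x in M. \<bar>u x\<bar> \<le> S"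
proof -
  have *: "AE x in M. \<bar>u x\<bar> \<le> l" if "S < l" for l
  proof -
    let ?A = "{x \<in> space M. l < \<bar>u x\<bar>}"
    have [measurable]: "?A \<in> sets M" by measurable
    have "0 < l" using that \<open>0 < S\<close> by simp
    have "emeasure M ?A \<le> ennreal ((S / l) powr m k)" for k
    proof -
      have "ennreal (l powr m k) * emeasure M ?A = (\<integral>\<^sup>+x. ennreal (l powr m k) * indicator ?A x \<partial>M)"
        by (simp add: nn_integral_cmult_indicator)
      also have "\<dots> \<le> (\<integral>\<^sup>+x. ennreal (\<bar>u x\<bar> powr m k) \<partial>M)"
        using \<open>0 < l\<close> less_imp_le[OF m(1)[of k]]
        by (intro nn_integral_mono) (auto simp: indicator_def intro!: ennreal_leI powr_mono2)
      also have "\<dots> \<le> ennreal (S powr m k)" by (rule le)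
      finally have "ennreal (l powr m k) * emeasure M ?A \<le> ennreal (S powr m k)" .
      then have "ennreal (1 / l powr m k) * (ennreal (l powr m k) * emeasure M ?A) \<le> ennreal (1 / l powr m k) * ennreal (S powr m k)"
        by (intro mult_left_mono) auto
      then show ?thesis
        using \<open>0 < l\<close> \<open>0 < S\<close> by (simp add: mult.assoc[symmetric] ennreal_mult[symmetric] powr_divide)
    qed
    moreover have "(\<lambda>k. (S / l) powr m k) \<longlonglongrightarrow> 0"
    proof -
      have "((\<lambda>x. exp (ln (S / l) * x)) \<longlongrightarrow> 0) at_top"
      proof -
        have "ln (S / l) < 0" using that \<open>0 < S\<close> by (simp add: ln_less_zero_iff)
        then have "filterlim (\<lambda>x. ln (S / l) * x) at_bot at_top"
          by (intro filterlim_tendsto_neg_mult_at_bot[OF tendsto_const] filterlim_ident) auto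
        from filterlim_compose[OF exp_at_bot this] show ?thesis .
      qed
      from filterlim_compose[OF this m(2)] show ?thesis
        using that \<open>0 < S\<close> by (simp add: powr_def mult.commute)
    qed
    then have "(\<lambda>k. ennreal ((S / l) powr m k)) \<longlonglongrightarrow> ennreal 0" by (intro tendsto_ennrealI)
    ultimately have "emeasure M ?A \<le> 0"
      by (intro LIMSEQ_le_const[of _ 0]) auto
    then have "?A \<in> null_sets M" by (auto simp: null_sets_def)
    then have "AE x in M. x \<notin> ?A" by (rule AE_not_in)
    then show ?thesis using AE_space by eventually_elim auto
  qed
  have "AE x in M. \<forall>k::nat. \<bar>u x\<bar> \<le> S + 1 / real (Suc k)"
    by (subst AE_all_countable, intro allI *) simp
  then show ?thesis
  proof eventually_elim
    fix x assume x: "\<forall>k::nat. \<bar>u x\<bar> \<le> S + 1 / real (Suc k)"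
    have "(\<lambda>k. S + 1 / real (Suc k)) \<longlonglongrightarrow> S + 0"
      by (intro tendsto_add tendsto_const LIMSEQ_Suc[OF lim_1_over_n])
    then show "\<bar>u x\<bar> \<le> S" using x by (intro LIMSEQ_le_const[of _ "S"]) auto
  qed
qed

section \<open>Integrability of powers of the solution and the Moser step\<close>

lemma X1_0_integrable_critical_powr:
  fixes u :: "'a::euclidean_space \<Rightarrow> real"
  assumes s: "0 < s" "2 * s < real DIM('a)" and p: "p = critical_exponent DIM('a) s"
    and \<Omega>: "open \<Omega>" "bounded \<Omega>" and u: "u \<in> X1_0 s \<Omega>"
  shows "integrable (lebesgue_on \<Omega>) (\<lambda>x. \<bar>u x\<bar> powr p)"
proof -
  let ?a = "real DIM('a) + 2 * s"
  let ?U = "\<lambda>z::'a \<times> 'a. \<bar>u (fst z) - u (snd z)\<bar> / norm (fst z - snd z) powr (?a / 2)"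
  define e where "e = (\<integral>z. (?U z)\<^sup>2 \<partial>lebesgue)"
  have um: "u \<in> borel_measurable lebesgue" using u by (simp add: X1_0_def X1_def)
  have umO[measurable]: "u \<in> borel_measurable (lebesgue_on \<Omega>)"
    using u by (auto simp: X1_0_def X1_def H1_def L2_def)
  have U: "integrable lebesgue (\<lambda>z. (?U z)\<^sup>2)"
    using u by (simp add: X1_0_def X1_def L2_def case_prod_beta)
  have "(norm (fst z - snd z) powr (?a / 2))\<^sup>2 = norm (fst z - snd z) powr ?a" for z :: "'a \<times> 'a"
    by (simp add: power2_eq_square flip: powr_add)
  then have "(\<integral>\<^sup>+z. ennreal ((u (fst z) - u (snd z))\<^sup>2 / norm (fst z - snd z) powr ?a) \<partial>(lebesgue :: ('a \<times> 'a) measure))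
     = (\<integral>\<^sup>+z. ennreal ((?U z)\<^sup>2) \<partial>lebesgue)"
    by (intro nn_integral_cong) (simp add: power_divide)
  also have "\<dots> = ennreal e" unfolding e_def by (intro nn_integral_eq_integral U) auto
  finally have "(\<integral>\<^sup>+x. ennreal (\<bar>u x\<bar> powr p) \<partial>lebesgue_on \<Omega>) \<le> ennreal ((sobolev_const DIM('a) p * e) powr (p / 2))"
    using u by (intro fractional_sobolev_X1_0[OF s p \<Omega> um, of "\<lambda>t. t"])
      (auto simp: X1_0_def e_def intro: Bochner_Integration.integral_nonneg continuous_on_id)
  then show ?thesis by (intro integrableI_bounded) (auto intro: order.strict_trans1)
qed

lemma weak_solution_measurable:
  "weak_solution s \<Omega> g u \<Longrightarrow> u \<in> borel_measurable (lebesgue_on \<Omega>)"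
  by (auto simp: weak_solution_def X1_0_def X1_def H1_def L2_def)

lemma finite_measure_lebesgue_on_bounded:
  assumes "open \<Omega>" "bounded \<Omega>"
  shows "finite_measure (lebesgue_on \<Omega>)"
  using assms bounded_set_imp_lmeasurable[of \<Omega>] by (intro finite_measure_lebesgue_on) auto

context
  fixes s c p :: real and \<Omega> :: "'a::euclidean_space set" and g :: "'a \<Rightarrow> real \<Rightarrow> real" and u :: "'a \<Rightarrow> real"
  assumes s: "0 < s" "2 * s < real DIM('a)" and p: "p = critical_exponent DIM('a) s"
    and \<Omega>: "open \<Omega>" "bounded \<Omega>" and sol: "weak_solution s \<Omega> g u" and c: "0 < c"
    and growth: "AE x in lebesgue_on \<Omega>. \<forall>t. \<bar>g x t\<bar> \<le> c * (1 + \<bar>t\<bar> powr (p - 1))"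
begin

lemma p_gt_2: "2 < p"
  using critical_exponent_props(1)[OF s] p by simp

declare weak_solution_measurable[OF sol, measurable]

text \<open>The right-hand side of the equation enters only through a majorant \<open>D\<close>.
  Quantifying over \<open>D\<close> after \<open>F\<close> and \<open>H\<close> have been obtained
  lets \<open>D\<close> involve \<open>H\<close> itself, as absorption requires.\<close>

lemma truncated_energy:
  fixes T \<kappa> :: real
  assumes T: "0 < T" and \<kappa>: "1 / 2 \<le> \<kappa>"
  obtains F H :: "real \<Rightarrow> real" where
    "continuous_on UNIV H"
    "\<And>t. \<bar>t\<bar> * \<bar>F t\<bar> \<le> (\<kappa> + 1) * (H t)\<^sup>2"
    "\<And>t. \<bar>F t\<bar> \<le> \<bar>t\<bar> powr (2 * \<kappa> + 1)"
    "\<And>t. \<bar>t\<bar> \<le> T \<Longrightarrow> \<bar>H t\<bar> = \<bar>t\<bar> powr (\<kappa> + 1) / (\<kappa> + 1)"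
    "\<And>t. \<bar>H t\<bar> \<le> T powr \<kappa> * \<bar>t\<bar>"
    "\<forall>D. integrable (lebesgue_on \<Omega>) D \<longrightarrow> (\<forall>x. c * ((1 + \<bar>u x\<bar> powr (p - 1)) * \<bar>F (u x)\<bar>) \<le> D x) \<longrightarrow>
       (\<integral>\<^sup>+x. ennreal (\<bar>H (u x)\<bar> powr p) \<partial>lebesgue_on \<Omega>)
         \<le> ennreal ((sobolev_const DIM('a) p * (\<integral>x. D x \<partial>lebesgue_on \<Omega>)) powr (p / 2))"
proof -
  obtain F F' M H where F: "\<And>t. (F has_real_derivative F' t) (at t)" "F 0 = 0"
    "\<And>t. 0 \<le> F' t" "\<And>t. F' t \<le> T powr (2 * \<kappa>)"
    "\<And>a b. \<bar>F' a - F' b\<bar> \<le> M * \<bar>a - b\<bar>"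
    and H: "continuous_on UNIV H" "\<And>a b. (H a - H b)\<^sup>2 \<le> (a - b) * (F a - F b)"
    "\<And>t. \<bar>t\<bar> * \<bar>F t\<bar> \<le> (\<kappa> + 1) * (H t)\<^sup>2"
    "\<And>t. \<bar>F t\<bar> \<le> \<bar>t\<bar> powr (2 * \<kappa> + 1)"
    "\<And>t. \<bar>t\<bar> \<le> T \<Longrightarrow> \<bar>H t\<bar> = \<bar>t\<bar> powr (\<kappa> + 1) / (\<kappa> + 1)"
    "\<And>t. \<bar>H t\<bar> \<le> T powr \<kappa> * \<bar>t\<bar>"
    by (rule truncated_power_test_functions[OF T \<kappa>]) (rule that; assumption)
  have H0: "H 0 = 0" using H(6)[of 0] by simp
  have L: "\<bar>F' a\<bar> \<le> T powr (2 * \<kappa>)" for a using F(3,4)[of a] by simp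
  show ?thesis
  proof (rule that[OF H(1) H(3-6)], assumption, intro allI impI)
    fix D assume D: "integrable (lebesgue_on \<Omega>) D" and "\<forall>x. c * ((1 + \<bar>u x\<bar> powr (p - 1)) * \<bar>F (u x)\<bar>) \<le> D x"
    then have le: "c * ((1 + \<bar>u x\<bar> powr (p - 1)) * \<bar>F (u x)\<bar>) \<le> D x" for x by blast
    have D0: "0 \<le> D x" for x using c by (intro order_trans[OF _ le[of x]]) auto
    have "(\<integral>\<^sup>+x. ennreal \<bar>g x (u x) * F (u x)\<bar> \<partial>lebesgue_on \<Omega>) \<le> (\<integral>\<^sup>+x. ennreal (D x) \<partial>lebesgue_on \<Omega>)"
      using growth
    proof (intro nn_integral_mono_AE, eventually_elim)
      fix x assume "\<forall>t. \<bar>g x t\<bar> \<le> c * (1 + \<bar>t\<bar> powr (p - 1))"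
      then have "\<bar>g x (u x)\<bar> * \<bar>F (u x)\<bar> \<le> (c * (1 + \<bar>u x\<bar> powr (p - 1))) * \<bar>F (u x)\<bar>"
        by (intro mult_right_mono) auto
      also have "\<dots> \<le> D x" using le[of x] by (simp add: mult.assoc)
      finally show "ennreal \<bar>g x (u x) * F (u x)\<bar> \<le> ennreal (D x)" by (simp add: abs_mult ennreal_leI)
    qed
    also have "\<dots> = ennreal (\<integral>x. D x \<partial>lebesgue_on \<Omega>)" by (intro nn_integral_eq_integral D AE_I2 D0)
    finally show "(\<integral>\<^sup>+x. ennreal (\<bar>H (u x)\<bar> powr p) \<partial>lebesgue_on \<Omega>)
         \<le> ennreal ((sobolev_const DIM('a) p * (\<integral>x. D x \<partial>lebesgue_on \<Omega>)) powr (p / 2))"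
      by (rule energy_inequality[OF s p \<Omega> sol F(1,2,3) L F(5) H(1) H0 H(2)]) (use D0 in \<open>auto intro: Bochner_Integration.integral_nonneg\<close>)
  qed
qed

text \<open>Brezis--Kato: on \<open>\<bar>u\<bar> > R\<close> the critical part of the right-hand side is absorbed
  into the left-hand side.\<close>

lemma solution_integrable_powr:
  fixes \<kappa> :: real
  assumes \<kappa>: "1 / 2 \<le> \<kappa>"
  shows "integrable (lebesgue_on \<Omega>) (\<lambda>x. \<bar>u x\<bar> powr (p * (\<kappa> + 1)))"
proof -
  let ?M = "lebesgue_on \<Omega>"
  interpret finite_measure ?M by (rule finite_measure_lebesgue_on_bounded[OF \<Omega>])
  define K where "K = sobolev_const DIM('a) p"
  have K: "0 < K" unfolding K_def by (rule sobolev_const_pos)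
  define r where "r = 1 - 2 / p"
  have r: "0 < r" using p_gt_2 by (simp add: r_def)
  \<comment> \<open>Chosen so that the coefficient
    \<open>4 * K * c * (\<kappa> + 1) * \<epsilon> powr r\<close> of the term to be absorbed is
    exactly \<open>1 / 2\<close>.\<close>
  define \<epsilon> where "\<epsilon> = (1 / (8 * K * c * (\<kappa> + 1))) powr (1 / r)"
  have \<epsilon>: "0 < \<epsilon>" using K c \<kappa> by (simp add: \<epsilon>_def)
  have \<epsilon>r: "4 * K * c * (\<kappa> + 1) * \<epsilon> powr r = 1 / 2"
    using K c \<kappa> r by (simp add: \<epsilon>_def powr_powr)
  have up: "integrable ?M (\<lambda>x. \<bar>u x\<bar> powr p)"
    using sol by (intro X1_0_integrable_critical_powr[OF s p \<Omega>]) (simp add: weak_solution_def)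
  let ?tail = "\<lambda>R x. \<bar>u x\<bar> powr p * indicator {t. R < \<bar>t\<bar>} (u x)"
  have [measurable]: "{t::real. R < \<bar>t\<bar>} \<in> sets borel" for R by measurable
  have tail: "integrable ?M (?tail R)" for R
    by (rule Bochner_Integration.integrable_bound[OF up]) (auto simp: indicator_def)
  \<comment> \<open>The tails tend to 0 because \<open>\<bar>u\<bar> powr p\<close> is integrable.
    The threshold obtained from this depends on \<open>u\<close>, and so does the bound
    \<open>Z\<close> built from it; it does not depend on \<open>T\<close>.\<close>
  have "(\<lambda>N. \<integral>x. ?tail (real (Suc N)) x \<partial>?M) \<longlonglongrightarrow> (\<integral>x. 0 \<partial>?M)"
  proof (rule integral_dominated_convergence[OF _ _ up])
    show "AE x in ?M. (\<lambda>N. ?tail (real (Suc N)) x) \<longlonglongrightarrow> 0"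
    proof (intro AE_I2 tendsto_eventually)
      fix x
      obtain N0 where N0: "\<bar>u x\<bar> \<le> real N0" using real_arch_simple by blast
      show "\<forall>\<^sub>F N in sequentially. ?tail (real (Suc N)) x = 0"
        by (intro eventually_sequentiallyI[of N0]) (use N0 in \<open>auto simp: indicator_def\<close>)
    qed
  qed (auto simp: indicator_def)
  then have "\<forall>\<^sub>F N in sequentially. (\<integral>x. ?tail (real (Suc N)) x \<partial>?M) < \<epsilon>"
    using \<epsilon> by (simp add: order_tendsto_iff)
  then obtain N where N: "(\<integral>x. ?tail (real (Suc N)) x \<partial>?M) < \<epsilon>"
    by (auto simp: eventually_sequentially)
  define R where "R = real (Suc N)"
  have R: "1 \<le> R" by (simp add: R_def)
  define A where "A = (1 + R powr (p - 1)) * R powr (2 * \<kappa> + 1)"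
  have A: "0 \<le> A" by (simp add: A_def)
  define W where "W = measure ?M (space ?M)"
  define Z where "Z = (2 * K * c * A * W) powr (p / 2)"
  show ?thesis
  proof (rule truncation_limit(1)[where Z = Z])
    fix T :: real assume T: "0 < T"
    obtain F H where H: "continuous_on UNIV H"
      "\<And>t. \<bar>t\<bar> * \<bar>F t\<bar> \<le> (\<kappa> + 1) * (H t)\<^sup>2"
      "\<And>t. \<bar>F t\<bar> \<le> \<bar>t\<bar> powr (2 * \<kappa> + 1)"
      "\<And>t. \<bar>t\<bar> \<le> T \<Longrightarrow> \<bar>H t\<bar> = \<bar>t\<bar> powr (\<kappa> + 1) / (\<kappa> + 1)"
      "\<And>t. \<bar>H t\<bar> \<le> T powr \<kappa> * \<bar>t\<bar>"
      and en: "\<forall>D. integrable ?M D \<longrightarrow> (\<forall>x. c * ((1 + \<bar>u x\<bar> powr (p - 1)) * \<bar>F (u x)\<bar>) \<le> D x) \<longrightarrow>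
       (\<integral>\<^sup>+x. ennreal (\<bar>H (u x)\<bar> powr p) \<partial>?M) \<le> ennreal ((sobolev_const DIM('a) p * (\<integral>x. D x \<partial>?M)) powr (p / 2))"
      by (rule truncated_energy[OF T \<kappa>]) (rule that; assumption)
    have [measurable]: "H \<in> borel_measurable borel" using H(1) by (rule borel_measurable_continuous_onI)
    \<comment> \<open>Finiteness of the integral \<open>X\<close>, from the linear growth of the
      truncated \<open>H\<close>; half of \<open>X powr (2 / p)\<close> could not be subtracted
      otherwise.\<close>
    have Hp: "integrable ?M (\<lambda>x. \<bar>H (u x)\<bar> powr p)"
    proof (rule Bochner_Integration.integrable_bound)
      show "integrable ?M (\<lambda>x. (T powr \<kappa>) powr p * \<bar>u x\<bar> powr p)" using up by simp
      have "\<bar>H t\<bar> powr p \<le> (T powr \<kappa> * \<bar>t\<bar>) powr p" for t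
        using H(5) p_gt_2 by (intro powr_mono2) auto
      then show "AE x in ?M. norm (\<bar>H (u x)\<bar> powr p) \<le> norm ((T powr \<kappa>) powr p * \<bar>u x\<bar> powr p)"
        by (intro AE_I2) (simp add: powr_mult)
    qed measurable
    define X where "X = (\<integral>x. \<bar>H (u x)\<bar> powr p \<partial>?M)"
    have X0: "0 \<le> X" by (simp add: X_def)
    have nnX: "(\<integral>\<^sup>+x. ennreal (\<bar>H (u x)\<bar> powr p) \<partial>?M) = ennreal X"
      unfolding X_def by (intro nn_integral_eq_integral Hp) auto
    have "X \<le> Z"
    proof (cases "X = 0")
      case False
      with X0 have X: "0 < X" by simp
      \<comment> \<open>This value balances the two parts of the coming split:
        \<open>\<mu>\<^sup>2 * \<epsilon>\<close> and \<open>\<mu> powr (2 - p) * X\<close> both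
        equal \<open>X powr (2 / p) * \<epsilon> powr r\<close>, the bound Hoelder's inequality
        would give for a tail of mass \<epsilon>.\<close>
      define \<mu> where "\<mu> = (X / \<epsilon>) powr (1 / p)"
      have \<mu>: "0 < \<mu>" using X \<epsilon> by (simp add: \<mu>_def)
      have \<mu>2: "\<mu>\<^sup>2 * \<epsilon> = X powr (2 / p) * \<epsilon> powr r"
      proof -
        have "\<mu>\<^sup>2 = X powr (2 / p) / \<epsilon> powr (2 / p)"
        proof -
          have "\<mu>\<^sup>2 = \<mu> powr 2" using \<mu> by simp
          also have "\<dots> = (X / \<epsilon>) powr (2 / p)" by (simp add: \<mu>_def powr_powr)
          finally show ?thesis using X \<epsilon> by (simp add: powr_divide)
        qed
        then show ?thesis using \<epsilon> by (simp add: r_def powr_diff)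
      qed
      have "\<mu> powr p = X / \<epsilon>" using X \<epsilon> p_gt_2 by (simp add: \<mu>_def powr_powr)
      then have \<mu>p: "\<mu> powr (2 - p) * X = X powr (2 / p) * \<epsilon> powr r"
        unfolding \<mu>2[symmetric] using \<mu> X \<epsilon> by (simp add: powr_diff)
      define D where "D x = c * (A + 2 * (\<kappa> + 1) * (\<mu>\<^sup>2 * ?tail R x + \<mu> powr (2 - p) * \<bar>H (u x)\<bar> powr p))" for x
      have D: "integrable ?M D" unfolding D_def using tail Hp by auto
      have Dint: "(\<integral>x. D x \<partial>?M) = c * (A * W + 2 * (\<kappa> + 1) * (\<mu>\<^sup>2 * (\<integral>x. ?tail R x \<partial>?M) + \<mu> powr (2 - p) * X))"
        unfolding D_def using tail Hp by (simp add: W_def X_def mult.commute[of A])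
      have "ennreal X \<le> ennreal ((sobolev_const DIM('a) p * (\<integral>x. D x \<partial>?M)) powr (p / 2))"
        unfolding nnX[symmetric]
      proof (rule en[rule_format, OF D])
        fix x
        define t where "t = u x"
        have "(1 + \<bar>t\<bar> powr (p - 1)) * \<bar>F t\<bar>
          \<le> A + 2 * (\<kappa> + 1) * (\<mu>\<^sup>2 * (\<bar>t\<bar> powr p * indicator {t. R < \<bar>t\<bar>} t) + \<mu> powr (2 - p) * \<bar>H t\<bar> powr p)"
        proof (cases "R < \<bar>t\<bar>")
          case True
          have t: "1 < \<bar>t\<bar>" using True R by simp
          have "1 \<le> \<bar>t\<bar> powr (p - 1)" using t p_gt_2 by (intro ge_one_powr_ge_zero) auto
          then have "(1 + \<bar>t\<bar> powr (p - 1)) * \<bar>F t\<bar> \<le> (2 * \<bar>t\<bar> powr (p - 1)) * \<bar>F t\<bar>"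
            by (intro mult_right_mono) auto
          also have "\<dots> = 2 * \<bar>t\<bar> powr (p - 2) * (\<bar>t\<bar> * \<bar>F t\<bar>)"
            using t powr_add[of "\<bar>t\<bar>" "p - 2" 1] by simp
          also have "\<dots> \<le> 2 * \<bar>t\<bar> powr (p - 2) * ((\<kappa> + 1) * (H t)\<^sup>2)"
            by (intro mult_left_mono H(2)) auto
          also have "\<dots> = 2 * (\<kappa> + 1) * (\<bar>t\<bar> powr (p - 2) * \<bar>H t\<bar>\<^sup>2)" by simp
          \<comment> \<open>The splitting level is proportional to \<open>\<bar>t\<bar>\<close>;
            then the weight \<open>\<bar>t\<bar> powr (p - 2)\<close> turns the first part into the
            tail integrand and cancels completely in the second.\<close>
          also have "\<dots> \<le> 2 * (\<kappa> + 1) * (\<bar>t\<bar> powr (p - 2) * ((\<mu> * \<bar>t\<bar>)\<^sup>2 + (\<mu> * \<bar>t\<bar>) powr (2 - p) * \<bar>H t\<bar> powr p))"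
            using \<kappa> \<mu> t p_gt_2 by (intro mult_left_mono square_le_level_powr) auto
          also have "\<bar>t\<bar> powr (p - 2) * ((\<mu> * \<bar>t\<bar>)\<^sup>2 + (\<mu> * \<bar>t\<bar>) powr (2 - p) * \<bar>H t\<bar> powr p)
             = \<mu>\<^sup>2 * \<bar>t\<bar> powr p + \<mu> powr (2 - p) * \<bar>H t\<bar> powr p"
          proof -
            have "\<bar>t\<bar> powr (p - 2) * \<bar>t\<bar>\<^sup>2 = \<bar>t\<bar> powr p"
              using t powr_add[of "\<bar>t\<bar>" "p - 2" 2] by simp
            moreover have "\<bar>t\<bar> powr (p - 2) * \<bar>t\<bar> powr (2 - p) = 1"
              using t powr_add[of "\<bar>t\<bar>" "p - 2" "2 - p"] by (auto split: if_splits)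
            moreover have "(\<mu> * \<bar>t\<bar>) powr (2 - p) = \<mu> powr (2 - p) * \<bar>t\<bar> powr (2 - p)"
              using \<mu> by (simp add: powr_mult)
            moreover have "a * ((\<mu> * b)\<^sup>2 + (m * d) * k) = \<mu>\<^sup>2 * (a * b\<^sup>2) + m * (a * d) * k" for a b m d k :: real
              by (simp add: algebra_simps power_mult_distrib)
            ultimately show ?thesis by simp
          qed
          finally show ?thesis using True A by simp
        next
          case False
          then have t: "\<bar>t\<bar> \<le> R" by simp
          have "(1 + \<bar>t\<bar> powr (p - 1)) * \<bar>F t\<bar> \<le> (1 + R powr (p - 1)) * R powr (2 * \<kappa> + 1)"
            using t p_gt_2 \<kappa>
            by (intro mult_mono add_left_mono powr_mono2 order_trans[OF H(3)]) auto
          then show ?thesis using \<kappa> False by (simp add: A_def add_increasing2)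
        qed
        then show "c * ((1 + \<bar>u x\<bar> powr (p - 1)) * \<bar>F (u x)\<bar>) \<le> D x"
          unfolding D_def t_def[symmetric] using c by (intro mult_left_mono) auto
      qed
      then have X1: "X \<le> (K * (\<integral>x. D x \<partial>?M)) powr (p / 2)" unfolding K_def by simp
      have D0: "0 \<le> (\<integral>x. D x \<partial>?M)"
        using c A \<kappa> by (intro Bochner_Integration.integral_nonneg) (auto simp: D_def intro!: mult_nonneg_nonneg add_nonneg_nonneg)
      have "X powr (2 / p) \<le> ((K * (\<integral>x. D x \<partial>?M)) powr (p / 2)) powr (2 / p)"
        using X1 X p_gt_2 by (intro powr_mono2) auto
      also have "\<dots> = K * (\<integral>x. D x \<partial>?M)" using K D0 p_gt_2 by (simp add: powr_powr)
      also have "\<dots> \<le> K * (c * (A * W + 2 * (\<kappa> + 1) * (\<mu>\<^sup>2 * \<epsilon> + \<mu> powr (2 - p) * X)))"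
        unfolding Dint using K c \<kappa> N
        by (intro mult_left_mono add_left_mono add_right_mono) (auto simp: R_def)
      also have "\<dots> = K * c * A * W + (4 * K * c * (\<kappa> + 1) * \<epsilon> powr r) * X powr (2 / p)"
        unfolding \<mu>2 \<mu>p by (simp add: algebra_simps)
      also have "\<dots> = K * c * A * W + X powr (2 / p) / 2" unfolding \<epsilon>r by simp
      finally have "X powr (2 / p) \<le> 2 * K * c * A * W" by simp
      then have "(X powr (2 / p)) powr (p / 2) \<le> Z"
        unfolding Z_def using p_gt_2 by (intro powr_mono2) auto
      then show ?thesis using X p_gt_2 by (simp add: powr_powr)
    qed (simp add: Z_def)
    then have "(\<integral>\<^sup>+x. ennreal (\<bar>H (u x)\<bar> powr p) \<partial>?M) \<le> ennreal Z"
      unfolding nnX by (rule ennreal_leI)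
    then show "\<exists>H. continuous_on UNIV H \<and> (\<forall>t. \<bar>t\<bar> \<le> T \<longrightarrow> \<bar>H t\<bar> = \<bar>t\<bar> powr (\<kappa> + 1) / (\<kappa> + 1)) \<and>
        (\<integral>\<^sup>+x. ennreal (\<bar>H (u x)\<bar> powr p) \<partial>?M) \<le> ennreal Z"
      using H(1,4) by blast
  qed (use \<kappa> p_gt_2 in \<open>auto simp: Z_def\<close>)
qed

text \<open>The growth of \<open>g\<close> times \<open>\<bar>F\<bar>\<close> is at most of order
  \<open>\<bar>u\<bar> powr (p + 2 * \<kappa>)\<close> up to constants, which fixes the exponent on
  the right. Adding 1 to both integrals gives the step a purely multiplicative form with quantities
  at least 1, so logarithms can be iterated.\<close>

lemma moser_step:
  fixes \<kappa> :: real
  assumes \<kappa>: "1 / 2 \<le> \<kappa>" and J: "integrable (lebesgue_on \<Omega>) (\<lambda>x. \<bar>u x\<bar> powr (p + 2 * \<kappa>))"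
  defines "K' \<equiv> sobolev_const DIM('a) p * c * (measure lebesgue \<Omega> + 2)"
  shows "1 + (\<integral>x. \<bar>u x\<bar> powr (p * (\<kappa> + 1)) \<partial>lebesgue_on \<Omega>)
    \<le> ((\<kappa> + 1)\<^sup>2 * (1 + K') * (1 + (\<integral>x. \<bar>u x\<bar> powr (p + 2 * \<kappa>) \<partial>lebesgue_on \<Omega>))) powr (p / 2)"
proof -
  let ?M = "lebesgue_on \<Omega>"
  interpret finite_measure ?M by (rule finite_measure_lebesgue_on_bounded[OF \<Omega>])
  have W: "measure ?M (space ?M) = measure lebesgue \<Omega>"
    using \<Omega> by (simp add: measure_restrict_space)
  define J0 where "J0 = (\<integral>x. \<bar>u x\<bar> powr (p + 2 * \<kappa>) \<partial>?M)"
  have J0: "0 \<le> J0" by (simp add: J0_def)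
  define K where "K = sobolev_const DIM('a) p"
  have K: "0 < K" unfolding K_def by (rule sobolev_const_pos)
  have K'0: "0 \<le> K'" unfolding K'_def K_def[symmetric] using K c by simp
  \<comment> \<open>The lower power \<open>2 * \<kappa> + 1\<close> is absorbed into
    \<open>1 + \<bar>u x\<bar> powr (p + 2 * \<kappa>)\<close>, whence the coefficient 2;
    integrating over \<Omega> produces the factor \<open>measure lebesgue \<Omega> + 2\<close> in
    \<open>K'\<close>.\<close>
  define D where "D x = c * (1 + 2 * \<bar>u x\<bar> powr (p + 2 * \<kappa>))" for x
  have D: "integrable ?M D" unfolding D_def using J by auto
  have Dint: "K * (\<integral>x. D x \<partial>?M) \<le> K' * (1 + J0)"
  proof -
    have "(\<integral>x. D x \<partial>?M) = c * (measure lebesgue \<Omega> + 2 * J0)"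
      unfolding D_def using J W by (simp add: J0_def)
    also have "\<dots> \<le> c * ((measure lebesgue \<Omega> + 2) * (1 + J0))"
      using c J0 by (intro mult_left_mono) (auto simp: algebra_simps)
    finally show ?thesis
      using K by (simp add: K'_def K_def mult.assoc mult_left_mono)
  qed
  have D0: "0 \<le> (\<integral>x. D x \<partial>?M)" using c by (intro Bochner_Integration.integral_nonneg) (auto simp: D_def)
  have "(\<integral>x. \<bar>u x\<bar> powr (p * (\<kappa> + 1)) \<partial>?M) \<le> (\<kappa> + 1) powr p * ((K' * (1 + J0)) powr (p / 2))"
  proof (rule truncation_limit(2))
    fix T :: real assume T: "0 < T"
    obtain F H where H: "continuous_on UNIV H"
      "\<And>t. \<bar>F t\<bar> \<le> \<bar>t\<bar> powr (2 * \<kappa> + 1)"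
      "\<And>t. \<bar>t\<bar> \<le> T \<Longrightarrow> \<bar>H t\<bar> = \<bar>t\<bar> powr (\<kappa> + 1) / (\<kappa> + 1)"
      and en: "\<forall>D. integrable ?M D \<longrightarrow> (\<forall>x. c * ((1 + \<bar>u x\<bar> powr (p - 1)) * \<bar>F (u x)\<bar>) \<le> D x) \<longrightarrow>
       (\<integral>\<^sup>+x. ennreal (\<bar>H (u x)\<bar> powr p) \<partial>?M) \<le> ennreal ((sobolev_const DIM('a) p * (\<integral>x. D x \<partial>?M)) powr (p / 2))"
      by (rule truncated_energy[OF T \<kappa>]) (rule that; assumption)
    have "(\<integral>\<^sup>+x. ennreal (\<bar>H (u x)\<bar> powr p) \<partial>?M) \<le> ennreal ((K * (\<integral>x. D x \<partial>?M)) powr (p / 2))"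
      unfolding K_def
    proof (rule en[rule_format, OF D])
      fix x
      define t where "t = u x"
      have "(1 + \<bar>t\<bar> powr (p - 1)) * \<bar>F t\<bar> \<le> (1 + \<bar>t\<bar> powr (p - 1)) * \<bar>t\<bar> powr (2 * \<kappa> + 1)"
        by (intro mult_left_mono H(2)) auto
      also have "\<dots> = \<bar>t\<bar> powr (2 * \<kappa> + 1) + \<bar>t\<bar> powr (p + 2 * \<kappa>)"
        by (simp add: distrib_right add_ac flip: powr_add)
      also have "\<dots> \<le> 1 + 2 * \<bar>t\<bar> powr (p + 2 * \<kappa>)"
        using powr_le_one_plus_powr[of "\<bar>t\<bar>" "2 * \<kappa> + 1" "p + 2 * \<kappa>"] \<kappa> p_gt_2 by simp
      finally show "c * ((1 + \<bar>u x\<bar> powr (p - 1)) * \<bar>F (u x)\<bar>) \<le> D x"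
        unfolding D_def t_def using c by (intro mult_left_mono) auto
    qed
    also have "\<dots> \<le> ennreal ((K' * (1 + J0)) powr (p / 2))"
      using Dint K D0 p_gt_2 by (intro ennreal_leI powr_mono2) auto
    finally show "\<exists>H. continuous_on UNIV H \<and> (\<forall>t. \<bar>t\<bar> \<le> T \<longrightarrow> \<bar>H t\<bar> = \<bar>t\<bar> powr (\<kappa> + 1) / (\<kappa> + 1)) \<and>
        (\<integral>\<^sup>+x. ennreal (\<bar>H (u x)\<bar> powr p) \<partial>?M) \<le> ennreal ((K' * (1 + J0)) powr (p / 2))"
      using H(1,3) by blast
  qed (use \<kappa> p_gt_2 in auto)
  also have "(\<kappa> + 1) powr p = ((\<kappa> + 1)\<^sup>2) powr (p / 2)"
    using \<kappa> powr_powr[of "\<kappa> + 1" 2 "p / 2"] by simp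
  also have "\<dots> * (K' * (1 + J0)) powr (p / 2) = ((\<kappa> + 1)\<^sup>2 * (K' * (1 + J0))) powr (p / 2)"
    by (intro powr_mult[symmetric])
  finally have "1 + (\<integral>x. \<bar>u x\<bar> powr (p * (\<kappa> + 1)) \<partial>?M) \<le> 1 + ((\<kappa> + 1)\<^sup>2 * (K' * (1 + J0))) powr (p / 2)" by simp
  \<comment> \<open>Superadditivity of the power \<open>p / 2\<close>, which exceeds 1, moves the
    summand 1 under the power; replacing \<open>K'\<close> by \<open>1 + K'\<close> then removes
    it.\<close>
  also have "\<dots> \<le> (1 + (\<kappa> + 1)\<^sup>2 * (K' * (1 + J0))) powr (p / 2)"
    using K'0 J0 p_gt_2 by (intro one_plus_powr_le) auto
  also have "\<dots> \<le> ((\<kappa> + 1)\<^sup>2 * (1 + K') * (1 + J0)) powr (p / 2)"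
  proof (intro powr_mono2)
    have "1 * 1 \<le> (\<kappa> + 1)\<^sup>2 * (1 + J0)" using \<kappa> J0 by (intro mult_mono) auto
    then show "1 + (\<kappa> + 1)\<^sup>2 * (K' * (1 + J0)) \<le> (\<kappa> + 1)\<^sup>2 * (1 + K') * (1 + J0)"
      by (simp add: algebra_simps)
  qed (use p_gt_2 K'0 J0 in auto)
  finally show ?thesis by (simp add: J0_def)
qed

end

section \<open>The bound in the supremum norm\<close>

text \<open>Reduces every admissible \<open>q\<close> to the critical exponent at the price of
  doubling \<open>c\<close>, so that one constant serves all \<open>q\<close>.\<close>

lemma critical_growth:
  fixes c q p :: real
  assumes "0 \<le> c" "2 \<le> q" "q \<le> p" and "y \<le> c * (1 + \<bar>t\<bar> powr (q - 1))"
  shows "y \<le> 2 * c * (1 + \<bar>t\<bar> powr (p - 1))"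
proof -
  have "1 + \<bar>t\<bar> powr (q - 1) \<le> 2 * (1 + \<bar>t\<bar> powr (p - 1))"
  proof -
    have "\<bar>t\<bar> powr (q - 1) \<le> 1 + \<bar>t\<bar> powr (p - 1)"
      using assms(2,3) by (intro powr_le_one_plus_powr) auto
    moreover have "1 + a \<le> 2 * (1 + b)" if "a \<le> 1 + b" "0 \<le> b" for a b :: real
      using that by simp
    ultimately show ?thesis using powr_ge_zero by blast
  qed
  then have "c * (1 + \<bar>t\<bar> powr (q - 1)) \<le> c * (2 * (1 + \<bar>t\<bar> powr (p - 1)))"
    using assms(1) by (rule mult_left_mono)
  then show ?thesis using assms(4) by (simp add: mult_ac)
qed

text \<open>All ingredients of \<open>C\<close> are fixed before \<open>g\<close> and
  \<open>u\<close> appear. The Moser step becomes an affine recursion for \<open>ln (I k)\<close>,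
  whose growth rate \<open>\<theta> ^ k\<close> matches that of the exponents
  \<open>p * (\<kappa> k + 1)\<close>, so taking roots leaves a bound uniform in
  \<open>k\<close>.\<close>

lemma Linfty_bound:
  fixes s c p \<kappa>\<^sub>0 :: real and \<Omega> :: "'a::euclidean_space set"
  assumes s: "0 < s" "2 * s < real DIM('a)" and p: "p = critical_exponent DIM('a) s"
    and \<Omega>: "open \<Omega>" "bounded \<Omega>" and c: "0 < c"
  defines "\<kappa>\<^sub>0 \<equiv> (p - 1) / 2"
  shows "\<exists>C>0. \<forall>(g :: 'a \<Rightarrow> real \<Rightarrow> real) u. weak_solution s \<Omega> g u \<longrightarrow>
      (AE x in lebesgue_on \<Omega>. \<forall>t. \<bar>g x t\<bar> \<le> c * (1 + \<bar>t\<bar> powr (p - 1))) \<longrightarrow>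
      (AE x in lebesgue_on \<Omega>. \<bar>u x\<bar> \<le>
         C * (1 + (\<integral>x. \<bar>u x\<bar> powr (p * (\<kappa>\<^sub>0 + 1)) \<partial>lebesgue_on \<Omega>)) powr (1 / (p * \<kappa>\<^sub>0)))"
proof -
  let ?M = "lebesgue_on \<Omega>"
  define \<theta> where "\<theta> = p / 2"
  have p2: "2 < p" using critical_exponent_props(1)[OF s] p by simp
  have \<theta>: "1 < \<theta>" using p2 by (simp add: \<theta>_def)
  define \<kappa> where "\<kappa> k = \<theta> ^ k * \<kappa>\<^sub>0" for k :: nat
  have \<kappa>0: "1 / 2 \<le> \<kappa>\<^sub>0" using p2 by (simp add: \<kappa>\<^sub>0_def)
  have \<theta>k: "1 \<le> \<theta> ^ k" for k using \<theta> by simp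
  have \<kappa>k: "1 / 2 \<le> \<kappa> k" for k
    using mult_mono[OF \<theta>k[of k] \<kappa>0] \<theta> by (simp add: \<kappa>_def)
  define K' where "K' = sobolev_const DIM('a) p * c * (measure lebesgue \<Omega> + 2)"
  have K': "0 < K'" using sobolev_const_pos[of "DIM('a)" p] c unfolding K'_def
    by (intro mult_pos_pos add_nonneg_pos) auto
  \<comment> \<open>From \<open>\<kappa> (Suc k) + 1 \<le> \<theta> ^ k * (\<theta> *
    (\<kappa>\<^sub>0 + 1))\<close>: squaring and taking logarithms, \<open>b\<close> collects the
    growth linear in \<open>k\<close>, and \<open>B\<close> the rest together with
    \<open>1 + K'\<close>.\<close>
  define B where "B = ln ((\<theta> * (\<kappa>\<^sub>0 + 1))\<^sup>2 * (1 + K'))"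
  define b where "b = 2 * ln \<theta>"
  define \<alpha> where "\<alpha> = \<theta> * b / (\<theta> - 1)"
  define \<gamma> where "\<gamma> = (\<theta> * B + \<alpha>) / (\<theta> - 1)"
  define C where "C = exp (\<gamma> / (p * \<kappa>\<^sub>0))"
  have b0: "0 \<le> b" using \<theta> by (simp add: b_def)
  have B0: "0 \<le> B"
  proof -
    have "1 * 1 \<le> \<theta> * (\<kappa>\<^sub>0 + 1)" using \<theta> \<kappa>0 by (intro mult_mono) auto
    then have "1 * 1 \<le> (\<theta> * (\<kappa>\<^sub>0 + 1))\<^sup>2 * (1 + K')"
      using K' by (intro mult_mono one_le_power) auto
    then show ?thesis unfolding B_def by simp
  qed
  have \<alpha>0: "0 \<le> \<alpha>" using b0 \<theta> by (simp add: \<alpha>_def)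
  have \<gamma>0: "0 \<le> \<gamma>" using B0 \<alpha>0 \<theta> by (simp add: \<gamma>_def)
  show ?thesis
  proof (intro exI[of _ C] conjI allI impI)
    show "0 < C" by (simp add: C_def)
    fix g :: "'a \<Rightarrow> real \<Rightarrow> real" and u
    assume sol: "weak_solution s \<Omega> g u"
      and growth: "AE x in ?M. \<forall>t. \<bar>g x t\<bar> \<le> c * (1 + \<bar>t\<bar> powr (p - 1))"
    have um: "u \<in> borel_measurable ?M" by (rule weak_solution_measurable[OF sol])
    define I where "I k = 1 + (\<integral>x. \<bar>u x\<bar> powr (p * (\<kappa> k + 1)) \<partial>?M)" for k
    have int: "integrable ?M (\<lambda>x. \<bar>u x\<bar> powr (p * (\<kappa> k + 1)))" for k
      by (rule solution_integrable_powr[OF s p \<Omega> sol c growth \<kappa>k])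
    have I1: "1 \<le> I k" for k by (simp add: I_def)
    have step: "ln (I (Suc k)) \<le> \<theta> * (ln (I k) + B + real k * b)" for k
    proof -
      \<comment> \<open>The exponent entering step \<open>Suc k\<close> is the one produced by step
        \<open>k\<close>; this is where the ratio \<open>\<theta> = p / 2\<close> is used.\<close>
      have e: "p + 2 * \<kappa> (Suc k) = p * (\<kappa> k + 1)" by (simp add: \<kappa>_def \<theta>_def algebra_simps)
      have "I (Suc k) \<le> ((\<kappa> (Suc k) + 1)\<^sup>2 * (1 + K') * I k) powr \<theta>"
        using moser_step[OF s p \<Omega> sol c growth \<kappa>k[of "Suc k"]] int[of k]
        unfolding e I_def \<theta>_def K'_def by blast
      then have "ln (I (Suc k)) \<le> ln (((\<kappa> (Suc k) + 1)\<^sup>2 * (1 + K') * I k) powr \<theta>)"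
        using I1[of "Suc k"] by (intro ln_mono) auto
      also have "\<dots> = \<theta> * ln ((\<kappa> (Suc k) + 1)\<^sup>2 * (1 + K') * I k)"
        using I1[of k] K' \<kappa>k[of "Suc k"] by (simp add: ln_powr)
      also have "\<dots> \<le> \<theta> * ln ((\<theta> ^ k)\<^sup>2 * ((\<theta> * (\<kappa>\<^sub>0 + 1))\<^sup>2 * (1 + K')) * I k)"
      proof -
        have "\<kappa> (Suc k) + 1 \<le> \<theta> ^ k * (\<theta> * (\<kappa>\<^sub>0 + 1))"
          using \<theta>k[of "Suc k"] by (simp add: \<kappa>_def algebra_simps)
        then have "(\<kappa> (Suc k) + 1)\<^sup>2 \<le> (\<theta> ^ k * (\<theta> * (\<kappa>\<^sub>0 + 1)))\<^sup>2"
          using \<kappa>k[of "Suc k"] by (intro power_mono) auto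
        then have "(\<kappa> (Suc k) + 1)\<^sup>2 * ((1 + K') * I k) \<le> (\<theta> ^ k * (\<theta> * (\<kappa>\<^sub>0 + 1)))\<^sup>2 * ((1 + K') * I k)"
          using K' I1[of k] by (intro mult_right_mono) auto
        moreover have "0 < (\<kappa> (Suc k) + 1)\<^sup>2 * ((1 + K') * I k)"
          using K' I1[of k] \<kappa>k[of "Suc k"] by (intro mult_pos_pos zero_less_power) auto
        ultimately have "ln ((\<kappa> (Suc k) + 1)\<^sup>2 * ((1 + K') * I k)) \<le> ln ((\<theta> ^ k * (\<theta> * (\<kappa>\<^sub>0 + 1)))\<^sup>2 * ((1 + K') * I k))"
          by (intro ln_mono) auto
        then show ?thesis using \<theta> by (simp add: power_mult_distrib mult_ac)
      qed
      also have "ln ((\<theta> ^ k)\<^sup>2 * ((\<theta> * (\<kappa>\<^sub>0 + 1))\<^sup>2 * (1 + K')) * I k) = real k * b + B + ln (I k)"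
      proof -
        have pos: "0 < (\<theta> ^ k)\<^sup>2" "0 < (\<theta> * (\<kappa>\<^sub>0 + 1))\<^sup>2 * (1 + K')" "0 < I k"
          using \<theta> \<kappa>0 K' I1[of k] by auto
        have "ln ((\<theta> ^ k)\<^sup>2) = real k * b"
          using \<theta> by (simp add: b_def ln_realpow flip: power_mult)
        then show ?thesis using pos by (simp only: ln_mult_pos mult_pos_pos B_def)
      qed
      finally show ?thesis by (simp add: add_ac)
    qed
    have lnI: "ln (I k) \<le> \<theta> ^ k * (ln (I 0) + \<gamma>)" for k
    proof -
      have "ln (I k) + \<alpha> * real k + \<gamma> \<le> \<theta> ^ k * (ln (I 0) + \<gamma>)"
        unfolding \<alpha>_def \<gamma>_def by (rule affine_recursion_bound[where x = "\<lambda>k. ln (I k)", OF \<theta> step])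
      then show ?thesis using \<alpha>0 \<gamma>0 mult_nonneg_nonneg[OF \<alpha>0, of "real k"] by linarith
    qed
    \<comment> \<open>Defined so that \<open>(p * \<kappa> k) * ln S\<close> is exactly the bound
      \<open>\<theta> ^ k * (ln (I 0) + \<gamma>)\<close> on \<open>ln (I k)\<close>.\<close>
    define S where "S = C * I 0 powr (1 / (p * \<kappa>\<^sub>0))"
    have lnS: "ln S = (ln (I 0) + \<gamma>) / (p * \<kappa>\<^sub>0)"
      using I1[of 0] by (simp add: S_def C_def ln_mult_pos ln_powr add_divide_distrib)
    have lnI0: "0 \<le> ln (I 0)" using I1[of 0] by simp
    have S: "0 < S" using I1[of 0] by (simp add: S_def C_def)
    have lnS0: "0 \<le> ln S" unfolding lnS using lnI0 \<gamma>0 p2 \<kappa>0 by (intro divide_nonneg_nonneg add_nonneg_nonneg) auto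
    have "AE x in ?M. \<bar>u x\<bar> \<le> S"
    proof (rule AE_le_of_powr_integrals[OF um S, where m = "\<lambda>k. p * (\<kappa> k + 1)"])
      fix k
      show "0 < p * (\<kappa> k + 1)" using p2 \<kappa>k[of k] by (intro mult_pos_pos) auto
      have "(\<integral>\<^sup>+x. ennreal (\<bar>u x\<bar> powr (p * (\<kappa> k + 1))) \<partial>?M) = ennreal (I k - 1)"
        using nn_integral_eq_integral[OF int[of k]] by (simp add: I_def)
      also have "\<dots> \<le> ennreal (S powr (p * (\<kappa> k + 1)))"
      proof (rule ennreal_leI)
        have "ln (I k) \<le> \<theta> ^ k * (ln (I 0) + \<gamma>)" by (rule lnI)
        also have "\<dots> = (p * \<kappa> k) * ln S"
          unfolding lnS using p2 \<kappa>0 by (simp add: \<kappa>_def)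
        \<comment> \<open>The exponent of the integral is larger than \<open>p * \<kappa> k\<close>
          by \<open>p\<close>. The excess is harmless because \<open>S \<ge> 1\<close>, which rests
          on \<open>I 0 \<ge> 1\<close> and \<open>\<gamma> \<ge> 0\<close>.\<close>
        also have "\<dots> \<le> (p * (\<kappa> k + 1)) * ln S"
          using lnS0 p2 by (intro mult_right_mono) auto
        finally have "exp (ln (I k)) \<le> exp ((p * (\<kappa> k + 1)) * ln S)" by simp
        then show "I k - 1 \<le> S powr (p * (\<kappa> k + 1))"
          using S I1[of k] by (simp add: powr_def)
      qed
      finally show "(\<integral>\<^sup>+x. ennreal (\<bar>u x\<bar> powr (p * (\<kappa> k + 1))) \<partial>?M) \<le> ennreal (S powr (p * (\<kappa> k + 1)))" .
    next
      have "filterlim (\<lambda>k. \<theta> ^ k) at_top sequentially"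
        using \<theta> by (intro filterlim_at_infinity_imp_filterlim_at_top filterlim_realpow_sequentially_gt1) auto
      then have "filterlim (\<lambda>k. (p * \<kappa>\<^sub>0) * \<theta> ^ k) at_top sequentially"
        using p2 \<kappa>0 by (intro filterlim_tendsto_pos_mult_at_top[OF tendsto_const]) auto
      then show "filterlim (\<lambda>k. p * (\<kappa> k + 1)) at_top sequentially"
        by (rule filterlim_at_top_mono) (use p2 in \<open>auto simp: \<kappa>_def algebra_simps\<close>)
    qed
    then show "AE x in ?M. \<bar>u x\<bar> \<le> C * (1 + (\<integral>x. \<bar>u x\<bar> powr (p * (\<kappa>\<^sub>0 + 1)) \<partial>?M)) powr (1 / (p * \<kappa>\<^sub>0))"
      by (simp add: S_def I_def \<kappa>_def)
  qed
qed

theorem theorem1p1: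
  fixes s c :: real and \<Omega> :: "'a::euclidean_space set"
  defines "p \<equiv> critical_exponent DIM('a) s"
  defines "\<beta>\<^sub>1 \<equiv> (p + 1) / 2"
  assumes "0 < s" and "s < 1"
    and "real DIM('a) > 2 * s"
    and "open \<Omega>" and "bounded \<Omega>" and "C1_boundary \<Omega>"
    and "c > 0"
  shows "\<exists>C\<^sub>0>0. \<forall>(g :: 'a \<Rightarrow> real \<Rightarrow> real) q u.
           2 \<le> q \<and> q \<le> p \<and>
           (AE x in lebesgue_on \<Omega>. \<forall>t. \<bar>g x t\<bar> \<le> c * (1 + \<bar>t\<bar> powr (q - 1))) \<and>
           weak_solution s \<Omega> g u \<longrightarrow>
           u \<in> Linfty \<Omega> \<and>
           Linfty_norm \<Omega> u \<le>
             ereal (C\<^sub>0 * (1 + (\<integral>x. \<bar>u x\<bar> powr (p * \<beta>\<^sub>1) \<partial>lebesgue_on \<Omega>))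
                           powr (1 / (p * (\<beta>\<^sub>1 - 1))))"
proof -
  let ?M = "lebesgue_on \<Omega>"
  \<comment> \<open>Translates the starting index \<open>\<kappa>\<^sub>0\<close> of the iteration
    into \<open>\<beta>\<^sub>1\<close>.\<close>
  have e: "(p - 1) / 2 = \<beta>\<^sub>1 - 1" "\<beta>\<^sub>1 - 1 + 1 = \<beta>\<^sub>1"
    by (simp_all add: \<beta>\<^sub>1_def field_simps)
  have "0 < 2 * c" using \<open>c > 0\<close> by simp
  from Linfty_bound[OF \<open>0 < s\<close> \<open>real DIM('a) > 2 * s\<close> p_def[THEN meta_eq_to_obj_eq] \<open>open \<Omega>\<close> \<open>bounded \<Omega>\<close> this]
  obtain C where C: "C > 0" and bound: "\<forall>(g :: 'a \<Rightarrow> real \<Rightarrow> real) u. weak_solution s \<Omega> g u \<longrightarrow>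
      (AE x in ?M. \<forall>t. \<bar>g x t\<bar> \<le> 2 * c * (1 + \<bar>t\<bar> powr (p - 1))) \<longrightarrow>
      (AE x in ?M. \<bar>u x\<bar> \<le> C * (1 + (\<integral>x. \<bar>u x\<bar> powr (p * \<beta>\<^sub>1) \<partial>?M)) powr (1 / (p * (\<beta>\<^sub>1 - 1))))"
    unfolding e by (elim exE conjE) (rule that)
  show ?thesis
  proof (intro exI[of _ C] conjI allI impI; (elim conjE)?)
    show "0 < C" by (rule C)
    fix g :: "'a \<Rightarrow> real \<Rightarrow> real" and q u
    assume q: "2 \<le> q" "q \<le> p" and growth: "AE x in ?M. \<forall>t. \<bar>g x t\<bar> \<le> c * (1 + \<bar>t\<bar> powr (q - 1))"
      and sol: "weak_solution s \<Omega> g u"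
    let ?b = "C * (1 + (\<integral>x. \<bar>u x\<bar> powr (p * \<beta>\<^sub>1) \<partial>?M)) powr (1 / (p * (\<beta>\<^sub>1 - 1)))"
    have [measurable]: "u \<in> borel_measurable ?M" by (rule weak_solution_measurable[OF sol])
    have "AE x in ?M. \<forall>t. \<bar>g x t\<bar> \<le> 2 * c * (1 + \<bar>t\<bar> powr (p - 1))"
      using growth by eventually_elim (intro allI critical_growth[OF less_imp_le[OF \<open>c > 0\<close>] q], elim allE)
    then have "AE x in ?M. \<bar>u x\<bar> \<le> ?b" by (rule bound[rule_format, OF sol])
    then have "AE x in ?M. ereal \<bar>u x\<bar> \<le> ereal ?b" by eventually_elim simp
    then show le: "Linfty_norm \<Omega> u \<le> ereal ?b"
      unfolding Linfty_norm_def by (intro esssup_I) measurable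
    show "u \<in> Linfty \<Omega>"
      unfolding Linfty_def using le_less_trans[OF le, of \<infinity>] by simp
  qed
qed

end
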